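(* (A) Let $(C,d)$ be either (1) a nonempty bounded convex subset of an $L_p$ space over a measurable space with $1<p<\infty$ (with the metric induced by the norm), or (2) a bounded $\mathrm{CAT}(\kappa)$ space, $\kappa\in\mathbb{R}$, where if $\kappa>0$ it is assumed that $\operatorname{diam}(C)<\pi/(2\sqrt{\kappa})$, and suppose $\operatorname{diam}(C)>0$. Then $C$ has an explicit modulus of uniform betweenness, namely $$\Theta(\varepsilon,a,b)=\min\left\{a,\ \Phi\left(\min\left\{\tfrac{a\varepsilon}{8b},\tfrac a2\right\},b\right)\right\},$$ where, in case (1), $$\Phi(\varepsilon,b)=\frac{p-1}{8}\,\frac{\varepsilon^2}{b+\varepsilon}\ \text{ if } 1<p\le 2,\qquad \Phi(\varepsilon,b)=\frac{1}{p2^p}\,\frac{\varepsilon^p}{(b+\varepsilon)^{p-1}}\ \text{ if } 2<p<\infty,$$ and, in case (2), $$\Phi(\varepsilon,b)=\frac{c}{16}\,\frac{\varepsilon^2}{b+\varepsilon},$$ with $c=2$ if $\kappa\le 0$, and $c=(\pi-2\sqrt{\kappa}\,\rho)\tan(\sqrt{\kappa}\,\rho)$ for any fixed $0<\rho\le \pi/(2\sqrt{\kappa})-\operatorname{diam}(C)$ if $\kappa>0$. Consequently the following explicit rate of convergence holds in $C$. Let $D>0$, $b\ge\operatorname{diam}(C)$, let $N\in\mathbb{N}$ satisfy $b+1<ND$ (e.g. $N=\lceil (b+1)/D\rceil+1$), put $\Theta(\varepsilon):=\Theta(\varepsilon,\varepsilon,b)$ (which satisfies $\Theta(\varepsilon)\le\varepsilon$),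 and let $\Theta^{(N)}$ be the $N$-fold iterate of $\varepsilon\mapsto\Theta(\varepsilon)$. For $\varepsilon>0$ let $$\Omega(\varepsilon)=N+N\left\lceil\frac{b}{\Theta^{(N)}(\alpha)}\right\rceil,\qquad\text{where } 0<\alpha\le\min\left\{\tfrac1N,\tfrac{\varepsilon}{2},\tfrac D2\right\}.$$ Then for every Lion-Man game $\langle (M_n),(L_n)\rangle$ in $C$ with speed $D$, every $\varepsilon>0$ and every $n\ge\Omega(\varepsilon)$, $$d(L_n,M_n)<D+\varepsilon\qquad\text{and}\qquad d(L_{n+1},M_n)<\varepsilon .$$ In particular the lion always wins in $C$. (B) The lion also always wins when the Lion-Man game is played in a bounded convex subset of a uniformly convex normed space: for every $D>0$ and every Lion-Man game $\langle (M_n),(L_n)\rangle$ with speed $D$ in such a set, $\lim_{n\to\infty}d(L_{n+1},M_n)=0$.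
   Context: Lion-Man game with speed $D>0$ in a metric space $(X,d)$: a pair $\langle (M_n),(L_n)\rangle$ of sequences in $X$ such that for all $n\in\mathbb{N}=\{0,1,2,\dots\}$: $d(M_n,M_{n+1})\le D$, $d(L_{n+1},L_n)+d(L_{n+1},M_n)=d(L_n,M_n)$, and $d(L_n,L_{n+1})=\min\{D,d(L_n,M_n)\}$. The lion wins if $d(L_{n+1},M_n)\to0$. A function $\Theta:(0,\infty)^3\to(0,\infty)$ is a modulus of uniform betweenness for $(X,d)$ if for all $\varepsilon,a,b>0$ and all $x,y,z,w\in X$ whose distinct-point distances are all at least $a$ (i.e. $\inf\{d(u,v):u,v\in\{x,y,z,w\},u\neq v\}\ge a$) and with $\operatorname{diam}\{x,y,z,w\}\le b$, the inequalities $d(x,y)+d(y,z)\le d(x,z)+\theta$ and $d(y,z)+d(z,w)\le d(y,w)+\theta$ with $\theta=\Theta(\varepsilon,a,b)$ imply $d(x,z)+d(z,w)\le d(x,w)+\varepsilon$. A normed space is uniformly convex if for every $\varepsilon\in(0,2]$ there is $\delta>0$ such that $\|x\|\le1$, $\|y\|\le1$, $\|x-y\|\ge\varepsilon$ imply $\|(x+y)/2\|\le1-\delta$. $\mathrm{CAT}(\kappa)$ spaces are the usual geodesic spaces whose geodesic triangles are no thicker than comparison triangles in the model plane of constant curvature $\kappa$. Disregarding the quantitative aspect, the $\mathrm{CAT}(\kappa)$ case recovers previously known results (Alexander, Bishop and Ghrist) on the success of the lion in such spaces.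
   Formalization: In the modulus of uniform betweenness the points y and z are required to be distinct; with y = z (e.g. x = w ≠ y = z and ε < 2d(x,y)) the implication as literally written fails in every space of positive diameter. *)

theory Defs
  imports "HOL-Analysis.Analysis"
begin

section \<open>Metric notions\<close>

definition set_diam :: "'a set \<Rightarrow> ('a \<Rightarrow> 'a \<Rightarrow> real) \<Rightarrow> real" where
  "set_diam C d = (if C = {} then 0 else SUP (x, y) \<in> C \<times> C. d x y)"

text \<open>
  The four points may partly coincide; the lower bound \<open>a\<close> only concerns distinct points.
  The requirement \<open>y \<noteq> z\<close> removes the one degenerate coincidence for which the implication
  could never hold: if \<open>y = z\<close> then both hypotheses are trivially true, while
  the conclusion would be \<open>d x y + d y w \<le> d x w + \<epsilon>\<close> for arbitrary \<open>x, y, w\<close>.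
\<close>

definition uniform_betweenness_modulus ::
  "'a set \<Rightarrow> ('a \<Rightarrow> 'a \<Rightarrow> real) \<Rightarrow> (real \<Rightarrow> real \<Rightarrow> real \<Rightarrow> real) \<Rightarrow> bool" where
  "uniform_betweenness_modulus C d \<Theta> \<longleftrightarrow>
     (\<forall>\<epsilon> a b. 0 < \<epsilon> \<and> 0 < a \<and> 0 < b \<longrightarrow>
        0 < \<Theta> \<epsilon> a b \<and>
        (\<forall>x\<in>C. \<forall>y\<in>C. \<forall>z\<in>C. \<forall>w\<in>C.
           y \<noteq> z \<and>
           (\<forall>u\<in>{x, y, z, w}. \<forall>v\<in>{x, y, z, w}. u \<noteq> v \<longrightarrow> a \<le> d u v) \<and>
           (\<forall>u\<in>{x, y, z, w}. \<forall>v\<in>{x, y, z, w}. d u v \<le> b) \<and>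
           d x y + d y z \<le> d x z + \<Theta> \<epsilon> a b \<and>
           d y z + d z w \<le> d y w + \<Theta> \<epsilon> a b
           \<longrightarrow> d x z + d z w \<le> d x w + \<epsilon>))"

section \<open>The Lion-Man game\<close>

definition lion_man_game ::
  "'a set \<Rightarrow> ('a \<Rightarrow> 'a \<Rightarrow> real) \<Rightarrow> real \<Rightarrow> (nat \<Rightarrow> 'a) \<Rightarrow> (nat \<Rightarrow> 'a) \<Rightarrow> bool" where
  "lion_man_game C d D M L \<longleftrightarrow>
     (\<forall>n. M n \<in> C \<and> L n \<in> C \<and>
          d (M n) (M (Suc n)) \<le> D \<and>
          d (L (Suc n)) (L n) + d (L (Suc n)) (M n) = d (L n) (M n) \<and>
          d (L n) (L (Suc n)) = min D (d (L n) (M n)))"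

definition lion_wins ::
  "('a \<Rightarrow> 'a \<Rightarrow> real) \<Rightarrow> (nat \<Rightarrow> 'a) \<Rightarrow> (nat \<Rightarrow> 'a) \<Rightarrow> bool" where
  "lion_wins d M L \<longleftrightarrow> (\<lambda>n. d (L (Suc n)) (M n)) \<longlonglongrightarrow> 0"

definition lion_always_wins :: "'a set \<Rightarrow> ('a \<Rightarrow> 'a \<Rightarrow> real) \<Rightarrow> bool" where
  "lion_always_wins C d \<longleftrightarrow>
     (\<forall>D>0. \<forall>M L. lion_man_game C d D M L \<longrightarrow> lion_wins d M L)"

section \<open>Explicit moduli and rates\<close>

definition Theta_of ::
  "(real \<Rightarrow> real \<Rightarrow> real) \<Rightarrow> real \<Rightarrow> real \<Rightarrow> real \<Rightarrow> real" where
  "Theta_of \<Phi> \<epsilon> a b = min a (\<Phi> (min (a * \<epsilon> / (8 * b)) (a / 2)) b)"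

definition Phi_Lp :: "real \<Rightarrow> real \<Rightarrow> real \<Rightarrow> real" where
  "Phi_Lp p \<epsilon> b =
     (if p \<le> 2 then (p - 1) / 8 * (\<epsilon>\<^sup>2 / (b + \<epsilon>))
      else 1 / (p * 2 powr p) * (\<epsilon> powr p / (b + \<epsilon>) powr (p - 1)))"

definition Phi_CAT :: "real \<Rightarrow> real \<Rightarrow> real \<Rightarrow> real" where
  "Phi_CAT c \<epsilon> b = c / 16 * (\<epsilon>\<^sup>2 / (b + \<epsilon>))"

definition Omega ::
  "(real \<Rightarrow> real \<Rightarrow> real \<Rightarrow> real) \<Rightarrow> real \<Rightarrow> nat \<Rightarrow> real \<Rightarrow> nat" where
  "Omega \<Theta> b N \<alpha> = N + N * nat \<lceil>b / ((\<lambda>e. \<Theta> e e b) ^^ N) \<alpha>\<rceil>"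

definition explicit_rate ::
  "'a set \<Rightarrow> ('a \<Rightarrow> 'a \<Rightarrow> real) \<Rightarrow> (real \<Rightarrow> real \<Rightarrow> real \<Rightarrow> real) \<Rightarrow> bool" where
  "explicit_rate C d \<Theta> \<longleftrightarrow>
     (\<forall>D b. 0 < D \<and> set_diam C d \<le> b \<longrightarrow>
        (\<forall>\<epsilon>>0. \<Theta> \<epsilon> \<epsilon> b \<le> \<epsilon>) \<and>
        b + 1 < real (nat \<lceil>(b + 1) / D\<rceil> + 1) * D \<and>
        (\<forall>N::nat. b + 1 < real N * D \<longrightarrow>
          (\<forall>M L. lion_man_game C d D M L \<longrightarrow>
            (\<forall>\<epsilon> \<alpha>. 0 < \<epsilon> \<and> 0 < \<alpha> \<and> \<alpha> \<le> Min {1 / real N, \<epsilon> / 2, D / 2} \<longrightarrow>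
              (\<forall>n \<ge> Omega \<Theta> b N \<alpha>.
                 d (L n) (M n) < D + \<epsilon> \<and> d (L (Suc n)) (M n) < \<epsilon>)))))"

section \<open>Lp spaces\<close>

text \<open>Elements of the space are classes of real-valued functions modulo equality a.e.\<close>

definition Lp_functions :: "'x measure \<Rightarrow> real \<Rightarrow> ('x \<Rightarrow> real) set" where
  "Lp_functions M p = {f \<in> borel_measurable M. integrable M (\<lambda>x. \<bar>f x\<bar> powr p)}"

definition Lp_class :: "'x measure \<Rightarrow> ('x \<Rightarrow> real) \<Rightarrow> ('x \<Rightarrow> real) set" where
  "Lp_class M f = {g \<in> borel_measurable M. AE x in M. g x = f x}"

definition Lp_space :: "'x measure \<Rightarrow> real \<Rightarrow> ('x \<Rightarrow> real) set set" where
  "Lp_space M p = Lp_class M ` Lp_functions M p"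

definition Lp_rep :: "('x \<Rightarrow> real) set \<Rightarrow> 'x \<Rightarrow> real" where
  "Lp_rep F = (SOME f. f \<in> F)"

definition Lp_dist ::
  "'x measure \<Rightarrow> real \<Rightarrow> ('x \<Rightarrow> real) set \<Rightarrow> ('x \<Rightarrow> real) set \<Rightarrow> real" where
  "Lp_dist M p F G = (\<integral>x. \<bar>Lp_rep F x - Lp_rep G x\<bar> powr p \<partial>M) powr (1 / p)"

definition Lp_convex :: "'x measure \<Rightarrow> ('x \<Rightarrow> real) set set \<Rightarrow> bool" where
  "Lp_convex M C \<longleftrightarrow>
     (\<forall>F\<in>C. \<forall>G\<in>C. \<forall>t\<in>{0..1}.
        Lp_class M (\<lambda>x. (1 - t) * Lp_rep F x + t * Lp_rep G x) \<in> C)"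

text \<open>The choice of representatives is immaterial.\<close>

lemma Lp_rep_class:
  assumes "f \<in> borel_measurable M"
  shows "Lp_rep (Lp_class M f) \<in> borel_measurable M"
    and "AE x in M. Lp_rep (Lp_class M f) x = f x"
proof -
  have "f \<in> Lp_class M f"
    using assms by (simp add: Lp_class_def)
  then have "Lp_rep (Lp_class M f) \<in> Lp_class M f"
    unfolding Lp_rep_def by (rule someI[where P = "\<lambda>h. h \<in> Lp_class M f"])
  then show "Lp_rep (Lp_class M f) \<in> borel_measurable M"
    and "AE x in M. Lp_rep (Lp_class M f) x = f x"
    by (auto simp: Lp_class_def)
qed

lemma Lp_dist_class:
  assumes "f \<in> borel_measurable M" "g \<in> borel_measurable M"
  shows "Lp_dist M p (Lp_class M f) (Lp_class M g) =
           (\<integral>x. \<bar>f x - g x\<bar> powr p \<partial>M) powr (1 / p)"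
proof -
  note [measurable] = assms Lp_rep_class(1)[OF assms(1)] Lp_rep_class(1)[OF assms(2)]
  have "(\<integral>x. \<bar>Lp_rep (Lp_class M f) x - Lp_rep (Lp_class M g) x\<bar> powr p \<partial>M) =
        (\<integral>x. \<bar>f x - g x\<bar> powr p \<partial>M)"
  proof (rule integral_cong_AE)
    show "AE x in M. \<bar>Lp_rep (Lp_class M f) x - Lp_rep (Lp_class M g) x\<bar> powr p =
                     \<bar>f x - g x\<bar> powr p"
      using Lp_rep_class(2)[OF assms(1)] Lp_rep_class(2)[OF assms(2)] by eventually_elim simp
  qed measurable
  then show ?thesis
    by (simp add: Lp_dist_def)
qed

section \<open>CAT spaces\<close>

definition geodesic_segment ::
  "'a set \<Rightarrow> ('a \<Rightarrow> 'a \<Rightarrow> real) \<Rightarrow> 'a \<Rightarrow> 'a \<Rightarrow> 'a set \<Rightarrow> bool" where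
  "geodesic_segment X d x y S \<longleftrightarrow>
     (\<exists>c. c ` {0..d x y} = S \<and> S \<subseteq> X \<and> c 0 = x \<and> c (d x y) = y \<and>
          (\<forall>s\<in>{0..d x y}. \<forall>t\<in>{0..d x y}. d (c s) (c t) = \<bar>s - t\<bar>))"

text \<open>
  The model plane of curvature \<open>\<kappa>\<close>: the unit sphere, a Euclidean plane, or the hyperboloid model
  of the hyperbolic plane, with the distance scaled by \<open>1 / sqrt \<bar>\<kappa>\<bar>\<close> if \<open>\<kappa> \<noteq> 0\<close>.
\<close>

definition model_plane :: "real \<Rightarrow> (real \<times> real \<times> real) set" where
  "model_plane \<kappa> =
     (if \<kappa> > 0 then sphere 0 1
      else if \<kappa> = 0 then {(x, y, z). z = 0}
      else {(x, y, z). 0 < z \<and> z\<^sup>2 - x\<^sup>2 - y\<^sup>2 = 1})"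

definition model_dist ::
  "real \<Rightarrow> (real \<times> real \<times> real) \<Rightarrow> (real \<times> real \<times> real) \<Rightarrow> real" where
  "model_dist \<kappa> u v =
     (if \<kappa> > 0 then arccos (u \<bullet> v) / sqrt \<kappa>
      else if \<kappa> = 0 then dist u v
      else (case (u, v) of ((x, y, z), (x', y', z')) \<Rightarrow>
              arcosh (z * z' - x * x' - y * y') / sqrt (- \<kappa>)))"

text \<open>Vertices \<open>v 0, v 1, v 2\<close>; the side \<open>S i\<close> joins \<open>v i\<close> to its cyclic successor.\<close>

definition geodesic_triangle ::
  "'a set \<Rightarrow> ('a \<Rightarrow> 'a \<Rightarrow> real) \<Rightarrow> (nat \<Rightarrow> 'a) \<Rightarrow> (nat \<Rightarrow> 'a set) \<Rightarrow> bool" where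
  "geodesic_triangle X d v S \<longleftrightarrow>
     (\<forall>i<3. v i \<in> X \<and> geodesic_segment X d (v i) (v (Suc i mod 3)) (S i))"

definition comparison_triangle ::
  "real \<Rightarrow> ('a \<Rightarrow> 'a \<Rightarrow> real) \<Rightarrow> (nat \<Rightarrow> 'a) \<Rightarrow>
   (nat \<Rightarrow> real \<times> real \<times> real) \<Rightarrow> (nat \<Rightarrow> (real \<times> real \<times> real) set) \<Rightarrow> bool" where
  "comparison_triangle \<kappa> d v v' S' \<longleftrightarrow>
     geodesic_triangle (model_plane \<kappa>) (model_dist \<kappa>) v' S' \<and>
     (\<forall>i<3. model_dist \<kappa> (v' i) (v' (Suc i mod 3)) = d (v i) (v (Suc i mod 3)))"

text \<open>
  For \<open>\<kappa> > 0\<close>, geodesics are only required between points at distance less than the diameter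
  \<open>pi / sqrt \<kappa>\<close> of the model plane, and only triangles of perimeter less than twice that
  diameter are compared; these have a comparison triangle, unique up to isometry.
\<close>

definition CAT_space :: "real \<Rightarrow> 'a set \<Rightarrow> ('a \<Rightarrow> 'a \<Rightarrow> real) \<Rightarrow> bool" where
  "CAT_space \<kappa> X d \<longleftrightarrow>
     Metric_space X d \<and>
     (\<forall>x\<in>X. \<forall>y\<in>X. (\<kappa> > 0 \<longrightarrow> d x y < pi / sqrt \<kappa>) \<longrightarrow> (\<exists>S. geodesic_segment X d x y S)) \<and>
     (\<forall>v S v' S'.
        geodesic_triangle X d v S \<and>
        (\<kappa> > 0 \<longrightarrow> (\<Sum>i<3. d (v i) (v (Suc i mod 3))) < 2 * (pi / sqrt \<kappa>)) \<and>
        comparison_triangle \<kappa> d v v' S' \<longrightarrow>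
        (\<forall>i<3. \<forall>j<3. \<forall>p\<in>S i. \<forall>q\<in>S j. \<forall>p'\<in>S' i. \<forall>q'\<in>S' j.
           model_dist \<kappa> (v' i) p' = d (v i) p \<and> model_dist \<kappa> (v' j) q' = d (v j) q
           \<longrightarrow> d p q \<le> model_dist \<kappa> p' q'))"

section \<open>Uniformly convex normed spaces\<close>

definition uniformly_convex :: "'v::real_normed_vector itself \<Rightarrow> bool" where
  "uniformly_convex _ \<longleftrightarrow>
     (\<forall>\<epsilon>. 0 < \<epsilon> \<and> \<epsilon> \<le> 2 \<longrightarrow>
        (\<exists>\<delta>>0. \<forall>x y :: 'v. norm x \<le> 1 \<and> norm y \<le> 1 \<and> norm (x - y) \<ge> \<epsilon> \<longrightarrow>
           norm ((1 / 2) *\<^sub>R (x + y)) \<le> 1 - \<delta>))"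

end

(*
  Let r_n = d(L_n, M_n). Then max(r_n, D) is nonincreasing, so if the lion stays farther than
  D + epsilon from the man for a long time, r_n is almost constant on some block of length N.
  There L_n, L_{n+1}, M_n are collinear and L_{n+1}, M_n, M_{n+1} almost collinear. The betweenness
  property, applied to the quadruple L_n, L_{n+1}, M_{n+k}, M_{n+k+1} and to its reversal, carries
  both relations from k to k+1, at the price of one application of the modulus. After N steps
  d(L_n, M_{n+N}) > b, a contradiction.

  Betweenness needs two facts: distance functions are convex along geodesics, and y is close to the
  point m dividing the geodesic from x to z in the ratio d(x,y) : d(y,z) as soon as
  d(x,y) + d(y,z) is close to d(x,z). For the second fact, the midpoint u of y and m is closer to
  x and to z than y is, by an amount controlled by uniform convexity, while
  d(x,z) <= d(x,u) + d(u,z).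

  In L_p, uniform convexity comes from a pointwise inequality (p <= 2, together with Hoelder) or
  from Clarkson's inequality (p > 2). In a CAT(kappa) space both facts follow from a bound on the
  distance of a vertex to the midpoint of the opposite side. For a model triangle with sides a, b
  and base l, put p = (a+b)/2, q = (a-b)/2, r = l/2 and let s be the median; then
  cos p cos q = cos r cos s, s^2 = p^2 + q^2 - r^2 or cosh p cosh q = cosh r cosh s
  (curvature 1, 0, -1), and the bound is a one-variable inequality.
*)
theory Submission
  imports Defs
begin

text \<open>The separation of points shapes the argument on the game. A modulus speaks only of
  quadruples whose distinct points are at least \<open>a\<close> apart, so the induction carries
  lower bounds on distances together with the two collinearity relations. Each of its steps trades
  an error \<open>T e\<close> for \<open>e\<close>, so it has to start from
  \<open>(T ^^ N) \<alpha>\<close> in order to end at \<open>\<alpha>\<close>. The N lion steps then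
  lose at most \<open>N * \<alpha> \<le> 1\<close> in total, which is the 1 in
  \<open>b + 1 < N * D\<close>. On the geometric side, betweenness first comes out multiplied by the
  factor 1 - t, with t = d x y / (d x y + d y z). Dividing by it costs at most 2b / a, whence the
  quotient by \<open>8 * b\<close> in \<open>Theta_of\<close>. In the power-type moduli
  \<open>b + \<epsilon>\<close> bounds the radii d x y and d y z, and since both radii shrink at
  once the modulus may carry twice the constant of the convexity estimate.\<close>

section \<open>From uniform convexity to uniform betweenness\<close>

text \<open>
  Taking \<open>w = x\<close> and \<open>w = z\<close> shows that such an \<open>m\<close> lies at distance at most
  \<open>t * d x z\<close> from \<open>x\<close> and at most \<open>(1 - t) * d x z\<close> from \<open>z\<close>.
\<close>

definition conv_point :: "'a set \<Rightarrow> ('a \<Rightarrow> 'a \<Rightarrow> real) \<Rightarrow> 'a \<Rightarrow> 'a \<Rightarrow> real \<Rightarrow> 'a \<Rightarrow> bool" where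
  "conv_point C d x z t m \<longleftrightarrow> m \<in> C \<and> (\<forall>w\<in>C. d w m \<le> (1 - t) * d w x + t * d w z)"

text \<open>Quantified uniqueness of geodesics, and the interface between geometry and game: each of
  the three settings only has to supply such a \<open>\<Phi>\<close>. The bound
  \<open>\<Phi> e b \<le> e\<close> also takes care of quadruples with \<open>x = y\<close>, which
  the implication leaves out.\<close>

definition uniqueness_modulus ::
  "'a set \<Rightarrow> ('a \<Rightarrow> 'a \<Rightarrow> real) \<Rightarrow> (real \<Rightarrow> real \<Rightarrow> real) \<Rightarrow> bool" where
  "uniqueness_modulus C d \<Phi> \<longleftrightarrow>
     (\<forall>e b. 0 < e \<and> 0 < b \<longrightarrow>
        0 < \<Phi> e b \<and> \<Phi> e b \<le> e \<and>
        (\<forall>x\<in>C. \<forall>y\<in>C. \<forall>z\<in>C.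
           x \<noteq> y \<and> y \<noteq> z \<and> d x y \<le> b \<and> d y z \<le> b \<and> d x z \<le> b \<and>
           d x y + d y z \<le> d x z + \<Phi> e b
           \<longrightarrow> (\<exists>m. conv_point C d x z (d x y / (d x y + d y z)) m \<and> d y m \<le> e)))"

lemma uniqueness_modulusD:
  assumes "uniqueness_modulus C d \<Phi>" "0 < e" "0 < b"
  shows "0 < \<Phi> e b" "\<Phi> e b \<le> e"
    and "\<And>x y z. x \<in> C \<Longrightarrow> y \<in> C \<Longrightarrow> z \<in> C \<Longrightarrow> x \<noteq> y \<Longrightarrow> y \<noteq> z \<Longrightarrow>
           d x y \<le> b \<Longrightarrow> d y z \<le> b \<Longrightarrow> d x z \<le> b \<Longrightarrow> d x y + d y z \<le> d x z + \<Phi> e b \<Longrightarrow>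
           \<exists>m. conv_point C d x z (d x y / (d x y + d y z)) m \<and> d y m \<le> e"
  using assms unfolding uniqueness_modulus_def by simp_all

lemma ratio_bounds:
  fixes a b :: real
  assumes "0 < a" "0 < b"
  shows "0 \<le> a / (a + b)" "a / (a + b) \<le> 1" "a / (a + b) * (a + b) = a"
    "(1 - a / (a + b)) * (a + b) = b"
  using assms by (auto simp: field_simps)

text \<open>Replace \<open>y\<close> by the point \<open>m\<close> between \<open>x\<close> and
  \<open>z\<close> that is within \<open>e\<close> of it. Convexity bounds \<open>d m w\<close> by
  \<open>(1 - t) * d x w + t * d z w\<close>; the last term cancels against part of
  \<open>d z w\<close>, and what remains is the claim multiplied by \<open>1 - t\<close>, up to
  \<open>2 * e\<close>.\<close>

lemma uniform_betweenness_Theta_of: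
  assumes "Metric_space C d" and modulus: "uniqueness_modulus C d \<Phi>"
  shows "uniform_betweenness_modulus C d (Theta_of \<Phi>)"
  unfolding uniform_betweenness_modulus_def
proof (intro allI impI conjI ballI)
  interpret Metric_space C d by fact
  fix \<epsilon> a b :: real
  assume pos: "0 < \<epsilon> \<and> 0 < a \<and> 0 < b"
  define e where "e = min (a * \<epsilon> / (8 * b)) (a / 2)"
  have e: "0 < e" using pos by (simp add: e_def)
  have \<theta>: "Theta_of \<Phi> \<epsilon> a b = min a (\<Phi> e b)" by (simp add: Theta_of_def e_def)
  have \<Phi>: "0 < \<Phi> e b" "\<Phi> e b \<le> e"
    using uniqueness_modulusD[OF modulus e] pos by auto
  then show "0 < Theta_of \<Phi> \<epsilon> a b" using pos \<theta> by simp
  fix x y z w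
  assume C: "x \<in> C" "y \<in> C" "z \<in> C" "w \<in> C"
  assume H: "y \<noteq> z \<and>
        (\<forall>u\<in>{x, y, z, w}. \<forall>v\<in>{x, y, z, w}. u \<noteq> v \<longrightarrow> a \<le> d u v) \<and>
        (\<forall>u\<in>{x, y, z, w}. \<forall>v\<in>{x, y, z, w}. d u v \<le> b) \<and>
        d x y + d y z \<le> d x z + Theta_of \<Phi> \<epsilon> a b \<and>
        d y z + d z w \<le> d y w + Theta_of \<Phi> \<epsilon> a b"
  have yz: "a \<le> d y z" using H by blast
  have le_b: "d x y \<le> b" "d y z \<le> b" "d x z \<le> b" using H by blast+
  have "d x y + d y z \<le> d x z + min a (\<Phi> e b)" "d y z + d z w \<le> d y w + min a (\<Phi> e b)"
    using H unfolding \<theta> by blast+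
  then have xyz: "d x y + d y z \<le> d x z + \<Phi> e b" and yzw: "d y z + d z w \<le> d y w + \<Phi> e b"
    by linarith+
  show "d x z + d z w \<le> d x w + \<epsilon>"
  proof (cases "x = y")
    \<comment> \<open>The uniqueness modulus is silent here, but the second hypothesis is now the
      claim up to \<open>\<Phi> e b \<le> e\<close>, and \<open>a \<le> d y z \<le> b\<close> gives
      \<open>e \<le> \<epsilon>\<close>.\<close>
    case True
    have "a * \<epsilon> / (8 * b) \<le> b * \<epsilon> / (8 * b)"
      using yz le_b pos by (intro divide_right_mono mult_right_mono) auto
    also have "\<dots> \<le> \<epsilon>" using pos by simp
    finally have "e \<le> \<epsilon>" by (simp add: e_def)
    then show ?thesis using True yzw \<Phi> by simp
  next
    case False
    define t where "t = d x y / (d x y + d y z)"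
    obtain m where m: "conv_point C d x z t m" and ym: "d y m \<le> e"
      using uniqueness_modulusD(3)[OF modulus e, of b x y z] pos C H le_b xyz False
      unfolding t_def by blast
    have dpos: "0 < d x y + d y z" using yz pos nonneg[of x y] by linarith
    have t1: "1 - t = d y z / (d x y + d y z)" using dpos by (simp add: t_def field_simps)
    have "a / (2 * b) \<le> d y z / (d x y + d y z)"
      using dpos yz le_b pos by (intro frac_le) auto
    then have t: "a / (2 * b) \<le> 1 - t" using t1 by simp
    have tpos: "0 < 1 - t" using t pos by (smt (verit) divide_pos_pos)
    have yz_eq: "d y z = (1 - t) * (d x y + d y z)" using t1 dpos by simp
    have "(1 - t) * d x z \<le> (1 - t) * (d x y + d y z)"
      using tpos triangle C by (intro mult_left_mono) auto
    then have yz_ge: "(1 - t) * d x z \<le> d y z" using yz_eq by simp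
    have "d y w \<le> d y m + d m w"
      using triangle C m by (auto simp: conv_point_def)
    also have "d m w \<le> (1 - t) * d x w + t * d z w"
      using m C commute by (metis conv_point_def)
    finally have "(1 - t) * d x z + d z w \<le> (1 - t) * d x w + t * d z w + 2 * e"
      using yzw yz_ge ym \<Phi> by linarith
    then have "(1 - t) * (d x z + d z w) \<le> (1 - t) * d x w + 2 * e"
      by (simp add: algebra_simps)
    also have "2 * e \<le> 2 * (a * \<epsilon> / (8 * b))"
      by (intro mult_left_mono) (simp_all add: e_def)
    also have "\<dots> \<le> (a / (2 * b)) * \<epsilon>" using pos by (simp add: field_simps)
    also have "\<dots> \<le> (1 - t) * \<epsilon>" using t pos by (intro mult_right_mono) auto
    finally have "(1 - t) * (d x z + d z w) \<le> (1 - t) * (d x w + \<epsilon>)"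
      by (simp add: algebra_simps)
    then show ?thesis using tpos by simp
  qed
qed

text \<open>The \<open>u\<close> in \<open>uc\<close> plays the midpoint of \<open>y\<close> and
  \<open>m\<close>. It must not depend on the centre \<open>x\<close>, because it is used for two
  balls, around \<open>x\<close> and around \<open>z\<close>, each with \<open>y\<close> on its
  boundary and \<open>m\<close> inside. The triangle inequality through \<open>u\<close> bounds the
  sum of the two gains by the excess \<open>\<Phi> e b\<close>; hence \<open>k' \<le> 2 * k\<close>.
  The power of \<open>s\<close> makes \<open>uc\<close> homogeneous.\<close>

lemma power_type_uniqueness_modulus:
  fixes k k' q :: real
  assumes "Metric_space C d"
    and conv: "\<And>x z t. x \<in> C \<Longrightarrow> z \<in> C \<Longrightarrow> 0 \<le> t \<Longrightarrow> t \<le> 1 \<Longrightarrow> \<exists>m. conv_point C d x z t m"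
    and uc: "\<And>y m. y \<in> C \<Longrightarrow> m \<in> C \<Longrightarrow> \<exists>u\<in>C. \<forall>x\<in>C. \<forall>s>0. d x y \<le> s \<and> d x m \<le> s \<longrightarrow>
               d x u \<le> s - k * (d y m powr q / s powr (q - 1))"
    and \<Phi>: "\<And>e b. 0 < e \<Longrightarrow> 0 < b \<Longrightarrow> \<Phi> e b = k' * (e powr q / (b + e) powr (q - 1))"
    and k: "0 < k'" "k' \<le> 1" "k' \<le> 2 * k" and q: "1 \<le> q"
  shows "uniqueness_modulus C d \<Phi>"
  unfolding uniqueness_modulus_def
proof (intro allI impI ballI)
  interpret Metric_space C d by fact
  fix e b :: real
  assume "0 < e \<and> 0 < b"
  then have e: "0 < e" and b: "0 < b" by auto
  let ?B = "(b + e) powr (q - 1)"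
  have B: "0 < ?B" using e b by simp
  have 1: "0 < \<Phi> e b" using \<Phi> e b k by simp
  have "e powr q = e * e powr (q - 1)" using e by (simp add: powr_diff)
  also have "\<dots> \<le> e * ?B" using e b q by (intro mult_left_mono powr_mono2) auto
  finally have "e powr q / ?B \<le> e" using B by (simp add: field_simps)
  then have "k' * (e powr q / ?B) \<le> 1 * e" using k by (intro mult_mono) auto
  then have 2: "\<Phi> e b \<le> e" using \<Phi> e b by simp
  have "\<exists>m. conv_point C d x z (d x y / (d x y + d y z)) m \<and> d y m \<le> e"
    if C: "x \<in> C" "y \<in> C" "z \<in> C" and ne: "x \<noteq> y" "y \<noteq> z" and xz: "d x z \<le> b"
      and ex: "d x y + d y z \<le> d x z + \<Phi> e b" for x y z
  proof -
    have s: "0 < d x y" "0 < d y z" using C ne nonneg by (auto simp: order_less_le)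
    define t where "t = d x y / (d x y + d y z)"
    note t = ratio_bounds[OF s, folded t_def]
    obtain m where m: "conv_point C d x z t m" using conv C t by blast
    have mC: "m \<in> C" using m by (simp add: conv_point_def)
    have xm: "d x m \<le> t * d x z" using m C by (auto simp: conv_point_def)
    have zm: "d z m \<le> (1 - t) * d x z" using m C commute[of x z] by (auto simp: conv_point_def)
    have tri: "d x z \<le> d x y + d y z" using triangle C by blast
    have xm: "d x m \<le> d x y" using xm mult_left_mono[OF tri t(1)] t(3) by linarith
    have zm: "d z m \<le> d y z" using zm mult_left_mono[OF tri, of "1 - t"] t by linarith
    obtain u where u: "u \<in> C" and U: "\<And>x s. x \<in> C \<Longrightarrow> 0 < s \<Longrightarrow> d x y \<le> s \<Longrightarrow> d x m \<le> s \<Longrightarrow>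
       d x u \<le> s - k * (d y m powr q / s powr (q - 1))"
      using uc C mC by metis
    have lower: "k * (d y m powr q / ?B) \<le> k * (d y m powr q / s powr (q - 1))"
      if "0 < s" "s \<le> b + e" for s
      using that k q by (intro mult_left_mono divide_left_mono powr_mono2 mult_pos_pos) auto
    \<comment> \<open>The origin of \<open>b + e\<close> in the formula: it dominates both radii,
      because \<open>\<Phi> e b \<le> e\<close>.\<close>
    have sum_le: "d x y + d y z \<le> b + e" using ex xz 2 by linarith
    have "d x z \<le> d x u + d u z" using triangle C u by blast
    also have "d u z = d z u" by (rule commute)
    also have "d x u \<le> d x y - k * (d y m powr q / ?B)"
      using U[of x "d x y"] lower[of "d x y"] C s xm sum_le by auto
    also have "d z u \<le> d y z - k * (d y m powr q / ?B)"
      using U[of z "d y z"] lower[of "d y z"] C s zm sum_le by (auto simp: commute)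
    finally have "2 * (k * (d y m powr q / ?B)) \<le> \<Phi> e b" using ex by linarith
    also have "\<dots> \<le> 2 * k * (e powr q / ?B)"
      unfolding \<Phi>[OF e b] using k by (intro mult_right_mono) auto
    finally have "d y m powr q \<le> e powr q" using k B by (simp add: field_simps)
    then have "d y m \<le> e" using e q nonneg by (smt (verit) powr_less_mono2)
    then show ?thesis using m t_def by auto
  qed
  then show "0 < \<Phi> e b \<and> \<Phi> e b \<le> e \<and>
        (\<forall>x\<in>C. \<forall>y\<in>C. \<forall>z\<in>C.
           x \<noteq> y \<and> y \<noteq> z \<and> d x y \<le> b \<and> d y z \<le> b \<and> d x z \<le> b \<and>
           d x y + d y z \<le> d x z + \<Phi> e b
           \<longrightarrow> (\<exists>m. conv_point C d x z (d x y / (d x y + d y z)) m \<and> d y m \<le> e))"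
    using 1 2 by blast
qed

section \<open>The rate of convergence\<close>

text \<open>The lion's steps point almost straight at where the man will be up to N moves later, so
  the distance from \<open>L n0\<close> to \<open>M (n0 + N)\<close> is nearly N full steps, more
  than \<open>b\<close> allows. The stage \<open>k\<close> of the induction has error
  \<open>?err k\<close>, which grows from \<open>(T ^^ N) \<alpha>\<close> to
  \<open>\<alpha>\<close>.\<close>

lemma lion_block_contradiction:
  fixes T :: "real \<Rightarrow> real"
  assumes "Metric_space C d" and game: "lion_man_game C d D M L" and D: "0 < D"
    and bd: "\<And>x y. x \<in> C \<Longrightarrow> y \<in> C \<Longrightarrow> d x y \<le> b"
    and T: "\<And>e. 0 < e \<Longrightarrow> 0 < T e \<and> T e \<le> e"
    and betw: "\<And>e x y z w. 0 < e \<Longrightarrow> x \<in> C \<Longrightarrow> y \<in> C \<Longrightarrow> z \<in> C \<Longrightarrow> w \<in> C \<Longrightarrow>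
       (\<And>u v. (u, v) \<in> {(x, y), (x, z), (x, w), (y, z), (y, w), (z, w)} \<Longrightarrow> e \<le> d u v) \<Longrightarrow>
       d x y + d y z \<le> d x z + T e \<Longrightarrow> d y z + d z w \<le> d y w + T e \<Longrightarrow>
       d x z + d z w \<le> d x w + e"
    and N: "b + 1 < real N * D"
    and \<alpha>: "0 < \<alpha>" "real N * \<alpha> \<le> 1" "2 * \<alpha> \<le> D"
    and far: "\<And>j. n0 \<le> j \<Longrightarrow> j \<le> n0 + N \<Longrightarrow> D + 2 * \<alpha> \<le> d (L j) (M j)"
    and dec: "\<And>j. n0 \<le> j \<Longrightarrow> j < n0 + N \<Longrightarrow> d (L (Suc j)) (M (Suc j)) \<le> d (L j) (M j)"
    and drop: "d (L n0) (M n0) - d (L (n0 + N)) (M (n0 + N)) \<le> (T ^^ N) \<alpha>"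
  shows False
proof -
  interpret Metric_space C d by fact
  let ?r = "\<lambda>j. d (L j) (M j)"
  let ?err = "\<lambda>k. (T ^^ (N - k)) \<alpha>"
  have M: "M j \<in> C" and L: "L j \<in> C" and man: "d (M j) (M (Suc j)) \<le> D"
    and lion: "d (L (Suc j)) (L j) + d (L (Suc j)) (M j) = ?r j"
      "d (L j) (L (Suc j)) = min D (?r j)" for j
    using game unfolding lion_man_game_def by auto
  have err: "0 < (T ^^ i) \<alpha> \<and> (T ^^ i) \<alpha> \<le> \<alpha>" for i
  proof (induction i)
    case (Suc i)
    then show ?case using T[of "(T ^^ i) \<alpha>"] by auto
  qed (use \<alpha> in simp)
  have step: "d (L j) (L (Suc j)) = D" "d (L (Suc j)) (M j) = ?r j - D"
    if "n0 \<le> j" "j \<le> n0 + N" for j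
    using lion[of j] far[OF that] \<alpha> commute[of "L j" "L (Suc j)"] by auto
  have mono: "?r j \<le> ?r i" if "n0 \<le> i" "i \<le> j" "j \<le> n0 + N" for i j
    using that(2,3)
  proof (induction j rule: dec_induct)
    case (step j)
    then show ?case using dec[of j] that(1) by auto
  qed simp
  have small_drop: "?r j - ?r (Suc j) \<le> (T ^^ N) \<alpha>" if "n0 \<le> j" "j < n0 + N" for j
    using mono[of n0 j] mono[of "Suc j" "n0 + N"] drop that by auto
  \<comment> \<open>The man has to run: the lion gains \<open>D \<ge> 2 * \<alpha>\<close> on his
    old position, so a shorter step of his would make \<open>?r\<close> drop by more than
    \<open>(T ^^ N) \<alpha>\<close>.\<close>
  have man_far: "2 * \<alpha> - (T ^^ N) \<alpha> \<le> d (M j) (M (Suc j))" if "n0 \<le> j" "j < n0 + N" for j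
    using triangle[of "L (Suc j)" "M j" "M (Suc j)"] L M step[of j] small_drop[of j] \<alpha> that by auto
  \<comment> \<open>The first and last conjunct say that \<open>L n, L (Suc n), M (n + k)\<close> and
    \<open>L n, M (n + k - 1), M (n + k)\<close> are almost collinear. For \<open>k = 0\<close> the last one involves the
    man's position before time \<open>n\<close>, hence \<open>n0 < n\<close>. The other two keep the points apart.\<close>
  have "(\<forall>n\<ge>n0. n + k \<le> n0 + N \<longrightarrow>
           D + d (L (Suc n)) (M (n + k)) \<le> d (L n) (M (n + k)) + ?err k \<and>
           D \<le> d (L n) (M (n + k)) \<and> 2 * \<alpha> \<le> d (L (Suc n)) (M (n + k)) \<and>
           (n0 < n \<longrightarrow> d (L n) (M (n + k - 1)) + d (M (n + k - 1)) (M (n + k)) \<le> d (L n) (M (n + k)) + ?err k))"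
    if "k \<le> N" for k
    using that
  proof (induction k)
    case 0
    show ?case
    proof (intro allI impI conjI)
      fix n assume n: "n0 \<le> n" "n + 0 \<le> n0 + N"
      show "D + d (L (Suc n)) (M (n + 0)) \<le> d (L n) (M (n + 0)) + ?err 0"
        using step[of n] n err[of N] by auto
      show "D \<le> d (L n) (M (n + 0))" "2 * \<alpha> \<le> d (L (Suc n)) (M (n + 0))"
        using far[of n] step[of n] n \<alpha> by auto
      assume "n0 < n"
      then obtain j where j: "n = Suc j" "n0 \<le> j" by (metis less_imp_Suc_add le_add1)
      \<comment> \<open>Here the small drop enters: the left side is at most
        \<open>(?r j - D) + D\<close>, and \<open>?r j\<close> exceeds \<open>?r n\<close> by at
        most \<open>(T ^^ N) \<alpha>\<close>.\<close>
      show "d (L n) (M (n + 0 - 1)) + d (M (n + 0 - 1)) (M (n + 0)) \<le> d (L n) (M (n + 0)) + ?err 0"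
        using step[of j] small_drop[of j] man[of j] n j by auto
    qed
  next
    case (Suc k)
    let ?e = "?err (Suc k)"
    have e: "0 < ?e" "?e \<le> \<alpha>" using err by auto
    have "N - k = Suc (N - Suc k)" using Suc.prems by simp
    then have Te: "T ?e = ?err k" by simp
    have IH: "D + d (L (Suc n)) (M (n + k)) \<le> d (L n) (M (n + k)) + ?err k"
       "D \<le> d (L n) (M (n + k))" "2 * \<alpha> \<le> d (L (Suc n)) (M (n + k))"
       "n0 < n \<Longrightarrow> d (L n) (M (n + k - 1)) + d (M (n + k - 1)) (M (n + k)) \<le> d (L n) (M (n + k)) + ?err k"
      if "n0 \<le> n" "n + k \<le> n0 + N" for n
      using Suc that by auto
    show ?case
    proof (intro allI impI)
      fix n assume n: "n0 \<le> n" "n + Suc k \<le> n0 + N"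
      let ?x = "L n" and ?y = "L (Suc n)" and ?z = "M (n + k)" and ?w = "M (Suc (n + k))"
      have xy: "d ?x ?y = D" using step[of n] n by auto
      have A: "d ?x ?y + d ?y ?z \<le> d ?x ?z + T ?e" using IH(1)[of n] n xy Te by auto
      \<comment> \<open>Taken from the induction hypothesis at \<open>Suc n\<close>, where
        \<open>n0 < Suc n\<close> always holds; so the last conjunct is available even for
        \<open>n = n0\<close>.\<close>
      have B: "d ?y ?z + d ?z ?w \<le> d ?y ?w + T ?e" using IH(4)[of "Suc n"] n Te by auto
      have yz: "2 * \<alpha> \<le> d ?y ?z" using IH(3)[of n] n by auto
      have yw: "D \<le> d ?y ?w" using IH(2)[of "Suc n"] n by auto
      have xz: "D \<le> d ?x ?z" using IH(2)[of n] n by auto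
      have zw: "\<alpha> \<le> d ?z ?w" using man_far[of "n + k"] err[of N] n by auto
      \<comment> \<open>Betweenness itself requires this separation, so only the triangle inequality
        is at hand: the man's step of at most \<open>D\<close> is offset by the lion's step of
        exactly \<open>D\<close>, leaving \<open>d ?y ?z\<close> minus the error.\<close>
      have xw: "\<alpha> \<le> d ?x ?w"
        using A xy yz triangle[of ?x ?w ?z] M L man[of "n + k"] err[of "N - k"] Te
        by (auto simp: commute[of ?w])
      have far: "?e \<le> d u v" if "(u, v) \<in> {(?x, ?y), (?x, ?z), (?x, ?w), (?y, ?z), (?y, ?w), (?z, ?w)}" for u v
        using that xy xz xw yz yw zw e \<alpha> by auto
      have B': "d ?x ?z + d ?z ?w \<le> d ?x ?w + ?e"
        using far A B M L e by (intro betw[of ?e ?x ?y ?z ?w]) auto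
      have A': "d ?w ?y + d ?y ?x \<le> d ?w ?x + ?e"
      proof (rule betw[of ?e ?w ?z ?y ?x])
        show "?e \<le> d u v" if "(u, v) \<in> {(?w, ?z), (?w, ?y), (?w, ?x), (?z, ?y), (?z, ?x), (?y, ?x)}" for u v
          using that far[of v u] commute[of u v] by auto
      qed (use A B M L e commute in \<open>auto simp: add.commute\<close>)
      have "D \<le> d ?x ?w" using A' xy yw e \<alpha> by (auto simp: commute)
      moreover have "2 * \<alpha> \<le> d ?y ?w" using yw \<alpha> by auto
      ultimately show "D + d (L (Suc n)) (M (n + Suc k)) \<le> d (L n) (M (n + Suc k)) + ?e \<and>
           D \<le> d (L n) (M (n + Suc k)) \<and> 2 * \<alpha> \<le> d (L (Suc n)) (M (n + Suc k)) \<and>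
           (n0 < n \<longrightarrow> d (L n) (M (n + Suc k - 1)) + d (M (n + Suc k - 1)) (M (n + Suc k)) \<le> d (L n) (M (n + Suc k)) + ?e)"
        using A' B' xy by (auto simp: commute)
    qed
  qed
  then have "D + d (L (Suc n)) (M (n + k)) \<le> d (L n) (M (n + k)) + ?err k"
    if "n0 \<le> n" "n + k \<le> n0 + N" for n k
    using that by simp
  then have stretch: "D + d (L (Suc n)) (M (n + k)) \<le> d (L n) (M (n + k)) + \<alpha>"
    if "n0 \<le> n" "n + k \<le> n0 + N" for n k
    using that err[of "N - k"] by fastforce
  \<comment> \<open>Peel off the lion's steps one by one while the man's final position stays fixed;
    each contributes \<open>D\<close> at a cost of \<open>\<alpha>\<close>.\<close>
  have "real k * D \<le> d (L n) (M (n + k)) + real k * \<alpha>" if "n0 \<le> n" "n + k \<le> n0 + N" for n k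
    using that
  proof (induction k arbitrary: n)
    case (Suc k)
    then show ?case using Suc.IH[of "Suc n"] stretch[of n "Suc k"] by (auto simp: algebra_simps)
  qed simp
  from this[of n0 N] have "real N * D \<le> b + 1" using bd[of "L n0" "M (n0 + N)"] M L \<alpha> by auto
  then show False using N by simp
qed

theorem lion_man_rate:
  fixes T :: "real \<Rightarrow> real"
  assumes metric: "Metric_space C d" and game: "lion_man_game C d D M L" and D: "0 < D"
    and bd: "\<And>x y. x \<in> C \<Longrightarrow> y \<in> C \<Longrightarrow> d x y \<le> b"
    and T: "\<And>e. 0 < e \<Longrightarrow> 0 < T e \<and> T e \<le> e"
    and betw: "\<And>e x y z w. 0 < e \<Longrightarrow> x \<in> C \<Longrightarrow> y \<in> C \<Longrightarrow> z \<in> C \<Longrightarrow> w \<in> C \<Longrightarrow>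
       (\<And>u v. (u, v) \<in> {(x, y), (x, z), (x, w), (y, z), (y, w), (z, w)} \<Longrightarrow> e \<le> d u v) \<Longrightarrow>
       d x y + d y z \<le> d x z + T e \<Longrightarrow> d y z + d z w \<le> d y w + T e \<Longrightarrow>
       d x z + d z w \<le> d x w + e"
    and N: "b + 1 < real N * D"
    and \<alpha>: "0 < \<alpha>" "\<alpha> \<le> 1 / real N" "\<alpha> \<le> \<epsilon> / 2" "\<alpha> \<le> D / 2"
    and n: "N + N * nat \<lceil>b / (T ^^ N) \<alpha>\<rceil> \<le> n"
  shows "d (L n) (M n) < D + \<epsilon> \<and> d (L (Suc n)) (M n) < \<epsilon>"
proof -
  interpret Metric_space C d by fact
  let ?r = "\<lambda>j. d (L j) (M j)"
  have M: "M j \<in> C" and L: "L j \<in> C" and man: "d (M j) (M (Suc j)) \<le> D"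
    and lion: "d (L (Suc j)) (L j) + d (L (Suc j)) (M j) = ?r j"
      "d (L j) (L (Suc j)) = min D (?r j)" for j
    using game unfolding lion_man_game_def by auto
  have gap: "d (L (Suc j)) (M j) = max (?r j - D) 0" for j
    using lion[of j] by (auto simp: commute)
  have rec: "?r (Suc j) \<le> max (?r j) D" for j
    using triangle[of "L (Suc j)" "M j" "M (Suc j)"] M L man[of j] gap[of j] by auto
  have mono: "?r j \<le> max (?r i) D" if "i \<le> j" for i j
    using that
  proof (induction j rule: dec_induct)
    case (step j)
    then show ?case using rec[of j] by auto
  qed simp
  have "?r n < D + \<epsilon>"
  proof (rule ccontr)
    assume "\<not> ?r n < D + \<epsilon>"
    then have far: "D + 2 * \<alpha> \<le> ?r j" if "j \<le> n" for j
      using mono[OF that] \<alpha> by auto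
    have dec: "?r (Suc j) \<le> ?r j" if "j \<le> n" for j
      using rec[of j] far[OF that] \<alpha> by auto
    define \<theta> where "\<theta> = (T ^^ N) \<alpha>"
    define K where "K = nat \<lceil>b / \<theta>\<rceil>"
    have "0 < (T ^^ i) \<alpha>" for i
      by (induction i) (use T \<alpha> in auto)
    then have \<theta>: "0 < \<theta>" by (simp add: \<theta>_def)
    \<comment> \<open>The summand \<open>N\<close> of \<open>Omega\<close> outside the product
      leaves room for the whole block that starts at \<open>N * K\<close>.\<close>
    have Kn: "N * k + N \<le> n" if "k \<le> K" for k
    proof -
      have "N * k \<le> N * K" using that by (rule mult_le_mono2)
      then show ?thesis using n unfolding K_def \<theta>_def by linarith
    qed
    \<comment> \<open>A block that loses at most \<open>\<theta>\<close> is impossible by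
      \<open>lion_block_contradiction\<close>. Hence \<open>?r\<close> loses at least
      \<open>K * \<theta> \<ge> b\<close> by time \<open>N * K\<close>, although it still exceeds
      \<open>D\<close> then.\<close>
    have drop: "\<theta> < ?r (N * k) - ?r (N * k + N)" if "k \<le> K" for k
    proof (rule ccontr)
      assume *: "\<not> \<theta> < ?r (N * k) - ?r (N * k + N)"
      have "N > 0" using N bd[of "L 0" "L 0"] L nonneg[of "L 0" "L 0"] by (cases N) auto
      then have 1: "real N * \<alpha> \<le> 1" using \<alpha> by (simp add: field_simps)
      show False
      proof (rule lion_block_contradiction[where T = T and \<alpha> = \<alpha> and ?n0.0 = "N * k", OF metric game D bd T betw N])
        show "D + 2 * \<alpha> \<le> d (L j) (M j)" if "N * k \<le> j" "j \<le> N * k + N" for j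
          using far[of j] Kn[OF \<open>k \<le> K\<close>] that by auto
        show "d (L (Suc j)) (M (Suc j)) \<le> d (L j) (M j)" if "N * k \<le> j" "j < N * k + N" for j
          using dec[of j] Kn[OF \<open>k \<le> K\<close>] that by auto
      qed (use * 1 \<alpha> \<theta>_def in auto)
    qed
    have "real k * \<theta> \<le> ?r 0 - ?r (N * k)" if "k \<le> K" for k
      using that
    proof (induction k)
      case (Suc k)
      then show ?case using drop[of k] by (auto simp: algebra_simps)
    qed simp
    from this[of K] have 2: "real K * \<theta> \<le> ?r 0 - ?r (N * K)" by simp
    have "b / \<theta> \<le> real K" unfolding K_def by linarith
    then have "b \<le> real K * \<theta>" using \<theta> by (simp add: field_simps)
    then show False using 2 bd[OF L M, of 0 0] far[of "N * K"] Kn[of K] D \<alpha> by auto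
  qed
  then show ?thesis using gap[of n] \<alpha> by auto
qed

section \<open>From a modulus of uniform betweenness to the rate and the lion's victory\<close>

lemma uniform_betweenness_rate:
  assumes metric: "Metric_space C d" and bd: "\<And>x y. x \<in> C \<Longrightarrow> y \<in> C \<Longrightarrow> d x y \<le> b" and b: "0 < b"
    and modulus: "uniform_betweenness_modulus C d \<Theta>" and le: "\<And>e. 0 < e \<Longrightarrow> \<Theta> e e b \<le> e"
    and game: "lion_man_game C d D M L" and D: "0 < D" and N: "b + 1 < real N * D"
    and \<alpha>: "0 < \<alpha>" "\<alpha> \<le> 1 / real N" "\<alpha> \<le> \<epsilon> / 2" "\<alpha> \<le> D / 2"
    and n: "Omega \<Theta> b N \<alpha> \<le> n"
  shows "d (L n) (M n) < D + \<epsilon> \<and> d (L (Suc n)) (M n) < \<epsilon>"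
proof (rule lion_man_rate[where T = "\<lambda>e. \<Theta> e e b", OF metric game D bd _ _ N \<alpha>])
  interpret Metric_space C d by fact
  show "0 < \<Theta> e e b \<and> \<Theta> e e b \<le> e" if "0 < e" for e
    using modulus le that b unfolding uniform_betweenness_modulus_def by auto
  fix e x y z w
  assume e: "0 < e" and C: "x \<in> C" "y \<in> C" "z \<in> C" "w \<in> C"
    and far: "\<And>u v. (u, v) \<in> {(x, y), (x, z), (x, w), (y, z), (y, w), (z, w)} \<Longrightarrow> e \<le> d u v"
    and H: "d x y + d y z \<le> d x z + \<Theta> e e b" "d y z + d z w \<le> d y w + \<Theta> e e b"
  have "y \<noteq> z" using far[of y z] e zero C by auto
  moreover have "\<forall>u\<in>{x, y, z, w}. \<forall>v\<in>{x, y, z, w}. u \<noteq> v \<longrightarrow> e \<le> d u v"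
    using far[of x y] far[of x z] far[of x w] far[of y z] far[of y w] far[of z w]
      commute[of y x] commute[of z x] commute[of w x] commute[of z y] commute[of w y] commute[of w z]
    by simp
  moreover have "\<forall>u\<in>{x, y, z, w}. \<forall>v\<in>{x, y, z, w}. d u v \<le> b"
    using bd C by blast
  ultimately show "d x z + d z w \<le> d x w + e"
    using modulus H C e b unfolding uniform_betweenness_modulus_def by blast
qed (use n in \<open>simp_all add: Omega_def\<close>)

lemma lion_always_wins_if_modulus:
  assumes metric: "Metric_space C d" and bd: "\<And>x y. x \<in> C \<Longrightarrow> y \<in> C \<Longrightarrow> d x y \<le> b" and b: "0 < b"
    and modulus: "uniform_betweenness_modulus C d \<Theta>" and le: "\<And>e. 0 < e \<Longrightarrow> \<Theta> e e b \<le> e"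
  shows "lion_always_wins C d"
  unfolding lion_always_wins_def lion_wins_def
proof (intro allI impI LIMSEQ_I)
  interpret Metric_space C d by fact
  fix D \<epsilon> :: real and M L
  assume D: "0 < D" and game: "lion_man_game C d D M L" and \<epsilon>: "0 < \<epsilon>"
  obtain N :: nat where "(b + 1) / D < real N" using reals_Archimedean2 by blast
  then have N: "b + 1 < real N * D" using D by (simp add: field_simps)
  then have "0 < N" using b by (cases N) auto
  define \<alpha> where "\<alpha> = min (1 / real N) (min (\<epsilon> / 2) (D / 2))"
  have "d (L (Suc n)) (M n) < \<epsilon>" if "Omega \<Theta> b N \<alpha> \<le> n" for n
    using uniform_betweenness_rate[OF metric bd b modulus le game D N _ _ _ _ that, of \<epsilon>]
      \<open>0 < N\<close> \<epsilon> D by (auto simp: \<alpha>_def)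
  then show "\<exists>no. \<forall>n\<ge>no. norm (d (L (Suc n)) (M n) - 0) < \<epsilon>" by auto
qed

lemma dist_le_set_diam:
  assumes "Metric_space X d" "Metric_space.mbounded X d C" "x \<in> C" "y \<in> C"
  shows "d x y \<le> set_diam C d"
proof -
  interpret Metric_space X d by fact
  obtain B where "\<And>x y. x \<in> C \<Longrightarrow> y \<in> C \<Longrightarrow> d x y \<le> B"
    using assms(2) unfolding mbounded_alt by blast
  then have "bdd_above ((\<lambda>(x, y). d x y) ` (C \<times> C))"
    by (auto intro!: bdd_aboveI2[where M = B])
  then have "d x y \<le> (SUP (x, y) \<in> C \<times> C. d x y)"
    using assms(3,4) by (intro cSUP_upper2[where x = "(x, y)"]) auto
  then show ?thesis using assms(3) by (auto simp: set_diam_def)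
qed

theorem modulus_rate_and_win:
  assumes X: "Metric_space X d" "Metric_space.mbounded X d C" and diam: "0 < set_diam C d"
    and modulus: "uniqueness_modulus C d \<Phi>"
  shows "uniform_betweenness_modulus C d (Theta_of \<Phi>) \<and> explicit_rate C d (Theta_of \<Phi>) \<and>
         lion_always_wins C d"
proof (intro conjI)
  interpret X: Metric_space X d by fact
  have metric: "Metric_space C d"
    using X.subspace X.mbounded_subset_mspace X(2) by blast
  show betw: "uniform_betweenness_modulus C d (Theta_of \<Phi>)"
    by (rule uniform_betweenness_Theta_of[OF metric modulus])
  have le: "Theta_of \<Phi> e e b \<le> e" for e b by (simp add: Theta_of_def)
  have bd: "d x y \<le> b" if "set_diam C d \<le> b" "x \<in> C" "y \<in> C" for x y b
    using dist_le_set_diam[OF X that(2,3)] that(1) by simp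
  show "lion_always_wins C d"
    by (rule lion_always_wins_if_modulus[OF metric bd[OF order.refl] diam betw le])
  show "explicit_rate C d (Theta_of \<Phi>)"
    unfolding explicit_rate_def
  proof (intro allI impI, elim conjE, intro conjI)
    fix D b :: real
    assume D: "0 < D" and b: "set_diam C d \<le> b"
    show "\<forall>\<epsilon>>0. Theta_of \<Phi> \<epsilon> \<epsilon> b \<le> \<epsilon>" using le by blast
    have "(b + 1) / D < real (nat \<lceil>(b + 1) / D\<rceil> + 1)" by linarith
    then show "b + 1 < real (nat \<lceil>(b + 1) / D\<rceil> + 1) * D" using D by (simp add: field_simps)
    show "\<forall>N::nat. b + 1 < real N * D \<longrightarrow>
          (\<forall>M L. lion_man_game C d D M L \<longrightarrow>
            (\<forall>\<epsilon> \<alpha>. 0 < \<epsilon> \<and> 0 < \<alpha> \<and> \<alpha> \<le> Min {1 / real N, \<epsilon> / 2, D / 2} \<longrightarrow>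
              (\<forall>n \<ge> Omega (Theta_of \<Phi>) b N \<alpha>.
                 d (L n) (M n) < D + \<epsilon> \<and> d (L (Suc n)) (M n) < \<epsilon>)))"
      using diam b D by (intro allI impI uniform_betweenness_rate[OF metric bd[OF b] _ betw le]) auto
  qed
qed

section \<open>Uniformly convex normed spaces\<close>

text \<open>No power law is known for \<open>\<delta>\<close>, so
  \<open>power_type_uniqueness_modulus\<close> is out of reach. The same midpoint argument runs by
  contradiction: if \<open>y\<close> is farther than \<open>e\<close> from \<open>m\<close>, both
  radii shrink by the factor \<open>1 - \<delta>\<close>, and their sum cannot be small.\<close>

lemma uniformly_convex_uniqueness_modulus:
  fixes C :: "'v::real_normed_vector set"
  assumes uc: "uniformly_convex TYPE('v)" and C: "convex C"
  shows "\<exists>\<Phi>. uniqueness_modulus C dist \<Phi>"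
proof -
  have conv: "conv_point C dist x z t ((1 - t) *\<^sub>R x + t *\<^sub>R z)"
    if "x \<in> C" "z \<in> C" "0 \<le> t" "t \<le> 1" for x z and t :: real
    unfolding conv_point_def
  proof (intro conjI ballI)
    show "(1 - t) *\<^sub>R x + t *\<^sub>R z \<in> C" using that C by (simp add: convex_alt)
    fix w
    have "w - ((1 - t) *\<^sub>R x + t *\<^sub>R z) = (1 - t) *\<^sub>R (w - x) + t *\<^sub>R (w - z)"
      by (simp add: algebra_simps)
    then have "dist w ((1 - t) *\<^sub>R x + t *\<^sub>R z) \<le> norm ((1 - t) *\<^sub>R (w - x)) + norm (t *\<^sub>R (w - z))"
      by (metis dist_norm norm_triangle_ineq)
    then show "dist w ((1 - t) *\<^sub>R x + t *\<^sub>R z) \<le> (1 - t) * dist w x + t * dist w z"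
      using that by (simp add: dist_norm)
  qed
  have "\<exists>\<phi>>0. \<phi> \<le> e \<and>
        (\<forall>x\<in>C. \<forall>y\<in>C. \<forall>z\<in>C.
           x \<noteq> y \<and> y \<noteq> z \<and> dist x y \<le> b \<and> dist y z \<le> b \<and> dist x z \<le> b \<and>
           dist x y + dist y z \<le> dist x z + \<phi>
           \<longrightarrow> (\<exists>m. conv_point C dist x z (dist x y / (dist x y + dist y z)) m \<and> dist y m \<le> e))"
    if "0 < e" "0 < b" for e b
  proof -
    \<comment> \<open>All radii \<open>s\<close> are at most \<open>b\<close>, so a distance of at
      least \<open>e\<close> becomes at least \<open>e / b\<close> after scaling to the unit ball;
      the cap 2 is the range in which uniform convexity supplies a \<open>\<delta>\<close>.\<close>
    define \<eta> where "\<eta> = min 2 (e / b)"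
    have "0 < \<eta> \<and> \<eta> \<le> 2" using that by (simp add: \<eta>_def)
    then obtain \<delta> where \<delta>: "0 < \<delta>" and
      UC: "\<And>x y :: 'v. norm x \<le> 1 \<Longrightarrow> norm y \<le> 1 \<Longrightarrow> norm (x - y) \<ge> \<eta> \<Longrightarrow>
             norm ((1 / 2) *\<^sub>R (x + y)) \<le> 1 - \<delta>"
      using uc unfolding uniformly_convex_def by metis
    have UCs: "norm ((1 / 2) *\<^sub>R (x + y)) \<le> s * (1 - \<delta>)"
      if "0 < s" "s \<le> b" "norm x \<le> s" "norm y \<le> s" "e \<le> norm (x - y)" for x y :: 'v and s
    proof -
      have "\<eta> \<le> e / b" by (simp add: \<eta>_def)
      also have "\<dots> \<le> norm (x - y) / s" using that \<open>0 < e\<close> by (intro frac_le) auto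
      also have "\<dots> = norm ((1 / s) *\<^sub>R x - (1 / s) *\<^sub>R y)"
        using that by (simp flip: scaleR_diff_right)
      finally have "norm ((1 / 2) *\<^sub>R ((1 / s) *\<^sub>R x + (1 / s) *\<^sub>R y)) \<le> 1 - \<delta>"
        using that by (intro UC) auto
      also have "(1 / 2) *\<^sub>R ((1 / s) *\<^sub>R x + (1 / s) *\<^sub>R y) = (1 / s) *\<^sub>R ((1 / 2) *\<^sub>R (x + y))"
        by (simp add: scaleR_right_distrib mult.commute)
      finally show ?thesis using that by (simp add: divide_le_eq mult.commute mult.left_commute)
    qed
    \<comment> \<open>The gain is \<open>(dist x y + dist y z) * \<delta>\<close>, and the sum of
      the radii exceeds \<open>e / 2\<close>, because
      \<open>e < dist y m \<le> dist x y + dist x m \<le> 2 * dist x y\<close>.\<close>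
    let ?\<phi> = "min e (e * \<delta> / 2)"
    have "\<exists>m. conv_point C dist x z (dist x y / (dist x y + dist y z)) m \<and> dist y m \<le> e"
      if P: "x \<in> C" "y \<in> C" "z \<in> C" "x \<noteq> y" "y \<noteq> z" "dist x y \<le> b" "dist y z \<le> b"
        "dist x y + dist y z \<le> dist x z + ?\<phi>" for x y z
    proof -
      define t where "t = dist x y / (dist x y + dist y z)"
      define m where "m = (1 - t) *\<^sub>R x + t *\<^sub>R z"
      have s: "0 < dist x y" "0 < dist y z" using P by auto
      note t = ratio_bounds[OF s, folded t_def]
      have m: "conv_point C dist x z t m" using conv[of x z t] P t by (simp add: m_def)
      have xm: "dist x m \<le> t * dist x z" using m P by (auto simp: conv_point_def)
      have zm: "dist z m \<le> (1 - t) * dist x z"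
        using m P dist_commute[of x z] by (auto simp: conv_point_def)
      have tri: "dist x z \<le> dist x y + dist y z" by (rule dist_triangle)
      have xm: "dist x m \<le> dist x y" using xm mult_left_mono[OF tri t(1)] t(3) by linarith
      have zm: "dist z m \<le> dist y z" using zm mult_left_mono[OF tri, of "1 - t"] t by linarith
      have "dist y m \<le> e"
      proof (rule ccontr)
        assume "\<not> dist y m \<le> e"
        then have far: "e < norm (y - m)" by (simp add: dist_norm)
        define u where "u = (1 / 2) *\<^sub>R (y + m)"
        have u: "v - u = (1 / 2) *\<^sub>R ((v - y) + (v - m))" for v
        proof -
          have "(v - y) + (v - m) = (v + v) - (y + m)" by simp
          then show ?thesis by (simp only: u_def scaleR_diff_right scaleR_half_double)
        qed
        have "norm (x - u) \<le> dist x y * (1 - \<delta>)"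
          unfolding u using P s xm far
          by (intro UCs) (auto simp: dist_norm norm_minus_commute)
        moreover have "norm (z - u) \<le> dist y z * (1 - \<delta>)"
          unfolding u using P s zm far
          by (intro UCs) (auto simp: dist_norm norm_minus_commute)
        moreover have "dist x z \<le> norm (x - u) + norm (z - u)"
          by (metis dist_norm dist_triangle2)
        ultimately have "(dist x y + dist y z) * \<delta> \<le> e * \<delta> / 2"
          using P(8) by (simp add: algebra_simps)
        moreover have "e \<le> dist x y + dist x m"
          using far dist_triangle[of y m x] by (simp add: dist_norm norm_minus_commute)
        then have "e / 2 < dist x y + dist y z" using xm s by linarith
        then have "e / 2 * \<delta> < (dist x y + dist y z) * \<delta>" using \<delta> by (intro mult_strict_right_mono)
        ultimately show False by simp
      qed
      then show ?thesis using m by (auto simp: t_def)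
    qed
    then show ?thesis using that \<delta> by (intro exI[of _ ?\<phi>]) auto
  qed
  then obtain \<Phi> where "\<And>e b. 0 < e \<Longrightarrow> 0 < b \<Longrightarrow> 0 < \<Phi> e b \<and> \<Phi> e b \<le> e \<and>
        (\<forall>x\<in>C. \<forall>y\<in>C. \<forall>z\<in>C.
           x \<noteq> y \<and> y \<noteq> z \<and> dist x y \<le> b \<and> dist y z \<le> b \<and> dist x z \<le> b \<and>
           dist x y + dist y z \<le> dist x z + \<Phi> e b
           \<longrightarrow> (\<exists>m. conv_point C dist x z (dist x y / (dist x y + dist y z)) m \<and> dist y m \<le> e))"
    by metis
  then show ?thesis unfolding uniqueness_modulus_def by blast
qed

theorem lion_always_wins_uniformly_convex:
  fixes C :: "'v::real_normed_vector set"
  assumes "uniformly_convex TYPE('v)" "convex C" "bounded C"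
  shows "lion_always_wins C dist"
proof -
  obtain \<Phi> where \<Phi>: "uniqueness_modulus C dist \<Phi>"
    using uniformly_convex_uniqueness_modulus assms by blast
  have metric: "Metric_space C dist" by (rule Met_TC.subspace) simp
  obtain b where b: "\<And>x y. x \<in> C \<Longrightarrow> y \<in> C \<Longrightarrow> dist x y \<le> b"
    using assms(3) unfolding bounded_two_points by blast
  show ?thesis
  proof (rule lion_always_wins_if_modulus[OF metric _ _ uniform_betweenness_Theta_of[OF metric \<Phi>]])
    show "dist x y \<le> max b 1" if "x \<in> C" "y \<in> C" for x y
      using b[OF that] by simp
  qed (simp_all add: Theta_of_def)
qed

section \<open>Uniform convexity of Lp spaces\<close>

lemma has_real_derivative_abs_powr:
  fixes p x :: real
  assumes "1 < p"
  shows "((\<lambda>x. \<bar>x\<bar> powr p) has_real_derivative p * sgn x * \<bar>x\<bar> powr (p - 1)) (at x)"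
proof (cases x "0::real" rule: linorder_cases)
  case greater
  have "((\<lambda>x. x powr p) has_real_derivative p * x powr (p - 1)) (at x)"
    using greater by (rule has_real_derivative_powr)
  then have "((\<lambda>x. \<bar>x\<bar> powr p) has_real_derivative p * x powr (p - 1)) (at x)"
    by (rule has_field_derivative_transform_within_open[where S = "{0<..}"]) (use greater in auto)
  then show ?thesis using greater by simp
next
  case less
  have "((\<lambda>x. (- x) powr p) has_real_derivative - (p * (- x) powr (p - 1))) (at x)"
    using less by (auto intro!: derivative_eq_intros)
  then have "((\<lambda>x. \<bar>x\<bar> powr p) has_real_derivative - (p * (- x) powr (p - 1))) (at x)"
    by (rule has_field_derivative_transform_within_open[where S = "{..<0}"]) (use less in auto)
  then show ?thesis using less by simp
next
  case equal
  \<comment> \<open>At 0 the difference quotient has absolute value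
    \<open>\<bar>h\<bar> powr (p - 1)\<close>, which vanishes in the limit because
    \<open>p > 1\<close>.\<close>
  have "((\<lambda>h::real. \<bar>h\<bar> powr (p - 1)) \<longlongrightarrow> 0) (at 0)"
    using assms by (intro tendsto_zero_powrI[where b = "p - 1"] tendsto_rabs_zero tendsto_ident_at)
      (auto intro!: tendsto_eq_intros)
  then have "((\<lambda>h::real. \<bar>h\<bar> powr p / h) \<longlongrightarrow> 0) (at 0)"
  proof (rule Lim_null_comparison[rotated])
    show "\<forall>\<^sub>F h in at 0. norm (\<bar>h\<bar> powr p / h) \<le> \<bar>h\<bar> powr (p - 1)"
      by (intro always_eventually allI) (auto simp: powr_diff)
  qed
  then show ?thesis using equal assms by (simp add: DERIV_def)
qed

lemma convex_on_abs_powr: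
  fixes p :: real
  assumes "1 < p"
  shows "convex_on UNIV (\<lambda>x. \<bar>x\<bar> powr p)"
proof (rule convex_on_realI[OF _ has_real_derivative_abs_powr[OF assms]])
  fix x y :: real
  assume "x \<le> y"
  then have "sgn x * \<bar>x\<bar> powr (p - 1) \<le> sgn y * \<bar>y\<bar> powr (p - 1)"
    using assms by (cases x "0::real" rule: linorder_cases; cases y "0::real" rule: linorder_cases)
      (auto intro: powr_mono2 order.trans[OF _ powr_ge_zero])
  then show "p * sgn x * \<bar>x\<bar> powr (p - 1) \<le> p * sgn y * \<bar>y\<bar> powr (p - 1)"
    using assms by (simp add: mult.assoc)
qed auto

text \<open>Away from 0 the second derivative of \<open>\<bar>x\<bar> powr p\<close> is p (p - 1)
  |x|^(p - 2), at least p (p - 1) on the unit interval because the exponent is not positive. For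
  \<open>p < 2\<close> it does not exist at 0, so monotonicity of the first derivative is proved on
  each side and glued by sign.\<close>

lemma convex_on_abs_powr_minus_square:
  fixes p :: real
  assumes "1 < p" "p \<le> 2"
  shows "convex_on {-1..1} (\<lambda>x. \<bar>x\<bar> powr p - p * (p - 1) / 2 * x\<^sup>2)"
proof (rule convex_on_realI)
  fix x :: real
  show "((\<lambda>x. \<bar>x\<bar> powr p - p * (p - 1) / 2 * x\<^sup>2) has_real_derivative
          p * sgn x * \<bar>x\<bar> powr (p - 1) - p * (p - 1) * x) (at x)"
    by (rule derivative_eq_intros has_real_derivative_abs_powr assms refl | simp)+
next
  let ?k = "\<lambda>x. x powr (p - 1) - (p - 1) * x"
  have pos: "?k x \<le> ?k y" if "0 < x" "x \<le> y" "y \<le> 1" for x y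
  proof (rule DERIV_nonneg_imp_nondecreasing[OF \<open>x \<le> y\<close>])
    fix z assume z: "x \<le> z" "z \<le> y"
    have "(?k has_real_derivative (p - 1) * z powr (p - 1 - 1) - (p - 1) * 1) (at z)"
      using z that by (intro derivative_intros has_real_derivative_powr) auto
    moreover have "z powr 0 \<le> z powr (p - 2)"
      using z that assms by (intro powr_mono') auto
    then have "0 \<le> (p - 1) * (z powr (p - 2) - 1)" using z that assms by simp
    ultimately show "\<exists>D. (?k has_real_derivative D) (at z) \<and> 0 \<le> D"
      by (auto simp: algebra_simps)
  qed
  have nonneg: "0 \<le> ?k y" if "0 \<le> y" "y \<le> 1" for y
  proof (cases "y = 0")
    case False
    have "(p - 1) * y \<le> 1 * y powr 1" using that assms by (intro mult_mono) auto
    also have "\<dots> \<le> y powr (p - 1)"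
      using that assms powr_mono'[of "p - 1" 1 y] by simp
    finally show ?thesis by simp
  qed simp
  have mono: "sgn x * ?k \<bar>x\<bar> \<le> sgn y * ?k \<bar>y\<bar>" if "x \<le> y" "-1 \<le> x" "y \<le> 1" for x y :: real
  proof -
    consider "0 < x" | "y < 0" | "x \<le> 0" "0 \<le> y" by linarith
    then show ?thesis
    proof cases
      case 1
      then show ?thesis using pos[of x y] that by simp
    next
      case 2
      then show ?thesis using pos[of "-y" "-x"] that by simp
    next
      case 3
      have "sgn x * ?k \<bar>x\<bar> \<le> 0"
        using nonneg[of "-x"] that 3 by (intro mult_nonpos_nonneg) (auto simp: sgn_if)
      moreover have "0 \<le> sgn y * ?k \<bar>y\<bar>"
        using nonneg[of y] that 3 by (intro mult_nonneg_nonneg) (auto simp: sgn_if)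
      ultimately show ?thesis by simp
    qed
  qed
  have eq: "p * sgn x * \<bar>x\<bar> powr (p - 1) - p * (p - 1) * x = p * (sgn x * ?k \<bar>x\<bar>)" for x
    by (auto simp: sgn_if algebra_simps)
  show "p * sgn x * \<bar>x\<bar> powr (p - 1) - p * (p - 1) * x \<le> p * sgn y * \<bar>y\<bar> powr (p - 1) - p * (p - 1) * y"
    if "x \<in> {-1..1}" "y \<in> {-1..1}" "x \<le> y" for x y
    unfolding eq using mono[of x y] that assms by auto
qed simp

text \<open>Scale to the unit interval and apply convexity at the midpoint. The squares contribute
  their midpoint defect \<open>(a - b)\<^sup>2 / 4\<close>, which turns
  \<open>p * (p - 1) / 2\<close> into \<open>p * (p - 1) / 8\<close>; undoing the scaling produces
  the weight of degree \<open>p - 2\<close>.\<close>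

lemma abs_powr_midpoint_quadratic:
  fixes a b p :: real
  assumes p: "1 < p" "p \<le> 2"
  shows "\<bar>(a + b) / 2\<bar> powr p + p * (p - 1) / 8 * ((a - b)\<^sup>2 * max \<bar>a\<bar> \<bar>b\<bar> powr (p - 2))
           \<le> (\<bar>a\<bar> powr p + \<bar>b\<bar> powr p) / 2"
proof (cases "max \<bar>a\<bar> \<bar>b\<bar> = 0")
  case False
  define m where "m = max \<bar>a\<bar> \<bar>b\<bar>"
  have m: "0 < m" using False by (simp add: m_def)
  define x y where "x = a / m" and "y = b / m"
  have ab: "a = m * x" "b = m * y" using m by (simp_all add: x_def y_def)
  have "x \<in> {-1..1}" "y \<in> {-1..1}"
    using m unfolding x_def y_def m_def by (auto simp: field_simps)
  then have "\<bar>(1 - 1/2) *\<^sub>R x + (1/2) *\<^sub>R y\<bar> powr p - p * (p - 1) / 2 * ((1 - 1/2) *\<^sub>R x + (1/2) *\<^sub>R y)\<^sup>2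
      \<le> (1 - 1/2) * (\<bar>x\<bar> powr p - p * (p - 1) / 2 * x\<^sup>2) + 1/2 * (\<bar>y\<bar> powr p - p * (p - 1) / 2 * y\<^sup>2)"
    by (intro convex_onD[OF convex_on_abs_powr_minus_square[OF p]]) auto
  moreover have "(1 - 1/2) *\<^sub>R x + (1/2) *\<^sub>R y = (x + y) / 2" by simp
  ultimately have "\<bar>(x + y) / 2\<bar> powr p + p * (p - 1) / 8 * (x - y)\<^sup>2 \<le> (\<bar>x\<bar> powr p + \<bar>y\<bar> powr p) / 2"
    by (simp add: power2_eq_square field_simps)
  then have *: "m powr p * (\<bar>(x + y) / 2\<bar> powr p + p * (p - 1) / 8 * (x - y)\<^sup>2)
      \<le> m powr p * ((\<bar>x\<bar> powr p + \<bar>y\<bar> powr p) / 2)"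
    by (intro mult_left_mono) auto
  have scale: "\<bar>m * t\<bar> powr p = m powr p * \<bar>t\<bar> powr p" for t
    using m by (simp add: abs_mult powr_mult)
  have "(a + b) / 2 = m * ((x + y) / 2)" by (simp add: ab distrib_left)
  then have 1: "\<bar>(a + b) / 2\<bar> powr p = m powr p * \<bar>(x + y) / 2\<bar> powr p"
    by (simp only: scale)
  have 2: "(a - b)\<^sup>2 * m powr (p - 2) = m powr p * (x - y)\<^sup>2"
    using m by (simp add: ab powr_diff power2_eq_square field_simps)
  have 3: "\<bar>a\<bar> powr p = m powr p * \<bar>x\<bar> powr p" "\<bar>b\<bar> powr p = m powr p * \<bar>y\<bar> powr p"
    unfolding ab by (rule scale)+
  have "\<bar>(a + b) / 2\<bar> powr p + p * (p - 1) / 8 * ((a - b)\<^sup>2 * m powr (p - 2))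
      \<le> (\<bar>a\<bar> powr p + \<bar>b\<bar> powr p) / 2"
    unfolding 1 2 3 using * by (simp add: algebra_simps)
  then show ?thesis by (simp add: m_def)
next
  case True
  then have "a = 0" "b = 0" by (auto simp: max_def split: if_splits)
  then show ?thesis by simp
qed

text \<open>Split off one factor, u^r = u * u^(r - 1), and enlarge the base of the other to
  \<open>u + v\<close>.\<close>

lemma powr_superadditive:
  fixes u v r :: real
  assumes "0 \<le> u" "0 \<le> v" "1 \<le> r"
  shows "u powr r + v powr r \<le> (u + v) powr r"
proof -
  have *: "x powr r = x * x powr (r - 1)" if "0 \<le> x" for x :: real
    using that by (cases "x = 0") (auto simp: powr_diff)
  have "u * u powr (r - 1) + v * v powr (r - 1) \<le> u * (u + v) powr (r - 1) + v * (u + v) powr (r - 1)"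
    using assms by (intro add_mono mult_left_mono powr_mono2) auto
  then show ?thesis using assms by (simp add: * algebra_simps)
qed

lemma square_powr_half: "(t\<^sup>2) powr (r / 2) = \<bar>t\<bar> powr r" for t r :: real
proof (cases "t = 0")
  case False
  then have "t\<^sup>2 = \<bar>t\<bar> powr 2" by simp
  then show ?thesis by (simp only: powr_powr) simp
qed simp

text \<open>Write the p-th powers as powers p / 2 of squares: superadditivity, then the
  parallelogram identity, then convexity of the power p / 2.\<close>

lemma clarkson_pointwise:
  fixes a b p :: real
  assumes "2 < p"
  shows "\<bar>(a + b) / 2\<bar> powr p + \<bar>(a - b) / 2\<bar> powr p \<le> (\<bar>a\<bar> powr p + \<bar>b\<bar> powr p) / 2"
proof -
  have *: "\<bar>t\<bar> powr p = (t\<^sup>2) powr (p / 2)" for t :: real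
    by (simp add: square_powr_half)
  have "\<bar>(a + b) / 2\<bar> powr p + \<bar>(a - b) / 2\<bar> powr p \<le> (((a + b) / 2)\<^sup>2 + ((a - b) / 2)\<^sup>2) powr (p / 2)"
    unfolding * using assms by (intro powr_superadditive) auto
  also have "((a + b) / 2)\<^sup>2 + ((a - b) / 2)\<^sup>2 = (1 - 1/2) *\<^sub>R a\<^sup>2 + (1/2) *\<^sub>R b\<^sup>2"
    by (simp add: power2_eq_square field_simps)
  also have "\<dots> powr (p / 2) \<le> (1 - 1/2) * \<bar>a\<^sup>2\<bar> powr (p / 2) + 1/2 * \<bar>b\<^sup>2\<bar> powr (p / 2)"
    using convex_onD[OF convex_on_abs_powr[of "p / 2"], of "1/2" "a\<^sup>2" "b\<^sup>2"] assms by simp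
  also have "\<dots> = (\<bar>a\<bar> powr p + \<bar>b\<bar> powr p) / 2" by (simp add: *)
  finally show ?thesis .
qed

text \<open>Turns an estimate of p-th powers into one of norms, through (1 - p X)^(1/p) \<le> 1 - X,
  which is weighted AM-GM for \<open>1 - p * X\<close> and 1. The root thus divides the gain by
  \<open>p\<close>.\<close>

lemma powr_root_Bernoulli:
  fixes v s p X :: real
  assumes p: "1 < p" and s: "0 < s" and v: "0 \<le> v" "v \<le> s powr p * (1 - p * X)" and X: "0 \<le> X"
  shows "v powr (1 / p) \<le> s * (1 - X)"
proof -
  have "0 \<le> s powr p * (1 - p * X)" using v by linarith
  then have pX: "p * X \<le> 1" using s by (simp add: zero_le_mult_iff)
  have "1 * X \<le> p * X" using p X by (intro mult_right_mono) auto
  show ?thesis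
  proof (cases "p * X = 1")
    case True
    then show ?thesis using v s pX \<open>1 * X \<le> p * X\<close> by simp
  next
    case False
    then have less: "0 < 1 - p * X" using pX by simp
    have "(1 - p * X) powr (1 / p) * 1 powr (1 - 1 / p) \<le> (1 / p) * (1 - p * X) + (1 - 1 / p) * 1"
      using p less by (intro Youngs_inequality_0) auto
    also have "\<dots> = 1 - X" using p by (simp add: field_simps)
    finally have *: "(1 - p * X) powr (1 / p) \<le> 1 - X" by simp
    have "v powr (1 / p) \<le> (s powr p * (1 - p * X)) powr (1 / p)"
      using v p by (intro powr_mono2) auto
    also have "\<dots> = s * (1 - p * X) powr (1 / p)"
      using s p less by (simp add: powr_mult powr_powr)
    also have "\<dots> \<le> s * (1 - X)" using * s by (intro mult_left_mono) auto
    finally show ?thesis .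
  qed
qed

section \<open>The L_p seminorm on functions and Minkowski's inequality\<close>

definition Lp_norm :: "'x measure \<Rightarrow> real \<Rightarrow> ('x \<Rightarrow> real) \<Rightarrow> real" where
  "Lp_norm M p f = (\<integral>x. \<bar>f x\<bar> powr p \<partial>M) powr (1 / p)"

lemma Lp_norm_nonneg [simp]: "0 \<le> Lp_norm M p f"
  by (simp add: Lp_norm_def)

lemma Lp_norm_powr:
  assumes "0 < p"
  shows "Lp_norm M p f powr p = (\<integral>x. \<bar>f x\<bar> powr p \<partial>M)"
  using assms by (simp add: Lp_norm_def powr_powr)

lemma integral_le_if_Lp_norm_le:
  assumes "0 < p" "Lp_norm M p f \<le> s"
  shows "(\<integral>x. \<bar>f x\<bar> powr p \<partial>M) \<le> s powr p"
  using assms powr_mono2[of p "Lp_norm M p f" s] by (simp add: Lp_norm_powr)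

lemma Lp_norm_le_if_integral_le:
  assumes "0 < p" "0 \<le> s" "(\<integral>x. \<bar>f x\<bar> powr p \<partial>M) \<le> s powr p"
  shows "Lp_norm M p f \<le> s"
  using assms powr_mono2[of "1 / p" "\<integral>x. \<bar>f x\<bar> powr p \<partial>M" "s powr p"]
  by (simp add: Lp_norm_def powr_powr)

lemma Lp_norm_cmult:
  assumes "0 < p"
  shows "Lp_norm M p (\<lambda>x. c * f x) = \<bar>c\<bar> * Lp_norm M p f"
  using assms by (simp add: Lp_norm_def abs_mult powr_mult powr_powr)

lemma Lp_functionsD:
  assumes "f \<in> Lp_functions M p"
  shows "f \<in> borel_measurable M" "integrable M (\<lambda>x. \<bar>f x\<bar> powr p)"
  using assms by (auto simp: Lp_functions_def)

lemma Lp_functions_cmult: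
  assumes "f \<in> Lp_functions M p"
  shows "(\<lambda>x. c * f x) \<in> Lp_functions M p"
  using assms by (auto simp: Lp_functions_def abs_mult powr_mult)

lemma Lp_functions_add:
  assumes p: "1 < p" and "f \<in> Lp_functions M p" "g \<in> Lp_functions M p"
  shows "(\<lambda>x. f x + g x) \<in> Lp_functions M p"
proof -
  note [measurable] = Lp_functionsD(1)[OF assms(2)] Lp_functionsD(1)[OF assms(3)]
  have 2: "(\<lambda>x. 2 * f x) \<in> Lp_functions M p" "(\<lambda>x. 2 * g x) \<in> Lp_functions M p"
    using assms by (auto intro: Lp_functions_cmult)
  have "integrable M (\<lambda>x. \<bar>f x + g x\<bar> powr p)"
  proof (rule Bochner_Integration.integrable_bound)
    show "integrable M (\<lambda>x. 1/2 * \<bar>2 * f x\<bar> powr p + 1/2 * \<bar>2 * g x\<bar> powr p)"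
      using Lp_functionsD(2)[OF 2(1)] Lp_functionsD(2)[OF 2(2)] by simp
    have "\<bar>f x + g x\<bar> powr p \<le> 1/2 * \<bar>2 * f x\<bar> powr p + 1/2 * \<bar>2 * g x\<bar> powr p" for x
      using convex_onD[OF convex_on_abs_powr[OF p], of "1/2" "2 * f x" "2 * g x"] by simp
    then show "AE x in M. norm (\<bar>f x + g x\<bar> powr p) \<le> norm (1/2 * \<bar>2 * f x\<bar> powr p + 1/2 * \<bar>2 * g x\<bar> powr p)"
      by (auto intro!: always_eventually)
  qed measurable
  then show ?thesis by (simp add: Lp_functions_def)
qed

lemma Lp_functions_linear:
  assumes "1 < p" "f \<in> Lp_functions M p" "g \<in> Lp_functions M p"
  shows "(\<lambda>x. s * f x + t * g x) \<in> Lp_functions M p"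
  by (intro Lp_functions_add Lp_functions_cmult assms)

lemma Lp_functions_diff:
  assumes "1 < p" "f \<in> Lp_functions M p" "g \<in> Lp_functions M p"
  shows "(\<lambda>x. f x - g x) \<in> Lp_functions M p"
  using Lp_functions_linear[OF assms, of 1 "-1"] by simp

text \<open>Write \<open>f + g\<close> as a multiple of a convex combination of the normalised
  \<open>f\<close> and \<open>g\<close> and use convexity of the power. The extra
  \<open>e / 2\<close> keeps the normalising factors positive when a norm vanishes.\<close>

lemma Lp_norm_triangle:
  assumes p: "1 < p" and f: "f \<in> Lp_functions M p" and g: "g \<in> Lp_functions M p"
  shows "Lp_norm M p (\<lambda>x. f x + g x) \<le> Lp_norm M p f + Lp_norm M p g"
proof (rule field_le_epsilon)
  fix e :: real assume e: "0 < e"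
  define \<alpha> \<beta> where "\<alpha> = Lp_norm M p f + e / 2" and "\<beta> = Lp_norm M p g + e / 2"
  have pos: "0 < \<alpha>" "0 < \<beta>"
    unfolding \<alpha>_def \<beta>_def using e by (auto intro!: add_nonneg_pos)
  define t where "t = \<beta> / (\<alpha> + \<beta>)"
  have t: "0 \<le> t" "t \<le> 1" and t1: "1 - t = \<alpha> / (\<alpha> + \<beta>)"
    using pos by (auto simp: t_def field_simps)
  let ?c = "(\<alpha> + \<beta>) powr p"
  let ?B = "\<lambda>x. ?c * ((1 - t) * (\<bar>f x\<bar> powr p / \<alpha> powr p) + t * (\<bar>g x\<bar> powr p / \<beta> powr p))"
  have "\<bar>f x + g x\<bar> powr p \<le> ?B x" for x
  proof -
    have "f x + g x = (\<alpha> + \<beta>) * ((1 - t) *\<^sub>R (f x / \<alpha>) + t *\<^sub>R (g x / \<beta>))"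
    proof -
      have "(\<alpha> + \<beta>) * (1 - t) = \<alpha>" "(\<alpha> + \<beta>) * t = \<beta>"
        unfolding t1 using pos by (simp_all add: t_def)
      then have "(\<alpha> + \<beta>) * ((1 - t) * a + t * b) = \<alpha> * a + \<beta> * b" for a b
        by (metis distrib_left mult.assoc)
      from this[of "f x / \<alpha>" "g x / \<beta>"] show ?thesis using pos by simp
    qed
    then have "\<bar>f x + g x\<bar> powr p = ?c * \<bar>(1 - t) *\<^sub>R (f x / \<alpha>) + t *\<^sub>R (g x / \<beta>)\<bar> powr p"
      using pos by (simp only: abs_mult powr_mult abs_of_pos add_pos_pos)
    also have "\<bar>(1 - t) *\<^sub>R (f x / \<alpha>) + t *\<^sub>R (g x / \<beta>)\<bar> powr p
        \<le> (1 - t) * \<bar>f x / \<alpha>\<bar> powr p + t * \<bar>g x / \<beta>\<bar> powr p"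
      using t by (intro convex_onD[OF convex_on_abs_powr[OF p]]) auto
    finally show ?thesis using pos by (simp add: powr_divide)
  qed
  then have "(\<integral>x. \<bar>f x + g x\<bar> powr p \<partial>M) \<le> (\<integral>x. ?B x \<partial>M)"
    using Lp_functionsD(2)[OF Lp_functions_add[OF p f g]] Lp_functionsD(2)[OF f] Lp_functionsD(2)[OF g]
    by (intro integral_mono) auto
  also have "\<dots> = ?c * ((1 - t) * ((\<integral>x. \<bar>f x\<bar> powr p \<partial>M) / \<alpha> powr p) + t * ((\<integral>x. \<bar>g x\<bar> powr p \<partial>M) / \<beta> powr p))"
    using Lp_functionsD(2)[OF f] Lp_functionsD(2)[OF g] by simp
  also have "\<dots> \<le> ?c * ((1 - t) * 1 + t * 1)"
    using integral_le_if_Lp_norm_le[of p M f \<alpha>] integral_le_if_Lp_norm_le[of p M g \<beta>] p pos t e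
    by (intro mult_left_mono add_mono) (auto simp: \<alpha>_def \<beta>_def)
  finally have "Lp_norm M p (\<lambda>x. f x + g x) \<le> \<alpha> + \<beta>"
    using p pos by (intro Lp_norm_le_if_integral_le) auto
  then show "Lp_norm M p (\<lambda>x. f x + g x) \<le> Lp_norm M p f + Lp_norm M p g + e"
    by (simp add: \<alpha>_def \<beta>_def)
qed

section \<open>Uniform convexity of the L_p seminorm\<close>

lemma Lp_uniform_convexity_ge_2:
  assumes p: "2 < p" and f: "f \<in> Lp_functions M p" and g: "g \<in> Lp_functions M p"
    and s: "0 < s" "Lp_norm M p f \<le> s" "Lp_norm M p g \<le> s"
  shows "Lp_norm M p (\<lambda>x. (f x + g x) / 2) \<le>
    s - 1 / (p * 2 powr p) * (Lp_norm M p (\<lambda>x. f x - g x) powr p / s powr (p - 1))"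
proof -
  let ?D = "Lp_norm M p (\<lambda>x. f x - g x)"
  have p1: "1 < p" using p by simp
  have u: "(\<lambda>x. (f x + g x) / 2) \<in> Lp_functions M p"
    using Lp_functions_linear[OF p1 f g, of "1/2" "1/2"] by (simp add: add_divide_distrib)
  have v: "(\<lambda>x. (f x - g x) / 2) \<in> Lp_functions M p"
    using Lp_functions_linear[OF p1 f g, of "1/2" "-1/2"] by (simp add: diff_divide_distrib)
  have "(\<integral>x. \<bar>(f x + g x) / 2\<bar> powr p \<partial>M) + (\<integral>x. \<bar>(f x - g x) / 2\<bar> powr p \<partial>M)
      = (\<integral>x. \<bar>(f x + g x) / 2\<bar> powr p + \<bar>(f x - g x) / 2\<bar> powr p \<partial>M)"
    using Lp_functionsD(2)[OF u] Lp_functionsD(2)[OF v] by simp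
  also have "\<dots> \<le> (\<integral>x. (\<bar>f x\<bar> powr p + \<bar>g x\<bar> powr p) / 2 \<partial>M)"
    using Lp_functionsD(2)[OF u] Lp_functionsD(2)[OF v] Lp_functionsD(2)[OF f] Lp_functionsD(2)[OF g]
    by (intro integral_mono clarkson_pointwise p) auto
  also have "\<dots> \<le> s powr p"
    using integral_le_if_Lp_norm_le[of p M f s] integral_le_if_Lp_norm_le[of p M g s] p s
      Lp_functionsD(2)[OF f] Lp_functionsD(2)[OF g] by simp
  also have "(\<integral>x. \<bar>(f x - g x) / 2\<bar> powr p \<partial>M) = ?D powr p / 2 powr p"
    using p by (simp add: Lp_norm_powr powr_divide)
  finally have I: "(\<integral>x. \<bar>(f x + g x) / 2\<bar> powr p \<partial>M) \<le> s powr p * (1 - p * (?D powr p / (p * 2 powr p * s powr p)))"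
    using p s by (simp add: algebra_simps)
  have "Lp_norm M p (\<lambda>x. (f x + g x) / 2) \<le> s * (1 - ?D powr p / (p * 2 powr p * s powr p))"
    unfolding Lp_norm_def[of M p "\<lambda>x. (f x + g x) / 2"]
    by (rule powr_root_Bernoulli[OF p1 s(1) _ I]) (use p in auto)
  also have "\<dots> = s - 1 / (p * 2 powr p) * (?D powr p / s powr (p - 1))"
    using s p by (simp add: powr_diff field_simps)
  finally show ?thesis .
qed

text \<open>Integrating the pointwise inequality gains \<open>c\<close> times the integral of
  \<open>h\<close>, a weighted square of \<open>f - g\<close>. Hoelder bounds that integral below by
  \<open>D\<^sup>2 * s powr (p - 2) / 2\<close>, using that the integral of \<open>m powr p\<close>
  is at most \<open>2 * s powr p\<close>.\<close>

lemma Lp_uniform_convexity_le_2: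
  assumes p: "1 < p" "p \<le> 2" and f: "f \<in> Lp_functions M p" and g: "g \<in> Lp_functions M p"
    and s: "0 < s" "Lp_norm M p f \<le> s" "Lp_norm M p g \<le> s"
  shows "Lp_norm M p (\<lambda>x. (f x + g x) / 2) \<le>
    s - (p - 1) / 16 * ((Lp_norm M p (\<lambda>x. f x - g x))\<^sup>2 / s)"
proof -
  note [measurable] = Lp_functionsD(1)[OF f] Lp_functionsD(1)[OF g]
  define D where "D = Lp_norm M p (\<lambda>x. f x - g x)"
  define m where "m x = max \<bar>f x\<bar> \<bar>g x\<bar>" for x
  define h where "h x = (f x - g x)\<^sup>2 * m x powr (p - 2)" for x
  have [measurable]: "h \<in> borel_measurable M" "m \<in> borel_measurable M"
    unfolding h_def m_def by measurable
  have mnn: "0 \<le> m x" for x by (simp add: m_def)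
  have hnn: "0 \<le> h x" for x by (simp add: h_def)
  define c where "c = p * (p - 1) / 8"
  have c: "0 < c" using p by (simp add: c_def)
  have u: "(\<lambda>x. (f x + g x) / 2) \<in> Lp_functions M p"
    using Lp_functions_linear[OF p(1) f g, of "1/2" "1/2"] by (simp add: add_divide_distrib)
  note int = Lp_functionsD(2)[OF u] Lp_functionsD(2)[OF f] Lp_functionsD(2)[OF g]
    Lp_functionsD(2)[OF Lp_functions_diff[OF p(1) f g]]
  note sp = integral_le_if_Lp_norm_le[of p M f s] integral_le_if_Lp_norm_le[of p M g s]
  have pw: "\<bar>(f x + g x) / 2\<bar> powr p + c * h x \<le> (\<bar>f x\<bar> powr p + \<bar>g x\<bar> powr p) / 2" for x
    using abs_powr_midpoint_quadratic[OF p, of "f x" "g x"] by (simp add: c_def h_def m_def)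
  have "integrable M (\<lambda>x. c * h x)"
  proof (rule Bochner_Integration.integrable_bound)
    show "integrable M (\<lambda>x. (\<bar>f x\<bar> powr p + \<bar>g x\<bar> powr p) / 2)" using int by simp
    have "c * h x \<le> (\<bar>f x\<bar> powr p + \<bar>g x\<bar> powr p) / 2" for x
      using pw[of x] powr_ge_zero[of "\<bar>(f x + g x) / 2\<bar>" p] by linarith
    then show "AE x in M. norm (c * h x) \<le> norm ((\<bar>f x\<bar> powr p + \<bar>g x\<bar> powr p) / 2)"
      using c hnn by (auto intro!: always_eventually simp: abs_mult)
  qed measurable
  then have inth: "integrable M h" using c by simp
  have "(\<integral>x. \<bar>(f x + g x) / 2\<bar> powr p \<partial>M) + c * (\<integral>x. h x \<partial>M)
      = (\<integral>x. \<bar>(f x + g x) / 2\<bar> powr p + c * h x \<partial>M)"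
    using int inth by simp
  also have "\<dots> \<le> (\<integral>x. (\<bar>f x\<bar> powr p + \<bar>g x\<bar> powr p) / 2 \<partial>M)"
    using int inth pw by (intro integral_mono) auto
  also have "\<dots> \<le> s powr p" using sp p s int by simp
  finally have I: "(\<integral>x. \<bar>(f x + g x) / 2\<bar> powr p \<partial>M) + c * (\<integral>x. h x \<partial>M) \<le> s powr p" .
  have m_le: "m x powr p \<le> \<bar>f x\<bar> powr p + \<bar>g x\<bar> powr p" for x
    by (simp add: m_def max_def)
  have intm: "integrable M (\<lambda>x. m x powr p)"
  proof (rule Bochner_Integration.integrable_bound)
    show "integrable M (\<lambda>x. \<bar>f x\<bar> powr p + \<bar>g x\<bar> powr p)" using int by simp
    show "AE x in M. norm (m x powr p) \<le> norm (\<bar>f x\<bar> powr p + \<bar>g x\<bar> powr p)"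
      using m_le by (auto intro!: always_eventually)
  qed measurable
  have "(\<integral>x. m x powr p \<partial>M) \<le> (\<integral>x. \<bar>f x\<bar> powr p + \<bar>g x\<bar> powr p \<partial>M)"
    using int intm m_le by (intro integral_mono) auto
  also have "\<dots> \<le> 2 * s powr p" using sp p s int by simp
  finally have Im: "(\<integral>x. m x powr p \<partial>M) \<le> 2 * s powr p" .
  \<comment> \<open>Hoelder's inequality for \<open>\<bar>f - g\<bar> powr p = h powr (p / 2) * (m powr p) powr (1 - p / 2)\<close>,
    via the pointwise Young inequality\<close>
  have H: "D\<^sup>2 * s powr (p - 2) / 2 \<le> (\<integral>x. h x \<partial>M)"
  proof (rule ccontr)
    assume less: "\<not> D\<^sup>2 * s powr (p - 2) / 2 \<le> (\<integral>x. h x \<partial>M)"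
    \<comment> \<open>\<open>A\<close> is the lower bound to be refuted and \<open>B\<close> the
      bound for the integral of \<open>m powr p\<close>. Normalising by them lets the pointwise
      Young inequality integrate to less than \<open>?K\<close>, which equals
      \<open>D powr p * 2 powr (1 - p)\<close>: a contradiction, since
      \<open>p \<ge> 1\<close>.\<close>
    define A B where "A = D\<^sup>2 * s powr (p - 2) / 2" and "B = 2 * s powr p"
    have "0 \<le> (\<integral>x. h x \<partial>M)" using hnn by simp
    then have A: "0 < A" using less unfolding A_def by linarith
    then have D: "0 < D" using Lp_norm_nonneg by (cases "D = 0") (auto simp: A_def D_def order_less_le)
    have B: "0 < B" using s by (simp add: B_def)
    let ?K = "A powr (p / 2) * B powr (1 - p / 2)"
    have K: "0 < ?K" using A B by simp
    have pwH: "\<bar>f x - g x\<bar> powr p \<le> ?K * (p / 2 * (h x / A) + (1 - p / 2) * (m x powr p / B))" for x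
    \<comment> \<open>Young's inequality is applied to positive numbers; \<open>h\<close> and
      \<open>m\<close> are positive at \<open>x\<close> as soon as
      \<open>f x \<noteq> g x\<close>.\<close>
    proof (cases "f x = g x")
      case True
      then show ?thesis using K A B p hnn[of x] by (auto intro!: mult_nonneg_nonneg add_nonneg_nonneg)
    next
      case False
      then have mp: "0 < m x" by (auto simp: m_def less_max_iff_disj)
      then have hp: "0 < h x" using False by (simp add: h_def)
      have "\<bar>f x - g x\<bar> powr p = h x powr (p / 2) * (m x powr p) powr (1 - p / 2)"
      proof -
        have "h x powr (p / 2) = \<bar>f x - g x\<bar> powr p * m x powr ((p - 2) * (p / 2))"
          by (simp add: h_def powr_mult powr_powr square_powr_half)
        moreover have "(m x powr p) powr (1 - p / 2) = m x powr (- ((p - 2) * (p / 2)))"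
          by (simp add: powr_powr right_diff_distrib diff_divide_distrib left_diff_distrib)
        ultimately show ?thesis using mp by (simp add: powr_minus)
      qed
      also have "\<dots> = ?K * ((h x / A) powr (p / 2) * ((m x powr p) / B) powr (1 - p / 2))"
        using A B hp mp by (simp add: powr_divide)
      also have "\<dots> \<le> ?K * (p / 2 * (h x / A) + (1 - p / 2) * (m x powr p / B))"
        using A B hp mp p K by (intro mult_left_mono Youngs_inequality_0) auto
      finally show ?thesis .
    qed
    have "D powr p = (\<integral>x. \<bar>f x - g x\<bar> powr p \<partial>M)" using p by (simp add: D_def Lp_norm_powr)
    also have "\<dots> \<le> (\<integral>x. ?K * (p / 2 * (h x / A) + (1 - p / 2) * (m x powr p / B)) \<partial>M)"
      using int inth intm pwH by (intro integral_mono) auto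
    also have "\<dots> = ?K * (p / 2 * ((\<integral>x. h x \<partial>M) / A) + (1 - p / 2) * ((\<integral>x. m x powr p \<partial>M) / B))"
      using inth intm by simp
    also have "\<dots> < ?K * (p / 2 * 1 + (1 - p / 2) * 1)"
    proof (intro mult_strict_left_mono add_less_le_mono mult_left_mono K)
      show "(\<integral>x. h x \<partial>M) / A < 1" using less A by (simp add: A_def)
      show "(\<integral>x. m x powr p \<partial>M) / B \<le> 1" using Im B by (simp add: B_def)
    qed (use p in auto)
    also have "\<dots> = D powr p * 2 powr (1 - p)"
    proof -
      have "A powr (p / 2) = D powr p * s powr ((p - 2) * (p / 2)) * 2 powr (- (p / 2))"
        using D s by (simp add: A_def powr_mult powr_divide powr_powr square_powr_half powr_minus_divide)
      moreover have "B powr (1 - p / 2) = 2 powr (1 - p / 2) * s powr (- ((p - 2) * (p / 2)))"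
        using s
        by (simp add: B_def powr_mult powr_powr right_diff_distrib diff_divide_distrib left_diff_distrib)
      moreover have "s powr ((p - 2) * (p / 2)) * s powr (- ((p - 2) * (p / 2))) = 1"
        using s by (simp flip: powr_add)
      moreover have "(2::real) powr (- (p / 2)) * 2 powr (1 - p / 2) = 2 powr (1 - p)"
        by (simp flip: powr_add)
      ultimately show ?thesis by (simp add: algebra_simps)
    qed
    also have "\<dots> \<le> D powr p * 2 powr 0"
      using p by (intro mult_left_mono powr_mono) auto
    finally show False by simp
  qed
  \<comment> \<open>The 16 is the 8 of the pointwise inequality times the 2 lost in Hoelder; the
    factor \<open>p\<close> is set apart because the root will remove it.\<close>
  have "s powr p * (1 - p * ((p - 1) / 16 * (D\<^sup>2 / s\<^sup>2))) = s powr p - c * (D\<^sup>2 * s powr (p - 2) / 2)"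
    using s by (simp add: c_def powr_diff power2_eq_square field_simps)
  also have "\<dots> \<ge> s powr p - c * (\<integral>x. h x \<partial>M)"
    using H c by (intro diff_left_mono mult_left_mono) auto
  finally have I': "(\<integral>x. \<bar>(f x + g x) / 2\<bar> powr p \<partial>M) \<le> s powr p * (1 - p * ((p - 1) / 16 * (D\<^sup>2 / s\<^sup>2)))"
    using I by linarith
  have "Lp_norm M p (\<lambda>x. (f x + g x) / 2) \<le> s * (1 - (p - 1) / 16 * (D\<^sup>2 / s\<^sup>2))"
    unfolding Lp_norm_def
    by (rule powr_root_Bernoulli[OF p(1) s(1) _ I']) (use p in auto)
  also have "\<dots> = s - (p - 1) / 16 * (D\<^sup>2 / s)"
    using s by (simp add: power2_eq_square field_simps)
  finally show ?thesis by (simp add: D_def)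
qed


section \<open>Classes of functions: the metric and convex combinations\<close>

lemma Lp_rep_in_functions:
  assumes "F \<in> Lp_space M p"
  shows "Lp_rep F \<in> Lp_functions M p" and "Lp_class M (Lp_rep F) = F"
proof -
  obtain f where f: "f \<in> Lp_functions M p" and F: "F = Lp_class M f"
    using assms by (auto simp: Lp_space_def)
  note [measurable] = Lp_functionsD(1)[OF f]
  note [measurable] = Lp_rep_class(1)[of f M]
  have ae: "AE x in M. Lp_rep F x = f x" and [measurable]: "Lp_rep F \<in> borel_measurable M"
    using Lp_rep_class[of f M] by (auto simp: F)
  have "integrable M (\<lambda>x. \<bar>Lp_rep F x\<bar> powr p) \<longleftrightarrow> integrable M (\<lambda>x. \<bar>f x\<bar> powr p)"
    by (rule integrable_cong_AE) (use ae in auto)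
  then show "Lp_rep F \<in> Lp_functions M p"
    using Lp_functionsD(2)[OF f] by (simp add: Lp_functions_def)
  have "(AE x in M. g x = Lp_rep F x) \<longleftrightarrow> (AE x in M. g x = f x)" for g
    using ae by (auto elim: eventually_elim2)
  then show "Lp_class M (Lp_rep F) = F" by (simp add: F Lp_class_def)
qed

lemma Lp_dist_eq_norm: "Lp_dist M p F G = Lp_norm M p (\<lambda>x. Lp_rep F x - Lp_rep G x)"
  by (simp add: Lp_dist_def Lp_norm_def)

lemma Lp_dist_class_right:
  assumes "F \<in> Lp_space M p" "g \<in> borel_measurable M"
  shows "Lp_dist M p F (Lp_class M g) = Lp_norm M p (\<lambda>x. Lp_rep F x - g x)"
  using Lp_dist_class[of "Lp_rep F" M g p] Lp_rep_in_functions[OF assms(1)] assms(2)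
  by (simp add: Lp_functionsD(1) Lp_norm_def)

lemma Metric_space_Lp:
  assumes p: "1 < p"
  shows "Metric_space (Lp_space M p) (Lp_dist M p)"
proof
  fix F G H
  show "0 \<le> Lp_dist M p F G" by (simp add: Lp_dist_eq_norm)
  show "Lp_dist M p F G = Lp_dist M p G F" by (simp add: Lp_dist_def abs_minus_commute)
  assume F: "F \<in> Lp_space M p" and G: "G \<in> Lp_space M p"
  note fg = Lp_rep_in_functions[OF F] Lp_rep_in_functions[OF G]
  note diff = Lp_functions_diff[OF p]
  have "Lp_dist M p F G = 0 \<longleftrightarrow> (\<integral>x. \<bar>Lp_rep F x - Lp_rep G x\<bar> powr p \<partial>M) = 0"
    by (simp add: Lp_dist_def)
  also have "\<dots> \<longleftrightarrow> (AE x in M. \<bar>Lp_rep F x - Lp_rep G x\<bar> powr p = 0)"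
    using Lp_functionsD(2)[OF diff[OF fg(1,3)]] by (intro integral_nonneg_eq_0_iff_AE) auto
  also have "\<dots> \<longleftrightarrow> F = G"
  proof
    assume ae: "AE x in M. \<bar>Lp_rep F x - Lp_rep G x\<bar> powr p = 0"
    then have "(AE x in M. g x = Lp_rep F x) \<longleftrightarrow> (AE x in M. g x = Lp_rep G x)" for g
      by (auto elim: eventually_elim2)
    then have "Lp_class M (Lp_rep F) = Lp_class M (Lp_rep G)" by (simp add: Lp_class_def)
    then show "F = G" using fg by simp
  qed simp
  finally show "Lp_dist M p F G = 0 \<longleftrightarrow> F = G" .
  assume H: "H \<in> Lp_space M p"
  note h = Lp_rep_in_functions(1)[OF H]
  show "Lp_dist M p F H \<le> Lp_dist M p F G + Lp_dist M p G H"
    using Lp_norm_triangle[OF p diff[OF fg(1,3)] diff[OF fg(3) h]] by (simp add: Lp_dist_eq_norm)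
qed

lemma Lp_convex_conv_point:
  assumes p: "1 < p" and C: "C \<subseteq> Lp_space M p" "Lp_convex M C"
    and FG: "F \<in> C" "G \<in> C" and t: "0 \<le> t" "t \<le> 1"
  shows "conv_point C (Lp_dist M p) F G t (Lp_class M (\<lambda>x. (1 - t) * Lp_rep F x + t * Lp_rep G x))"
  unfolding conv_point_def
proof (intro conjI ballI)
  show "Lp_class M (\<lambda>x. (1 - t) * Lp_rep F x + t * Lp_rep G x) \<in> C"
    using C(2) FG t unfolding Lp_convex_def by auto
  have rep: "Lp_rep K \<in> Lp_functions M p" if "K \<in> C" for K
    using that C(1) Lp_rep_in_functions(1) by blast
  fix W assume W: "W \<in> C"
  note diff = Lp_functions_diff[OF p rep[OF W] rep]
  have "Lp_dist M p W (Lp_class M (\<lambda>x. (1 - t) * Lp_rep F x + t * Lp_rep G x))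
      = Lp_norm M p (\<lambda>x. Lp_rep W x - ((1 - t) * Lp_rep F x + t * Lp_rep G x))"
    using W C(1) Lp_functionsD(1)[OF Lp_functions_linear[OF p rep[OF FG(1)] rep[OF FG(2)]]]
    by (intro Lp_dist_class_right) auto
  also have "(\<lambda>x. Lp_rep W x - ((1 - t) * Lp_rep F x + t * Lp_rep G x))
      = (\<lambda>x. (1 - t) * (Lp_rep W x - Lp_rep F x) + t * (Lp_rep W x - Lp_rep G x))"
    by (simp add: algebra_simps)
  also have "Lp_norm M p \<dots> \<le> Lp_norm M p (\<lambda>x. (1 - t) * (Lp_rep W x - Lp_rep F x))
      + Lp_norm M p (\<lambda>x. t * (Lp_rep W x - Lp_rep G x))"
    by (intro Lp_norm_triangle p Lp_functions_cmult diff FG)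
  also have "\<dots> = (1 - t) * Lp_dist M p W F + t * Lp_dist M p W G"
    using p t by (simp add: Lp_norm_cmult Lp_dist_eq_norm)
  finally show "Lp_dist M p W (Lp_class M (\<lambda>x. (1 - t) * Lp_rep F x + t * Lp_rep G x))
      \<le> (1 - t) * Lp_dist M p W F + t * Lp_dist M p W G" .
qed

lemma Lp_uniqueness_modulus:
  assumes p: "1 < p" and C: "C \<subseteq> Lp_space M p" "Lp_convex M C"
  shows "uniqueness_modulus C (Lp_dist M p) (Phi_Lp p)"
proof -
  have metric: "Metric_space C (Lp_dist M p)"
    using Metric_space.subspace[OF Metric_space_Lp[OF p] C(1)] .
  have rep: "Lp_rep K \<in> Lp_functions M p" if "K \<in> C" for K
    using that C(1) Lp_rep_in_functions(1) by blast
  have conv: "\<exists>m. conv_point C (Lp_dist M p) F G t m"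
    if "F \<in> C" "G \<in> C" "0 \<le> t" "t \<le> 1" for F G t
    using Lp_convex_conv_point[OF p C that] by blast
  \<comment> \<open>Convexity is applied to the functions X - Y and X - Z: their mean is X minus the
    midpoint of Y and Z, their difference is Y - Z up to sign. Keeping \<open>k\<close> and
    \<open>q\<close> general serves both ranges of \<open>p\<close>.\<close>
  have midpoint: "\<exists>U\<in>C. \<forall>X\<in>C. \<forall>s>0. Lp_dist M p X Y \<le> s \<and> Lp_dist M p X Z \<le> s \<longrightarrow>
      Lp_dist M p X U \<le> s - k * (Lp_dist M p Y Z powr q / s powr (q - 1))"
    if YZ: "Y \<in> C" "Z \<in> C" and
      uc: "\<And>f g s. f \<in> Lp_functions M p \<Longrightarrow> g \<in> Lp_functions M p \<Longrightarrow> 0 < s \<Longrightarrow>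
         Lp_norm M p f \<le> s \<Longrightarrow> Lp_norm M p g \<le> s \<Longrightarrow>
         Lp_norm M p (\<lambda>x. (f x + g x) / 2) \<le> s - k * (Lp_norm M p (\<lambda>x. g x - f x) powr q / s powr (q - 1))"
    for Y Z k q
  proof (intro bexI ballI allI impI)
    let ?u = "\<lambda>x. (1 - 1/2) * Lp_rep Y x + 1/2 * Lp_rep Z x"
    have "1 / 2 \<in> {0..1::real}" by simp
    then show U: "Lp_class M ?u \<in> C" using C(2) YZ unfolding Lp_convex_def by blast
    fix X and s :: real assume X: "X \<in> C" and s: "0 < s"
      and le: "Lp_dist M p X Y \<le> s \<and> Lp_dist M p X Z \<le> s"
    have "Lp_dist M p X (Lp_class M ?u) = Lp_norm M p (\<lambda>x. Lp_rep X x - ?u x)"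
      using X C(1) Lp_functionsD(1)[OF Lp_functions_linear[OF p rep[OF YZ(1)] rep[OF YZ(2)]]]
      by (intro Lp_dist_class_right) (rule subsetD, assumption+)
    also have "(\<lambda>x. Lp_rep X x - ?u x) = (\<lambda>x. ((Lp_rep X x - Lp_rep Y x) + (Lp_rep X x - Lp_rep Z x)) / 2)"
      by (simp add: field_simps)
    also have "Lp_norm M p \<dots> \<le> s - k * (Lp_norm M p (\<lambda>x. (Lp_rep X x - Lp_rep Z x) - (Lp_rep X x - Lp_rep Y x)) powr q / s powr (q - 1))"
      using le s by (intro uc Lp_functions_diff p rep X YZ) (auto simp: Lp_dist_eq_norm)
    finally show "Lp_dist M p X (Lp_class M ?u) \<le> s - k * (Lp_dist M p Y Z powr q / s powr (q - 1))"
      by (simp add: Lp_dist_eq_norm)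
  qed
  have swap: "Lp_norm M p (\<lambda>x. g x - f x) = Lp_norm M p (\<lambda>x. f x - g x)" for f g
    by (simp add: Lp_norm_def abs_minus_commute)
  show ?thesis
  proof (cases "p \<le> 2")
    case True
    show ?thesis
    \<comment> \<open>The constant \<open>(p - 1) / 8\<close> of \<open>Phi_Lp\<close> is exactly
      \<open>2 * k\<close>, the most that the power-type lemma allows.\<close>
    proof (rule power_type_uniqueness_modulus[OF metric conv midpoint, where k = "(p - 1) / 16" and q = 2 and k' = "(p - 1) / 8"])
      show "Phi_Lp p e b = (p - 1) / 8 * (e powr 2 / (b + e) powr (2 - 1))" if "0 < e" "0 < b" for e b
        using True that by (simp add: Phi_Lp_def)
      fix f g and s :: real
      assume "f \<in> Lp_functions M p" "g \<in> Lp_functions M p" "0 < s"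
         "Lp_norm M p f \<le> s" "Lp_norm M p g \<le> s"
      from Lp_uniform_convexity_le_2[OF p True this]
      show "Lp_norm M p (\<lambda>x. (f x + g x) / 2) \<le> s - (p - 1) / 16 * (Lp_norm M p (\<lambda>x. g x - f x) powr 2 / s powr (2 - 1))"
        using \<open>0 < s\<close> by (simp add: swap[of g f])
    qed (use p True in auto)
  next
    case False
    then have p2: "2 < p" by simp
    have "1 * 1 \<le> p * 2 powr p" using p by (intro mult_mono ge_one_powr_ge_zero) auto
    then have small: "1 / (p * 2 powr p) \<le> 1" by simp
    show ?thesis
    proof (rule power_type_uniqueness_modulus[OF metric conv midpoint, where k = "1 / (p * 2 powr p)" and q = p and k' = "1 / (p * 2 powr p)"])
      show "Phi_Lp p e b = 1 / (p * 2 powr p) * (e powr p / (b + e) powr (p - 1))" if "0 < e" "0 < b" for e b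
        using False that by (simp add: Phi_Lp_def)
      fix f g and s :: real
      assume "f \<in> Lp_functions M p" "g \<in> Lp_functions M p" "0 < s"
         "Lp_norm M p f \<le> s" "Lp_norm M p g \<le> s"
      from Lp_uniform_convexity_ge_2[OF p2 this]
      show "Lp_norm M p (\<lambda>x. (f x + g x) / 2) \<le> s - 1 / (p * 2 powr p) * (Lp_norm M p (\<lambda>x. g x - f x) powr p / s powr (p - 1))"
        by (simp only: swap[of g f])
    qed (use p small in \<open>auto intro: divide_right_mono\<close>)
  qed
qed

section \<open>Comparison triangles\<close>

lemma geodesic_segmentI:
  assumes "\<And>t. 0 \<le> t \<Longrightarrow> t \<le> d x y \<Longrightarrow> c t \<in> X" "c 0 = x" "c (d x y) = y"
    and "\<And>s t. 0 \<le> s \<Longrightarrow> s \<le> d x y \<Longrightarrow> 0 \<le> t \<Longrightarrow> t \<le> d x y \<Longrightarrow> d (c s) (c t) = \<bar>s - t\<bar>"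
  shows "geodesic_segment X d x y (c ` {0..d x y})"
  unfolding geodesic_segment_def using assms by (intro exI[of _ c]) auto

lemma geodesic_segment_endpoints:
  assumes "geodesic_segment X d x y S" "0 \<le> d x y"
  shows "x \<in> S" "y \<in> S"
proof -
  obtain c where "c ` {0..d x y} = S" "c 0 = x" "c (d x y) = y"
    using assms(1) unfolding geodesic_segment_def by blast
  then show "x \<in> S" "y \<in> S"
    using assms(2) imageI[of 0 "{0..d x y}" c] imageI[of "d x y" "{0..d x y}" c] by simp_all
qed

lemma CAT_geodesic:
  assumes "CAT_space \<kappa> X d" "x \<in> X" "y \<in> X" "\<kappa> > 0 \<Longrightarrow> d x y < pi / sqrt \<kappa>"
  shows "\<exists>S. geodesic_segment X d x y S"
proof -
  have "\<forall>x\<in>X. \<forall>y\<in>X. (\<kappa> > 0 \<longrightarrow> d x y < pi / sqrt \<kappa>) \<longrightarrow> (\<exists>S. geodesic_segment X d x y S)"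
    using assms(1) unfolding CAT_space_def by (elim conjE)
  then show ?thesis using assms(2-4) by simp
qed

text \<open>Unwinds the indexed CAT condition once for all curvatures. Side 0 runs from
  \<open>z\<close> to \<open>m\<close> and carries \<open>u\<close>; the opposite vertex
  \<open>x\<close> is treated as the initial point of side 2.\<close>

lemma CAT_vertex_comparison:
  assumes CAT: "CAT_space \<kappa> X d"
    and C: "z \<in> X" "m \<in> X" "x \<in> X" and S: "geodesic_segment X d z m S" "u \<in> S"
    and small: "\<kappa> > 0 \<Longrightarrow> d z m + d m x + d x z < 2 * (pi / sqrt \<kappa>)"
       "\<kappa> > 0 \<Longrightarrow> d m x < pi / sqrt \<kappa>" "\<kappa> > 0 \<Longrightarrow> d x z < pi / sqrt \<kappa>"
    and plane: "z' \<in> model_plane \<kappa>" "m' \<in> model_plane \<kappa>" "x' \<in> model_plane \<kappa>"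
    and S': "geodesic_segment (model_plane \<kappa>) (model_dist \<kappa>) z' m' S0" "u' \<in> S0"
      "geodesic_segment (model_plane \<kappa>) (model_dist \<kappa>) m' x' S1"
      "geodesic_segment (model_plane \<kappa>) (model_dist \<kappa>) x' z' S2"
    and eq: "model_dist \<kappa> z' m' = d z m" "model_dist \<kappa> m' x' = d m x" "model_dist \<kappa> x' z' = d x z"
      "model_dist \<kappa> z' u' = d z u" "model_dist \<kappa> x' x' = 0"
  shows "d u x \<le> model_dist \<kappa> u' x'"
proof -
  interpret Metric_space X d using CAT by (simp add: CAT_space_def)
  obtain T1 T2 where T: "geodesic_segment X d m x T1" "geodesic_segment X d x z T2"
    using CAT_geodesic[OF CAT C(2,3) small(2)] CAT_geodesic[OF CAT C(3,1) small(3)] by blast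
  define v where "v = (\<lambda>i::nat. if i = 0 then z else if i = 1 then m else x)"
  define V where "V = (\<lambda>i::nat. if i = 0 then S else if i = 1 then T1 else T2)"
  define v' where "v' = (\<lambda>i::nat. if i = 0 then z' else if i = 1 then m' else x')"
  define V' where "V' = (\<lambda>i::nat. if i = 0 then S0 else if i = 1 then S1 else S2)"
  have all3: "(\<forall>i<3. P i) \<longleftrightarrow> P 0 \<and> P 1 \<and> P 2" for P :: "nat \<Rightarrow> bool"
    by (auto simp: numeral_3_eq_3 less_Suc_eq numeral_2_eq_2)
  have tri: "geodesic_triangle X d v V"
    using C S T unfolding geodesic_triangle_def all3 by (simp add: v_def V_def)
  have comp: "comparison_triangle \<kappa> d v v' V'"
    using plane S' eq unfolding comparison_triangle_def geodesic_triangle_def all3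
    by (simp add: v_def v'_def V'_def)
  have per: "\<kappa> > 0 \<longrightarrow> (\<Sum>i<3. d (v i) (v (Suc i mod 3))) < 2 * (pi / sqrt \<kappa>)"
  proof -
    have "(\<Sum>i<3. f i) = f 0 + f 1 + f 2" for f :: "nat \<Rightarrow> real"
      by (simp add: eval_nat_numeral)
    then show ?thesis using small(1) by (simp add: v_def)
  qed
  have x: "x \<in> V 2" using geodesic_segment_endpoints[OF T(2)] by (simp add: V_def)
  have x': "x' \<in> V' 2"
    using geodesic_segment_endpoints(1)[OF S'(4)] eq(3) by (simp add: V'_def)
  have mem: "u \<in> V 0" "u' \<in> V' 0"
    and dist: "model_dist \<kappa> (v' 0) u' = d (v 0) u" "model_dist \<kappa> (v' 2) x' = d (v 2) x"
    using S S' eq C by (simp_all add: V_def V'_def v_def v'_def)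
  show ?thesis
    using CAT[unfolded CAT_space_def, THEN conjunct2, THEN conjunct2, rule_format,
        of v V v' V' 0 2 u x u' x'] tri comp per mem x x' dist by simp
qed

text \<open>
  A comparison triangle is placed so that the midpoint of its base is \<open>(0, 0, 1)\<close> on the sphere or
  hyperboloid. The law of cosines then determines two coordinates of the apex; the third one exists
  by the next bound, where \<open>A, B, w\<close> are the squared cosines of half the sum and half the
  difference of the other two sides, and of half the base.
\<close>

lemma vertex_coordinate_bound:
  fixes A B w :: real
  assumes "0 < w" "w < 1" "A \<le> w" "w \<le> B"
  shows "A * B / w + (1 - A) * (1 - B) / (1 - w) \<le> 1"
proof -
  have "0 \<le> (w - A) * (B - w)" using assms by simp
  then have "A * B * (1 - w) + (1 - A) * (1 - B) * w \<le> w * (1 - w)" by (simp add: algebra_simps)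
  then show ?thesis using assms by (simp add: field_simps)
qed

subsection \<open>Positive curvature\<close>

text \<open>The segment is an arc of a great circle, with unit tangent \<open>w\<close> obtained
  from \<open>v\<close> by Gram-Schmidt. Antipodal points, for which \<open>w\<close> would be
  undefined, are excluded by the distance bound.\<close>

lemma model_segment_pos:
  assumes \<kappa>: "\<kappa> > 0" and u: "u \<in> model_plane \<kappa>" and v: "v \<in> model_plane \<kappa>"
    and less: "model_dist \<kappa> u v < pi / sqrt \<kappa>"
  shows "\<exists>S. geodesic_segment (model_plane \<kappa>) (model_dist \<kappa>) u v S"
proof -
  define k where "k = sqrt \<kappa>"
  have k: "0 < k" using \<kappa> by (simp add: k_def)
  have uu: "u \<bullet> u = 1" and vv: "v \<bullet> v = 1"
    using u v \<kappa> by (auto simp: model_plane_def norm_eq_1)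
  have "norm u = 1" "norm v = 1" using uu vv by (simp_all add: norm_eq_1)
  then have uv: "-1 \<le> u \<bullet> v" "u \<bullet> v \<le> 1"
    using Cauchy_Schwarz_ineq2[of u v] by (simp_all add: abs_le_iff)
  define \<delta> where "\<delta> = arccos (u \<bullet> v)"
  have md: "model_dist \<kappa> p q = arccos (p \<bullet> q) / k" for p q
    using \<kappa> by (simp add: model_dist_def k_def)
  have D: "model_dist \<kappa> u v = \<delta> / k" by (simp add: md \<delta>_def)
  have \<delta>: "0 \<le> \<delta>" "\<delta> < pi" "cos \<delta> = u \<bullet> v"
    using arccos_lbound[OF uv] cos_arccos[OF uv] less k
    by (auto simp: \<delta>_def md k_def[symmetric] divide_less_cancel)
  show ?thesis
  proof (cases "\<delta> = 0")
    case True
    then have "u \<bullet> v = 1" using \<delta> by simp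
    then have "(u - v) \<bullet> (u - v) = 0" by (simp add: inner_diff_left inner_diff_right uu vv inner_commute)
    then have "u = v" by simp
    have "geodesic_segment (model_plane \<kappa>) (model_dist \<kappa>) u v ((\<lambda>t. u) ` {0..model_dist \<kappa> u v})"
      using u \<open>u = v\<close> uu by (intro geodesic_segmentI) (auto simp: md)
    then show ?thesis by blast
  next
    case False
    then have s: "0 < sin \<delta>" using \<delta> by (simp add: sin_gt_zero)
    define w where "w = (1 / sin \<delta>) *\<^sub>R (v - cos \<delta> *\<^sub>R u)"
    have uw: "u \<bullet> w = 0" using \<delta> uu by (simp add: w_def inner_diff_right)
    have "(v - cos \<delta> *\<^sub>R u) \<bullet> (v - cos \<delta> *\<^sub>R u) = 1 - (cos \<delta>)\<^sup>2"
      using \<delta> uu vv by (simp add: inner_diff_left inner_diff_right inner_commute power2_eq_square)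
    also have "\<dots> = (sin \<delta>)\<^sup>2" by (simp add: sin_squared_eq)
    finally have ww: "w \<bullet> w = 1" using s by (simp add: w_def power2_eq_square)
    define c where "c t = cos (k * t) *\<^sub>R u + sin (k * t) *\<^sub>R w" for t
    have cc: "c s \<bullet> c t = cos (k * s - k * t)" for s t
      using uu uw ww by (simp add: c_def inner_add_left inner_add_right inner_commute cos_diff)
    have "geodesic_segment (model_plane \<kappa>) (model_dist \<kappa>) u v (c ` {0..model_dist \<kappa> u v})"
    proof (rule geodesic_segmentI)
      show "c t \<in> model_plane \<kappa>" for t
        using cc[of t t] \<kappa> by (simp add: model_plane_def norm_eq_1)
      show "c 0 = u" by (simp add: c_def)
      show "c (model_dist \<kappa> u v) = v" using k s by (simp add: c_def D w_def)
      fix s t assume *: "0 \<le> s" "s \<le> model_dist \<kappa> u v" "0 \<le> t" "t \<le> model_dist \<kappa> u v"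
      then have "0 \<le> k * s" "k * s \<le> \<delta>" "0 \<le> k * t" "k * t \<le> \<delta>"
        using k by (auto simp: D field_simps)
      then have "\<bar>k * s - k * t\<bar> \<le> pi" using \<delta> by linarith
      then have "model_dist \<kappa> (c s) (c t) = \<bar>k * s - k * t\<bar> / k"
        by (simp add: md cc arccos_cos_eq_abs)
      also have "\<dots> = \<bar>s - t\<bar>" using k by (simp add: abs_mult flip: right_diff_distrib)
      finally show "model_dist \<kappa> (c s) (c t) = \<bar>s - t\<bar>" .
    qed
    then show ?thesis by blast
  qed
qed

lemma CAT_midpoint_pos:
  assumes \<kappa>: "\<kappa> > 0" and CAT: "CAT_space \<kappa> X d"
    and C: "z \<in> X" "m \<in> X" "x \<in> X" and S: "geodesic_segment X d z m S" "u \<in> S" "d z u = d z m / 2"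
    and zm: "0 < d z m"
    and small: "sqrt \<kappa> * d z m < pi / 2" "sqrt \<kappa> * d x z < pi / 2" "sqrt \<kappa> * d x m < pi / 2"
  shows "cos (sqrt \<kappa> * ((d x z + d x m) / 2)) * cos (sqrt \<kappa> * ((d x z - d x m) / 2))
       \<le> cos (sqrt \<kappa> * (d z m / 2)) * cos (sqrt \<kappa> * d x u)"
proof -
  interpret Metric_space X d using CAT by (simp add: CAT_space_def)
  define k where "k = sqrt \<kappa>"
  have k: "0 < k" using \<kappa> by (simp add: k_def)
  define p q r where "p = k * ((d x z + d x m) / 2)" and "q = k * ((d x z - d x m) / 2)"
    and "r = k * (d z m / 2)"
  have tri: "d z m \<le> d x z + d x m" "\<bar>d x z - d x m\<bar> \<le> d z m"
    using triangle[of z x m] triangle[of x z m] triangle[of x m z] C commute by (auto simp: abs_le_iff)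
  have r: "0 < r" using k zm by (simp add: r_def)
  have rp: "r \<le> p" using tri k by (simp add: r_def p_def)
  have "\<bar>q\<bar> = k * \<bar>d x z - d x m\<bar> / 2" using k by (simp add: q_def abs_mult)
  then have qr: "\<bar>q\<bar> \<le> r" using tri(2) k by (simp add: r_def)
  have p: "p < pi / 2" using small by (simp add: p_def k_def[symmetric] algebra_simps)
  have pq: "p + q = k * d x z" "p - q = k * d x m" "2 * r = k * d z m"
    by (simp_all add: p_def q_def r_def algebra_simps add_divide_distrib diff_divide_distrib)
  have cos: "0 < cos p" "cos p \<le> cos r" "cos r \<le> cos q" "0 < cos r" "cos r < 1"
  proof -
    show "0 < cos p" "0 < cos r" using r rp p by (simp_all add: cos_gt_zero_pi)
    show "cos p \<le> cos r" using r rp p by (intro cos_monotone_0_pi_le) auto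
    have "cos r \<le> cos \<bar>q\<bar>" using r qr rp p by (intro cos_monotone_0_pi_le) auto
    then show "cos r \<le> cos q" by simp
    show "cos r < 1" using cos_monotone_0_pi[of 0 r] r rp p by auto
  qed
  have sr: "0 < sin r" using r rp p by (intro sin_gt_zero) auto
  \<comment> \<open>With the base ends at (-sin r, 0, cos r) and (sin r, 0, cos r), the law of
    cosines reads Z cos r - A sin r = cos (p + q) and Z cos r + A sin r = cos (p - q). Solving gives
    \<open>Z\<close>, the cosine of the model median, and \<open>A\<close>.\<close>
  define Z where "Z = cos p * cos q / cos r"
  define A where "A = sin p * sin q / sin r"
  have "(cos p)\<^sup>2 * (cos q)\<^sup>2 / (cos r)\<^sup>2 + (1 - (cos p)\<^sup>2) * (1 - (cos q)\<^sup>2) / (1 - (cos r)\<^sup>2) \<le> 1"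
    using cos by (intro vertex_coordinate_bound) (auto simp: power_less_one_iff abs_square_less_1 intro: power_mono)
  then have ZA: "Z\<^sup>2 + A\<^sup>2 \<le> 1"
    by (simp add: Z_def A_def power_mult_distrib power_divide flip: sin_squared_eq)
  define B where "B = sqrt (1 - Z\<^sup>2 - A\<^sup>2)"
  have B: "B\<^sup>2 = 1 - Z\<^sup>2 - A\<^sup>2" using ZA by (simp add: B_def)
  define x' z' m' where "x' = (A, B, Z)" and "z' = (- sin r, 0 :: real, cos r)"
    and "m' = (sin r, 0 :: real, cos r)"
  define u' where "u' = (0 :: real, 0 :: real, 1 :: real)"
  have Zr: "Z * cos r = cos p * cos q" and Ar: "A * sin r = sin p * sin q"
    using cos sr by (simp_all add: Z_def A_def)
  have inner: "x' \<bullet> x' = 1" "z' \<bullet> m' = cos (k * d z m)" "m' \<bullet> x' = cos (k * d m x)"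
    "x' \<bullet> z' = cos (k * d x z)" "z' \<bullet> u' = cos (k * d z u)" "u' \<bullet> x' = Z"
  proof -
    show "x' \<bullet> x' = 1" using B by (simp add: x'_def inner_prod_def flip: power2_eq_square)
    have "z' \<bullet> m' = cos (r + r)"
      unfolding cos_add by (simp add: z'_def m'_def inner_prod_def)
    then show "z' \<bullet> m' = cos (k * d z m)" using pq(3) by simp
    have "m' \<bullet> x' = A * sin r + Z * cos r" by (simp add: m'_def x'_def inner_prod_def mult.commute)
    also have "\<dots> = cos (p - q)" by (simp add: Zr Ar cos_diff)
    finally show "m' \<bullet> x' = cos (k * d m x)" using pq(2) commute by simp
    have "x' \<bullet> z' = Z * cos r - A * sin r" by (simp add: z'_def x'_def inner_prod_def)
    also have "\<dots> = cos (p + q)" by (simp add: Zr Ar cos_add)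
    finally show "x' \<bullet> z' = cos (k * d x z)" using pq(1) by simp
    have "k * d z u = r" using S(3) by (simp add: r_def)
    then show "z' \<bullet> u' = cos (k * d z u)" by (simp add: z'_def u'_def inner_prod_def)
    show "u' \<bullet> x' = Z" by (simp add: x'_def u'_def inner_prod_def)
  qed
  have md: "model_dist \<kappa> a b = arccos (a \<bullet> b) / k" for a b
    using \<kappa> by (simp add: model_dist_def k_def)
  have arc: "arccos (cos (k * e)) / k = e" if "0 \<le> e" "k * e < pi / 2" for e
  proof -
    have "0 \<le> k * e" "k * e \<le> pi" using that k pi_gt_zero by (simp, linarith)
    then show ?thesis using k by (simp add: arccos_cos)
  qed
  have "k * d z u = r" using S(3) by (simp add: r_def)
  then have "k * d z u < pi / 2" using rp p by simp
  then have dist: "model_dist \<kappa> z' m' = d z m" "model_dist \<kappa> m' x' = d m x" "model_dist \<kappa> x' z' = d x z"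
      "model_dist \<kappa> z' u' = d z u" "model_dist \<kappa> x' x' = 0"
    unfolding md inner using small by (simp_all add: arc k_def[symmetric] commute[of m x])
  have plane: "z' \<in> model_plane \<kappa>" "m' \<in> model_plane \<kappa>" "x' \<in> model_plane \<kappa>"
    using \<kappa> inner(1) by (simp_all add: model_plane_def norm_eq_1 z'_def m'_def inner_prod_def flip: power2_eq_square)
  \<comment> \<open>The shift by \<open>r\<close> centres the base, so that the parameter of the
    midpoint gives \<open>u'\<close>.\<close>
  define c where "c t = (sin (k * t - r), 0 :: real, cos (k * t - r))" for t
  have cc: "c s \<bullet> c t = cos (k * s - k * t)" for s t
    using cos_diff[of "k * s - r" "k * t - r"] by (simp add: c_def inner_prod_def)
  have seg0: "geodesic_segment (model_plane \<kappa>) (model_dist \<kappa>) z' m' (c ` {0..model_dist \<kappa> z' m'})"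
  proof (rule geodesic_segmentI)
    show "c t \<in> model_plane \<kappa>" for t
      using cc[of t t] \<kappa> by (simp add: model_plane_def norm_eq_1)
    show "c 0 = z'" by (simp add: c_def z'_def)
    show "c (model_dist \<kappa> z' m') = m'" unfolding dist(1) by (simp add: c_def m'_def flip: pq(3))
    fix s t assume "0 \<le> s" "s \<le> model_dist \<kappa> z' m'" "0 \<le> t" "t \<le> model_dist \<kappa> z' m'"
    then have "0 \<le> k * s" "k * s \<le> k * d z m" "0 \<le> k * t" "k * t \<le> k * d z m"
      using k dist(1) by auto
    then have "\<bar>k * s - k * t\<bar> \<le> pi" using small(1) by (simp add: k_def[symmetric])
    then have "model_dist \<kappa> (c s) (c t) = \<bar>k * s - k * t\<bar> / k"
      by (simp add: md cc arccos_cos_eq_abs)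
    also have "\<dots> = \<bar>s - t\<bar>" using k by (simp add: abs_mult flip: right_diff_distrib)
    finally show "model_dist \<kappa> (c s) (c t) = \<bar>s - t\<bar>" .
  qed
  have "c (d z m / 2) = u'" by (simp add: c_def u'_def r_def)
  then have mem: "u' \<in> c ` {0..model_dist \<kappa> z' m'}"
    using zm dist(1) by (intro image_eqI[of _ _ "d z m / 2"]) auto
  have lt: "e < pi / sqrt \<kappa>" if "sqrt \<kappa> * e < pi / 2" for e
  proof -
    have "sqrt \<kappa> * e < pi" using that pi_gt_zero by linarith
    then show ?thesis using \<kappa> by (simp add: pos_less_divide_eq mult.commute)
  qed
  have less: "d m x < pi / sqrt \<kappa>" "d x z < pi / sqrt \<kappa>"
    using lt small(2,3) commute[of m x] by simp_all
  obtain S1 S2 where seg: "geodesic_segment (model_plane \<kappa>) (model_dist \<kappa>) m' x' S1"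
      "geodesic_segment (model_plane \<kappa>) (model_dist \<kappa>) x' z' S2"
    using model_segment_pos[OF \<kappa> plane(2,3), unfolded dist, OF less(1)]
      model_segment_pos[OF \<kappa> plane(3,1), unfolded dist, OF less(2)] by blast
  have "sqrt \<kappa> * (d z m + d m x + d x z) < 2 * pi"
    using small pi_gt_zero unfolding distrib_left commute[of m x] by linarith
  then have per: "d z m + d m x + d x z < 2 * (pi / sqrt \<kappa>)"
    using \<kappa> by (simp add: pos_less_divide_eq mult.commute)
  have "d u x \<le> model_dist \<kappa> u' x'"
    by (rule CAT_vertex_comparison[OF CAT C S(1,2) per less plane seg0 mem seg dist])
  then have le: "k * d x u \<le> arccos Z" using k by (simp add: md inner commute[of x u] field_simps)
  have "Z\<^sup>2 \<le> 1" using ZA zero_le_power2[of A] by linarith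
  then have Z: "-1 \<le> Z" "Z \<le> 1" by (auto simp: abs_square_le_1 abs_le_iff)
  have "cos (arccos Z) \<le> cos (k * d x u)"
    using le k Z by (intro cos_monotone_0_pi_le) (auto simp: arccos_ubound)
  then have "cos r * Z \<le> cos r * cos (k * d x u)" using Z cos by (intro mult_left_mono) auto
  moreover have "cos r * Z = cos p * cos q" using Zr by (simp only: mult.commute)
  ultimately show ?thesis by (simp only: p_def q_def r_def k_def)
qed

subsection \<open>Zero curvature\<close>

lemma model_segment_zero:
  assumes u: "u \<in> model_plane 0" and v: "v \<in> model_plane 0"
  shows "geodesic_segment (model_plane 0) (model_dist 0) u v
           ((\<lambda>t. u + (t / dist u v) *\<^sub>R (v - u)) ` {0..model_dist 0 u v})"
proof (rule geodesic_segmentI)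
  let ?c = "\<lambda>t. u + (t / dist u v) *\<^sub>R (v - u)"
  show "?c t \<in> model_plane 0" for t
    using u v by (auto simp: model_plane_def split: prod.splits)
  show "?c 0 = u" by simp
  show "?c (model_dist 0 u v) = v" by (cases "u = v") (auto simp: model_dist_def)
  fix s t assume "0 \<le> s" "s \<le> model_dist 0 u v" "0 \<le> t" "t \<le> model_dist 0 u v"
  \<comment> \<open>For \<open>u = v\<close> the quotient \<open>t / dist u v\<close> is 0 by
    convention and the parameter interval is a single point.\<close>
  then have *: "u = v \<Longrightarrow> s = t" by (simp add: model_dist_def)
  have "?c s - ?c t = ((s - t) / dist u v) *\<^sub>R (v - u)"
    by (simp add: diff_divide_distrib scaleR_diff_left)
  then have "model_dist 0 (?c s) (?c t) = \<bar>s - t\<bar> / dist u v * norm (v - u)"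
    by (simp add: model_dist_def dist_norm)
  then show "model_dist 0 (?c s) (?c t) = \<bar>s - t\<bar>"
    using * by (cases "u = v") (auto simp: dist_norm norm_minus_commute)
qed

lemma CAT_midpoint_zero:
  assumes CAT: "CAT_space 0 X d"
    and C: "z \<in> X" "m \<in> X" "x \<in> X" and S: "geodesic_segment X d z m S" "u \<in> S" "d z u = d z m / 2"
    and zm: "0 < d z m"
  shows "(d x u)\<^sup>2 \<le> ((d x z)\<^sup>2 + (d x m)\<^sup>2) / 2 - (d z m)\<^sup>2 / 4"
proof -
  interpret Metric_space X d using CAT by (simp add: CAT_space_def)
  define a b r where "a = d x z" and "b = d x m" and "r = d z m / 2"
  have r: "0 < r" using zm by (simp add: r_def)
  have tri: "2 * r \<le> a + b" "\<bar>a - b\<bar> \<le> 2 * r"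
    using triangle[of z x m] triangle[of x z m] triangle[of x m z] C commute
    by (auto simp: abs_le_iff a_def b_def r_def)
  \<comment> \<open>\<open>q\<close> is the squared median by Apollonius and \<open>A\<close> the
    component of the median along the base. That \<open>A\<^sup>2 \<le> q\<close> is Heron's
    formula: 16 r^2 q - (a^2 - b^2)^2 is minus the product in the inequality proved next, whose sign
    comes from the triangle inequalities.\<close>
  define q where "q = (a\<^sup>2 + b\<^sup>2) / 2 - r\<^sup>2"
  define A where "A = (a\<^sup>2 - b\<^sup>2) / (4 * r)"
  have "(2 * r)\<^sup>2 \<le> (a + b)\<^sup>2" using tri r by (intro power_mono) auto
  moreover have "(a - b)\<^sup>2 \<le> (2 * r)\<^sup>2"
    using tri r abs_le_square_iff[of "a - b" "2 * r"] by simp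
  ultimately have "((a + b)\<^sup>2 - (2 * r)\<^sup>2) * ((a - b)\<^sup>2 - (2 * r)\<^sup>2) \<le> 0"
    by (intro mult_nonneg_nonpos) auto
  then have "(a\<^sup>2 - b\<^sup>2)\<^sup>2 \<le> 16 * r\<^sup>2 * q"
    by (simp add: q_def power2_eq_square algebra_simps)
  then have Aq: "A\<^sup>2 \<le> q"
    using r by (simp add: A_def power_divide power_mult_distrib divide_le_eq mult.commute)
  define B where "B = sqrt (q - A\<^sup>2)"
  have B: "B\<^sup>2 = q - A\<^sup>2" using Aq by (simp add: B_def)
  define x' z' m' where "x' = (A, B, 0 :: real)" and "z' = (- r, 0 :: real, 0 :: real)"
    and "m' = (r, 0 :: real, 0 :: real)"
  have Ar: "2 * (A * r) = (a\<^sup>2 - b\<^sup>2) / 2" using r by (simp add: A_def)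
  have nn: "0 \<le> a" "0 \<le> b" by (simp_all add: a_def b_def)
  have dist: "model_dist 0 z' m' = d z m" "model_dist 0 m' x' = d m x" "model_dist 0 x' z' = d x z"
      "model_dist 0 z' 0 = d z u" "model_dist 0 x' x' = 0"
  proof -
    show "model_dist 0 z' m' = d z m"
      using r by (simp add: model_dist_def z'_def m'_def dist_prod_def dist_real_def r_def)
    have "(r - A)\<^sup>2 + B\<^sup>2 = b\<^sup>2" using Ar by (simp add: power2_diff B q_def field_simps)
    then show "model_dist 0 m' x' = d m x"
      using nn by (simp add: model_dist_def m'_def x'_def dist_prod_def dist_real_def commute b_def)
    have "(A + r)\<^sup>2 + B\<^sup>2 = a\<^sup>2" using Ar by (simp add: power2_sum B q_def field_simps)
    then show "model_dist 0 x' z' = d x z"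
      using nn by (simp add: model_dist_def z'_def x'_def dist_prod_def dist_real_def a_def)
    show "model_dist 0 z' 0 = d z u"
      using r S(3) by (simp add: model_dist_def z'_def zero_prod_def dist_prod_def dist_real_def r_def)
  qed (simp add: model_dist_def)
  have plane: "z' \<in> model_plane 0" "m' \<in> model_plane 0" "x' \<in> model_plane 0"
    by (simp_all add: model_plane_def z'_def m'_def x'_def)
  have "dist z' m' = d z m" using dist(1) by (simp add: model_dist_def)
  then have "(0 :: real \<times> real \<times> real) = z' + ((d z m / 2) / dist z' m') *\<^sub>R (m' - z')"
    using zm by (simp add: z'_def m'_def zero_prod_def)
  then have mem: "0 \<in> (\<lambda>t. z' + (t / dist z' m') *\<^sub>R (m' - z')) ` {0..model_dist 0 z' m'}"
    using r dist(1) by (intro image_eqI[of _ _ "d z m / 2"]) auto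
  have "d u x \<le> model_dist 0 0 x'"
    by (rule CAT_vertex_comparison[OF CAT C S(1,2) _ _ _ plane model_segment_zero[OF plane(1,2)] mem
          model_segment_zero[OF plane(2,3)] model_segment_zero[OF plane(3,1)] dist]) simp_all
  also have "model_dist 0 0 x' = sqrt q"
    using Aq by (simp add: model_dist_def x'_def zero_prod_def dist_prod_def dist_real_def B_def)
  finally have "(d x u)\<^sup>2 \<le> (sqrt q)\<^sup>2" by (intro power_mono) (auto simp: commute)
  also have "\<dots> = q" using order_trans[OF zero_le_power2 Aq] by simp
  finally show ?thesis by (simp add: q_def a_def b_def r_def power_divide)
qed

subsection \<open>Negative curvature\<close>

text \<open>The Minkowski form, signed so that the hyperboloid is \<open>lorentz u u = 1\<close> and
  the form is the hyperbolic cosine of the unscaled distance.\<close>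

fun lorentz :: "real \<times> real \<times> real \<Rightarrow> real \<times> real \<times> real \<Rightarrow> real" where
  "lorentz (x, y, z) (x', y', z') = z * z' - x * x' - y * y'"

lemma lorentz_linear:
  "lorentz (s *\<^sub>R u + t *\<^sub>R v) w = s * lorentz u w + t * lorentz v w"
  "lorentz w (s *\<^sub>R u + t *\<^sub>R v) = s * lorentz w u + t * lorentz w v"
  by (cases u; cases v; cases w; simp add: algebra_simps)+

lemma lorentz_commute: "lorentz u v = lorentz v u"
  by (cases u; cases v) (simp add: mult.commute)

lemma model_plane_neg:
  assumes "\<kappa> < 0"
  shows "u \<in> model_plane \<kappa> \<longleftrightarrow> 0 < snd (snd u) \<and> lorentz u u = 1"
  using assms by (cases u) (auto simp: model_plane_def power2_eq_square)

lemma model_dist_neg: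
  assumes "\<kappa> < 0"
  shows "model_dist \<kappa> u v = arcosh (lorentz u v) / sqrt (- \<kappa>)"
  using assms by (cases u; cases v) (simp add: model_dist_def)

text \<open>The difference of (z z')^2 and (1 + x x' + y y')^2 is a sum of squares by Lagrange's
  identity; equality kills every square. The bound makes \<open>arcosh\<close> meaningful on the
  hyperboloid.\<close>

lemma reverse_Cauchy_Schwarz:
  assumes "0 < snd (snd u)" "lorentz u u = 1" "0 < snd (snd v)" "lorentz v v = 1"
  shows "1 \<le> lorentz u v" and "lorentz u v = 1 \<Longrightarrow> u = v"
proof -
  obtain x y z x' y' z' where uv: "u = (x, y, z)" "v = (x', y', z')" by (metis prod_cases3)
  have z: "0 < z" "z\<^sup>2 = 1 + x\<^sup>2 + y\<^sup>2" "0 < z'" "z'\<^sup>2 = 1 + x'\<^sup>2 + y'\<^sup>2"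
    using assms by (auto simp: uv power2_eq_square)
  let ?w = "1 + x * x' + y * y'"
  have "(z * z')\<^sup>2 - ?w\<^sup>2 = (1 + x\<^sup>2 + y\<^sup>2) * (1 + x'\<^sup>2 + y'\<^sup>2) - ?w\<^sup>2"
    by (simp add: power_mult_distrib z)
  also have "\<dots> = (x - x')\<^sup>2 + (y - y')\<^sup>2 + (x * y' - y * x')\<^sup>2"
    by algebra
  finally have eq: "(z * z')\<^sup>2 - ?w\<^sup>2 = (x - x')\<^sup>2 + (y - y')\<^sup>2 + (x * y' - y * x')\<^sup>2" .
  have "0 \<le> (z * z')\<^sup>2 - ?w\<^sup>2" unfolding eq by simp
  then have "?w\<^sup>2 \<le> (z * z')\<^sup>2" by (simp only: diff_ge_0_iff_ge)
  then have "?w \<le> z * z'" using z(1,3) by (auto intro: power2_le_imp_le)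
  then show "1 \<le> lorentz u v" by (simp add: uv)
  assume "lorentz u v = 1"
  then have "z * z' = ?w" by (simp add: uv)
  then have "(x - x')\<^sup>2 + (y - y')\<^sup>2 + (x * y' - y * x')\<^sup>2 = 0"
    unfolding eq[symmetric] by simp
  then have "(x - x')\<^sup>2 + (y - y')\<^sup>2 = 0"
    by (subst (asm) add_nonneg_eq_0_iff) auto
  then have "x = x'" "y = y'" by (simp_all add: sum_power2_eq_zero_iff)
  moreover from this have "z\<^sup>2 = z'\<^sup>2" using z by simp
  then have "z = z'" by (rule power2_eq_imp_eq) (use z(1,3) in auto)
  ultimately show "u = v" by (simp add: uv)
qed

lemma arcosh_cosh_abs: "arcosh (cosh x) = \<bar>x\<bar>" for x :: real
  using arcosh_cosh_real[of x] arcosh_cosh_real[of "- x"] by (cases "0 \<le> x") auto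

lemma model_segment_neg:
  assumes \<kappa>: "\<kappa> < 0" and u: "u \<in> model_plane \<kappa>" and v: "v \<in> model_plane \<kappa>"
  shows "\<exists>S. geodesic_segment (model_plane \<kappa>) (model_dist \<kappa>) u v S"
proof -
  define k where "k = sqrt (- \<kappa>)"
  have k: "0 < k" using \<kappa> by (simp add: k_def)
  note plane = model_plane_neg[OF \<kappa>]
  have md: "model_dist \<kappa> a b = arcosh (lorentz a b) / k" for a b
    using model_dist_neg[OF \<kappa>] by (simp add: k_def)
  have uu: "lorentz u u = 1" and vv: "lorentz v v = 1" and upos: "0 < snd (snd u)" and vpos: "0 < snd (snd v)"
    using u v by (simp_all add: plane)
  define \<delta> where "\<delta> = arcosh (lorentz u v)"
  have D: "model_dist \<kappa> u v = \<delta> / k" by (simp add: md \<delta>_def)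
  have ge1: "1 \<le> lorentz u v" using reverse_Cauchy_Schwarz(1) uu vv upos vpos by blast
  then have \<delta>: "0 \<le> \<delta>" "cosh \<delta> = lorentz u v" by (simp_all add: \<delta>_def)
  show ?thesis
  proof (cases "\<delta> = 0")
    case True
    then have "u = v" using \<delta> reverse_Cauchy_Schwarz(2) uu vv upos vpos by simp
    have "geodesic_segment (model_plane \<kappa>) (model_dist \<kappa>) u v ((\<lambda>t. u) ` {0..model_dist \<kappa> u v})"
      using u \<open>u = v\<close> uu by (intro geodesic_segmentI) (auto simp: md)
    then show ?thesis by blast
  next
    case False
    then have s: "0 < sinh \<delta>" using \<delta> by simp
    define w where "w = (1 / sinh \<delta>) *\<^sub>R v + (- cosh \<delta> / sinh \<delta>) *\<^sub>R u"
    have w: "lorentz y w = (1 / sinh \<delta>) * lorentz y v + (- cosh \<delta> / sinh \<delta>) * lorentz y u" for y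
      unfolding w_def by (rule lorentz_linear)
    have uw: "lorentz u w = 0" unfolding w using \<delta> uu by simp
    have "lorentz v w = (1 - (cosh \<delta>)\<^sup>2) / sinh \<delta>"
      unfolding w using \<delta> vv by (simp add: lorentz_commute[of v u] power2_eq_square diff_divide_distrib)
    also have "\<dots> = - sinh \<delta>"
      using s by (simp add: cosh_square_eq divide_eq_eq) (simp add: power2_eq_square)
    finally have "lorentz w v = - sinh \<delta>" by (simp add: lorentz_commute[of w v])
    then have ww: "lorentz w w = -1"
      using uw s unfolding w[of w] by (simp add: lorentz_commute[of w u])
    define c where "c t = cosh (k * t) *\<^sub>R u + sinh (k * t) *\<^sub>R w" for t
    have cc: "lorentz (c s) (c t) = cosh (k * s - k * t)" for s t
      using uu uw ww by (simp add: c_def lorentz_linear lorentz_commute[of w u] cosh_diff)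
    \<comment> \<open>As a combination of \<open>u\<close> and \<open>v\<close> with nonnegative
      coefficients, the curve visibly stays on the upper sheet, which the form with \<open>w\<close>
      does not show.\<close>
    have c_eq: "c t = (sinh (\<delta> - k * t) / sinh \<delta>) *\<^sub>R u + (sinh (k * t) / sinh \<delta>) *\<^sub>R v" for t
    proof -
      have "c t = (cosh (k * t) - sinh (k * t) * cosh \<delta> / sinh \<delta>) *\<^sub>R u + (sinh (k * t) / sinh \<delta>) *\<^sub>R v"
        by (simp add: c_def w_def algebra_simps)
      also have "cosh (k * t) - sinh (k * t) * cosh \<delta> / sinh \<delta> = sinh (\<delta> - k * t) / sinh \<delta>"
        using s by (simp add: sinh_diff field_simps)
      finally show ?thesis .
    qed
    have bounds: "0 \<le> k * t" "k * t \<le> \<delta>" if "0 \<le> t" "t \<le> model_dist \<kappa> u v" for t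
      using that k by (auto simp: D field_simps)
    have "geodesic_segment (model_plane \<kappa>) (model_dist \<kappa>) u v (c ` {0..model_dist \<kappa> u v})"
    proof (rule geodesic_segmentI)
      fix t assume t: "0 \<le> t" "t \<le> model_dist \<kappa> u v"
      have "0 < sinh (\<delta> - k * t) * snd (snd u) + sinh (k * t) * snd (snd v)"
      proof (cases "k * t = \<delta>")
        case True
        then show ?thesis using s vpos by simp
      next
        case False
        then show ?thesis using bounds[OF t] upos vpos by (intro add_pos_nonneg) auto
      qed
      then have "0 < snd (snd (c t))"
        using s by (simp add: c_eq add_divide_distrib[symmetric])
      then show "c t \<in> model_plane \<kappa>" using cc[of t t] by (simp add: plane)
    next
      show "c 0 = u" by (simp add: c_def)
      show "c (model_dist \<kappa> u v) = v" using k s by (simp add: c_eq D)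
    next
      fix s t
      have "model_dist \<kappa> (c s) (c t) = \<bar>k * s - k * t\<bar> / k"
        by (simp add: md cc arcosh_cosh_abs)
      also have "\<dots> = \<bar>s - t\<bar>" using k by (simp add: abs_mult flip: right_diff_distrib)
      finally show "model_dist \<kappa> (c s) (c t) = \<bar>s - t\<bar>" .
    qed
    then show ?thesis by blast
  qed
qed

text \<open>Counterpart of \<open>vertex_coordinate_bound\<close> for squared hyperbolic cosines; it
  again provides the third coordinate of the apex.\<close>

lemma vertex_coordinate_bound_neg:
  fixes A B w :: real
  assumes "1 < w" "w \<le> A" "B \<le> w"
  shows "1 \<le> A * B / w - (A - 1) * (B - 1) / (w - 1)"
proof -
  have "0 \<le> (A - w) * (w - B)" using assms by simp
  then have "w * (w - 1) \<le> A * B * (w - 1) - (A - 1) * (B - 1) * w" by (simp add: algebra_simps)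
  then have "1 \<le> (A * B * (w - 1) - (A - 1) * (B - 1) * w) / (w * (w - 1))"
    using assms by (simp add: le_divide_eq)
  also have "\<dots> = A * B / w - (A - 1) * (B - 1) / (w - 1)"
    using assms by (simp add: diff_divide_distrib)
  finally show ?thesis .
qed

lemma CAT_midpoint_neg:
  assumes \<kappa>: "\<kappa> < 0" and CAT: "CAT_space \<kappa> X d"
    and C: "z \<in> X" "m \<in> X" "x \<in> X" and S: "geodesic_segment X d z m S" "u \<in> S" "d z u = d z m / 2"
    and zm: "0 < d z m"
  shows "cosh (sqrt (- \<kappa>) * (d z m / 2)) * cosh (sqrt (- \<kappa>) * d x u)
       \<le> cosh (sqrt (- \<kappa>) * ((d x z + d x m) / 2)) * cosh (sqrt (- \<kappa>) * ((d x z - d x m) / 2))"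
proof -
  interpret Metric_space X d using CAT by (simp add: CAT_space_def)
  define k where "k = sqrt (- \<kappa>)"
  have k: "0 < k" using \<kappa> by (simp add: k_def)
  note plane_iff = model_plane_neg[OF \<kappa>]
  have md: "model_dist \<kappa> a b = arcosh (lorentz a b) / k" for a b
    using model_dist_neg[OF \<kappa>] by (simp add: k_def)
  define p q r where "p = k * ((d x z + d x m) / 2)" and "q = k * ((d x z - d x m) / 2)"
    and "r = k * (d z m / 2)"
  have tri: "d z m \<le> d x z + d x m" "\<bar>d x z - d x m\<bar> \<le> d z m"
    using triangle[of z x m] triangle[of x z m] triangle[of x m z] C commute by (auto simp: abs_le_iff)
  have r: "0 < r" using k zm by (simp add: r_def)
  have rp: "r \<le> p" using tri k by (simp add: r_def p_def)
  have "\<bar>q\<bar> = k * \<bar>d x z - d x m\<bar> / 2" using k by (simp add: q_def abs_mult)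
  then have qr: "\<bar>q\<bar> \<le> r" using tri(2) k by (simp add: r_def)
  have pq: "p + q = k * d x z" "p - q = k * d x m" "2 * r = k * d z m"
    by (simp_all add: p_def q_def r_def algebra_simps add_divide_distrib diff_divide_distrib)
  have cosh: "cosh r \<le> cosh p" "cosh q \<le> cosh r" "1 < cosh r"
  proof -
    show "cosh r \<le> cosh p" using r rp by (simp add: cosh_real_nonneg_le_iff)
    have "cosh \<bar>q\<bar> \<le> cosh r" using qr r by (subst cosh_real_nonneg_le_iff) auto
    then show "cosh q \<le> cosh r" by (simp add: abs_if split: if_splits)
    show "1 < cosh r" using r cosh_real_strict_mono[of 0 r] by simp
  qed
  have cr: "0 < cosh r" and sr: "0 < sinh r" using r cosh by simp_all
  \<comment> \<open>Solves the hyperbolic law of cosines Z cosh r + A sinh r = cosh (p + q), Z cosh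
    r - A sinh r = cosh (p - q); \<open>Z\<close> is the hyperbolic cosine of the model
    median.\<close>
  define Z where "Z = cosh p * cosh q / cosh r"
  define A where "A = sinh p * sinh q / sinh r"
  have sq: "(sinh t)\<^sup>2 = (cosh t)\<^sup>2 - 1" for t :: real by (simp add: cosh_square_eq)
  have "1 \<le> (cosh p)\<^sup>2 * (cosh q)\<^sup>2 / (cosh r)\<^sup>2 - ((cosh p)\<^sup>2 - 1) * ((cosh q)\<^sup>2 - 1) / ((cosh r)\<^sup>2 - 1)"
    using cosh by (intro vertex_coordinate_bound_neg) (auto simp: one_less_power intro: power_mono)
  then have ZA: "1 + A\<^sup>2 \<le> Z\<^sup>2"
    by (simp add: Z_def A_def power_mult_distrib power_divide flip: sq)
  define B where "B = sqrt (Z\<^sup>2 - A\<^sup>2 - 1)"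
  have B: "B\<^sup>2 = Z\<^sup>2 - A\<^sup>2 - 1" using ZA by (simp add: B_def)
  have Z: "0 < Z" using cr by (simp add: Z_def)
  have "1 \<le> Z\<^sup>2" using ZA zero_le_power2[of A] by linarith
  then have Z1: "1 \<le> Z" using Z power2_le_imp_le[of 1 Z] by simp
  define x' z' m' where "x' = (A, B, Z)" and "z' = (- sinh r, 0 :: real, cosh r)"
    and "m' = (sinh r, 0 :: real, cosh r)"
  define u' where "u' = (0 :: real, 0 :: real, 1 :: real)"
  have Zr: "Z * cosh r = cosh p * cosh q" and Ar: "A * sinh r = sinh p * sinh q"
    using cr sr by (simp_all add: Z_def A_def)
  have lor: "lorentz x' x' = 1" "lorentz z' m' = cosh (k * d z m)" "lorentz m' x' = cosh (k * d m x)"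
    "lorentz x' z' = cosh (k * d x z)" "lorentz z' u' = cosh (k * d z u)" "lorentz u' x' = Z"
  proof -
    show "lorentz x' x' = 1" using B by (simp add: x'_def flip: power2_eq_square)
    have "lorentz z' m' = cosh (r + r)" unfolding cosh_add by (simp add: z'_def m'_def)
    then show "lorentz z' m' = cosh (k * d z m)" using pq(3) by simp
    have "lorentz m' x' = Z * cosh r - A * sinh r" by (simp add: m'_def x'_def mult.commute)
    also have "\<dots> = cosh (p - q)" by (simp add: Zr Ar cosh_diff)
    finally show "lorentz m' x' = cosh (k * d m x)" using pq(2) commute by simp
    have "lorentz x' z' = Z * cosh r + A * sinh r" by (simp add: z'_def x'_def)
    also have "\<dots> = cosh (p + q)" by (simp add: Zr Ar cosh_add)
    finally show "lorentz x' z' = cosh (k * d x z)" using pq(1) by simp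
    have "k * d z u = r" using S(3) by (simp add: r_def)
    then show "lorentz z' u' = cosh (k * d z u)" by (simp add: z'_def u'_def)
    show "lorentz u' x' = Z" by (simp add: x'_def u'_def)
  qed
  have arc: "arcosh (cosh (k * e)) / k = e" if "0 \<le> e" for e
    using that k by (simp add: arcosh_cosh_real)
  have dist: "model_dist \<kappa> z' m' = d z m" "model_dist \<kappa> m' x' = d m x" "model_dist \<kappa> x' z' = d x z"
      "model_dist \<kappa> z' u' = d z u" "model_dist \<kappa> x' x' = 0"
    unfolding md lor by (simp_all add: arc)
  have plane: "z' \<in> model_plane \<kappa>" "m' \<in> model_plane \<kappa>" "x' \<in> model_plane \<kappa>"
    using lor(1) Z cr by (simp_all add: plane_iff z'_def m'_def x'_def hyperbolic_pythagoras flip: power2_eq_square)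
  define c where "c t = (sinh (k * t - r), 0 :: real, cosh (k * t - r))" for t
  have cc: "lorentz (c s) (c t) = cosh (k * s - k * t)" for s t
    using cosh_diff[of "k * s - r" "k * t - r"] by (simp add: c_def)
  have seg0: "geodesic_segment (model_plane \<kappa>) (model_dist \<kappa>) z' m' (c ` {0..model_dist \<kappa> z' m'})"
  proof (rule geodesic_segmentI)
    show "c t \<in> model_plane \<kappa>" for t
      using cc[of t t] by (simp add: plane_iff) (simp add: c_def)
    show "c 0 = z'" by (simp add: c_def z'_def)
    show "c (model_dist \<kappa> z' m') = m'" unfolding dist(1) by (simp add: c_def m'_def flip: pq(3))
    fix s t
    have "model_dist \<kappa> (c s) (c t) = \<bar>k * s - k * t\<bar> / k"
      by (simp add: md cc arcosh_cosh_abs)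
    also have "\<dots> = \<bar>s - t\<bar>" using k by (simp add: abs_mult flip: right_diff_distrib)
    finally show "model_dist \<kappa> (c s) (c t) = \<bar>s - t\<bar>" .
  qed
  have "c (d z m / 2) = u'" by (simp add: c_def u'_def r_def)
  then have mem: "u' \<in> c ` {0..model_dist \<kappa> z' m'}"
    using zm dist(1) by (intro image_eqI[of _ _ "d z m / 2"]) auto
  obtain S1 S2 where seg: "geodesic_segment (model_plane \<kappa>) (model_dist \<kappa>) m' x' S1"
      "geodesic_segment (model_plane \<kappa>) (model_dist \<kappa>) x' z' S2"
    using model_segment_neg[OF \<kappa> plane(2,3)] model_segment_neg[OF \<kappa> plane(3,1)] by blast
  have "d u x \<le> model_dist \<kappa> u' x'"
    by (rule CAT_vertex_comparison[OF CAT C S(1,2) _ _ _ plane seg0 mem seg dist]) (use \<kappa> in simp_all)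
  then have le: "k * d x u \<le> arcosh Z" using k by (simp add: md lor commute[of x u] field_simps)
  have "cosh (k * d x u) \<le> cosh (arcosh Z)"
    using le k Z1 by (subst cosh_real_nonneg_le_iff) auto
  then have "cosh r * cosh (k * d x u) \<le> cosh r * Z" using Z1 cr by (intro mult_left_mono) auto
  also have "\<dots> = cosh p * cosh q" using Zr by (simp add: mult.commute)
  finally show ?thesis by (simp add: k_def p_def q_def r_def)
qed

section \<open>Uniform convexity of CAT spaces\<close>

text \<open>The ratio is the slope of a chord from 0, and \<open>tanh\<close> is concave on the
  positive axis.\<close>

lemma tanh_ratio_antimono:
  fixes x y :: real
  assumes "0 < x" "x \<le> y"
  shows "tanh y / y \<le> tanh x / x"
proof (rule DERIV_nonpos_imp_nonincreasing[OF assms(2)])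
  fix t assume t: "x \<le> t" "t \<le> y"
  have "0 - 0 * (1 - (tanh 0)\<^sup>2) \<le> tanh t - t * (1 - (tanh t)\<^sup>2)"
  proof -
    have "tanh 0 - 0 * (1 - (tanh 0)\<^sup>2) \<le> tanh t - t * (1 - (tanh t)\<^sup>2)"
    proof (rule DERIV_nonneg_imp_nondecreasing[where f = "\<lambda>s. tanh s - s * (1 - (tanh s)\<^sup>2)"])
      fix s :: real assume s: "0 \<le> s" "s \<le> t"
      have "((\<lambda>s. tanh s - s * (1 - (tanh s)\<^sup>2)) has_real_derivative
              2 * s * tanh s * (1 - (tanh s)\<^sup>2)) (at s)"
        by (auto intro!: derivative_eq_intros simp: algebra_simps power2_eq_square)
      moreover have "\<bar>tanh s\<bar> < 1" using tanh_real_lt_1[of s] tanh_real_gt_neg1[of s] by (auto simp: abs_less_iff)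
      then have "0 \<le> 2 * s * tanh s * (1 - (tanh s)\<^sup>2)"
        using s abs_square_less_1[of "tanh s"] by (intro mult_nonneg_nonneg) auto
      ultimately show "\<exists>D. ((\<lambda>s. tanh s - s * (1 - (tanh s)\<^sup>2)) has_real_derivative D) (at s) \<and> 0 \<le> D"
        by blast
    qed (use t assms in simp)
    then show ?thesis by simp
  qed
  then have "(t * (1 - (tanh t)\<^sup>2) - tanh t) / t\<^sup>2 \<le> 0"
    by (intro divide_nonpos_nonneg) auto
  moreover have "((\<lambda>t. tanh t / t) has_real_derivative (t * (1 - (tanh t)\<^sup>2) - tanh t) / t\<^sup>2) (at t)"
    using t assms by (auto intro!: derivative_eq_intros simp: power2_eq_square mult.commute)
  ultimately show "\<exists>D. ((\<lambda>t. tanh t / t) has_real_derivative D) (at t) \<and> D \<le> 0"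
    by blast
qed

lemma inverse_cos_square: "cos x \<noteq> 0 \<Longrightarrow> inverse ((cos x)\<^sup>2) = 1 + (tan x)\<^sup>2" for x :: real
  by (simp add: tan_sec power_inverse)

text \<open>Again the slope of a chord from 0, now for the convex function
  \<open>tan\<close>.\<close>

lemma tan_ratio_mono:
  fixes x y :: real
  assumes "0 < x" "x \<le> y" "y < pi / 2"
  shows "tan x / x \<le> tan y / y"
proof (rule DERIV_nonneg_imp_nondecreasing[OF assms(2)])
  fix t assume t: "x \<le> t" "t \<le> y"
  have cos: "cos s \<noteq> 0" if "0 \<le> s" "s \<le> t" for s
    using cos_gt_zero_pi[of s] that t assms by auto
  have "0 * (1 + (tan 0)\<^sup>2) - tan 0 \<le> t * (1 + (tan t)\<^sup>2) - tan t"
  proof (rule DERIV_nonneg_imp_nondecreasing[where f = "\<lambda>s. s * (1 + (tan s)\<^sup>2) - tan s"])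
    fix s :: real assume s: "0 \<le> s" "s \<le> t"
    have "((\<lambda>s. s * (1 + (tan s)\<^sup>2) - tan s) has_real_derivative
            2 * s * tan s * (1 + (tan s)\<^sup>2)) (at s)"
      using cos[OF s]
      by (auto intro!: derivative_eq_intros simp: inverse_cos_square)
    moreover have "0 \<le> tan s"
      using s t assms tan_gt_zero[of s] by (cases "s = 0") auto
    then have "0 \<le> 2 * s * tan s * (1 + (tan s)\<^sup>2)"
      using s by (intro mult_nonneg_nonneg) auto
    ultimately show "\<exists>D. ((\<lambda>s. s * (1 + (tan s)\<^sup>2) - tan s) has_real_derivative D) (at s) \<and> 0 \<le> D"
      by blast
  qed (use t assms in simp)
  then have "0 \<le> ((1 + (tan t)\<^sup>2) * t - tan t) / t\<^sup>2"
    by (simp add: mult.commute)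
  moreover have "((\<lambda>t. tan t / t) has_real_derivative ((1 + (tan t)\<^sup>2) * t - tan t) / t\<^sup>2) (at t)"
    using t assms cos[of t]
    by (auto intro!: derivative_eq_intros simp: inverse_cos_square power2_eq_square[of t])
  ultimately show "\<exists>D. ((\<lambda>t. tan t / t) has_real_derivative D) (at t) \<and> 0 \<le> D"
    by blast
qed

lemma le_tan:
  fixes x :: real
  assumes "0 \<le> x" "x < pi / 2"
  shows "x \<le> tan x"
proof -
  have "tan 0 - 0 \<le> tan x - x"
  proof (rule DERIV_nonneg_imp_nondecreasing[OF assms(1), where f = "\<lambda>s. tan s - s"])
    fix s :: real assume s: "0 \<le> s" "s \<le> x"
    have "cos s \<noteq> 0" using cos_gt_zero_pi[of s] s assms by auto
    then have "((\<lambda>s. tan s - s) has_real_derivative (tan s)\<^sup>2) (at s)"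
      by (auto intro!: derivative_eq_intros simp: inverse_cos_square)
    then show "\<exists>D. ((\<lambda>s. tan s - s) has_real_derivative D) (at s) \<and> 0 \<le> D"
      by (meson zero_le_power2)
  qed
  then show ?thesis by simp
qed

text \<open>In the variables \<open>p\<^sup>2, q\<^sup>2, r\<^sup>2, s\<^sup>2\<close> this is the concavity of \<open>v \<mapsto> ln (cosh (sqrt v))\<close>.\<close>

lemma cosh_product_le:
  fixes p q r s :: real
  assumes q: "0 \<le> q" "q \<le> r" and rs: "0 < r" "r \<le> s" and s: "s \<le> p"
    and sum: "p\<^sup>2 + q\<^sup>2 = r\<^sup>2 + s\<^sup>2"
  shows "cosh p * cosh q \<le> cosh r * cosh s"
proof -
  \<comment> \<open>\<open>\<tau> / 2\<close> is the slope of v \<mapsto> ln (cosh (sqrt v)) at v =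
    r^2, so \<open>F\<close> measures, up to a constant, the gap to the tangent there: it increases
    up to \<open>r\<close> and decreases afterwards. By \<open>sum\<close> the quadratic terms
    cancel.\<close>
  define \<tau> where "\<tau> = tanh r / r"
  define F where "F x = ln (cosh x) - \<tau> / 2 * x\<^sup>2" for x
  have F: "(F has_real_derivative tanh x - \<tau> * x) (at x)" for x
    unfolding F_def
    by (auto intro!: derivative_eq_intros simp: tanh_def)
  have "F q \<le> F r"
  proof (rule DERIV_nonneg_imp_nondecreasing[OF q(2)])
    fix x assume x: "q \<le> x" "x \<le> r"
    have "0 \<le> tanh x - \<tau> * x"
    proof (cases "x = 0")
      case False
      then show ?thesis
        using tanh_ratio_antimono[of x r] x q by (simp add: \<tau>_def le_divide_eq)
    qed simp
    then show "\<exists>D. (F has_real_derivative D) (at x) \<and> 0 \<le> D" using F by blast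
  qed
  moreover have "F p \<le> F s"
  proof (rule DERIV_nonpos_imp_nonincreasing[OF s])
    fix x assume x: "s \<le> x" "x \<le> p"
    have "tanh x - \<tau> * x \<le> 0"
      using tanh_ratio_antimono[of r x] x rs by (simp add: \<tau>_def divide_le_eq)
    then show "\<exists>D. (F has_real_derivative D) (at x) \<and> D \<le> 0" using F by blast
  qed
  moreover have "\<tau> / 2 * p\<^sup>2 + \<tau> / 2 * q\<^sup>2 = \<tau> / 2 * r\<^sup>2 + \<tau> / 2 * s\<^sup>2"
    using sum by (metis distrib_left)
  ultimately have "ln (cosh p) + ln (cosh q) \<le> ln (cosh r) + ln (cosh s)"
    unfolding F_def by linarith
  then have "ln (cosh p * cosh q) \<le> ln (cosh r * cosh s)" by (simp add: ln_mult)
  then show ?thesis by (subst (asm) ln_le_cancel_iff) auto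
qed

text \<open>\<open>S\<close> is the median of the Euclidean triangle with the same sides. Concavity
  shows that \<open>S\<close> over-fulfils the hyperbolic median relation, so
  \<open>s \<le> S\<close>.\<close>

lemma hyperbolic_midpoint_bound:
  fixes p q r s :: real
  assumes qr: "\<bar>q\<bar> \<le> r" and r: "0 < r" "r \<le> p" and s: "0 \<le> s" "cosh r * cosh s \<le> cosh p * cosh q"
  shows "s\<^sup>2 \<le> p\<^sup>2 + q\<^sup>2 - r\<^sup>2"
proof -
  define S where "S = sqrt (p\<^sup>2 + q\<^sup>2 - r\<^sup>2)"
  have q2: "q\<^sup>2 \<le> r\<^sup>2" using qr abs_le_square_iff[of q r] r by simp
  have r2: "r\<^sup>2 \<le> p\<^sup>2" using r by (intro power_mono) auto
  have "r\<^sup>2 + 0 \<le> p\<^sup>2 + q\<^sup>2" using r2 by (intro add_mono) auto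
  then have "0 \<le> p\<^sup>2 + q\<^sup>2 - r\<^sup>2" by (simp only: add_0_right diff_ge_0_iff_ge)
  then have S2: "S\<^sup>2 = p\<^sup>2 + q\<^sup>2 - r\<^sup>2" and S: "0 \<le> S" by (simp_all add: S_def)
  have "q\<^sup>2 \<le> S\<^sup>2" unfolding S2 using r2 by simp
  then have "\<bar>q\<bar> \<le> \<bar>S\<bar>" by (simp only: abs_le_square_iff)
  then have qS: "\<bar>q\<bar> \<le> S" using S by simp
  have "S\<^sup>2 \<le> p\<^sup>2" unfolding S2 using q2 by simp
  then have Sp: "S \<le> p" by (rule power2_le_imp_le) (use r in simp)
  have cq: "cosh \<bar>q\<bar> = cosh q" by (cases "0 \<le> q") auto
  have "cosh p * cosh q \<le> cosh r * cosh S"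
  \<comment> \<open>\<open>cosh_product_le\<close> needs its middle pair ordered, with positive
    smaller member: so \<open>r\<close> and \<open>S\<close> may trade places, and
    \<open>S = 0\<close> forces \<open>q = 0\<close> and \<open>p = r\<close>.\<close>
  proof (cases "r \<le> S")
    case True
    have "p\<^sup>2 + \<bar>q\<bar>\<^sup>2 = r\<^sup>2 + S\<^sup>2" unfolding S2 by simp
    then show ?thesis using cosh_product_le[of "\<bar>q\<bar>" r S p] qr r Sp True unfolding cq by simp
  next
    case False
    show ?thesis
    proof (cases "S = 0")
      case True
      then have "q = 0" using qS by simp
      moreover have "p\<^sup>2 = r\<^sup>2" using S2 unfolding \<open>S = 0\<close> \<open>q = 0\<close> by simp
      then have "p = r" by (rule power2_eq_imp_eq) (use r in auto)
      ultimately show ?thesis using True by simp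
    next
      case ne: False
      have "p\<^sup>2 + \<bar>q\<bar>\<^sup>2 = S\<^sup>2 + r\<^sup>2" unfolding S2 by simp
      moreover have "0 < S" "S \<le> r" using ne S False by simp_all
      ultimately have "cosh p * cosh q \<le> cosh S * cosh r"
        using cosh_product_le[of "\<bar>q\<bar>" S r p] qS r(2) unfolding cq by simp
      then show ?thesis by (simp only: mult.commute)
    qed
  qed
  then have "cosh r * cosh s \<le> cosh r * cosh S" using s by linarith
  then have "cosh s \<le> cosh S" by (simp add: mult_le_cancel_left)
  then have "s \<le> S" using s S by (simp add: cosh_real_nonneg_le_iff)
  then have "s\<^sup>2 \<le> S\<^sup>2" using s by (intro power_mono)
  then show ?thesis unfolding S2 .
qed

text \<open>The derivative \<open>tan x\<close> of -ln (cos x) lies between x and (tan R / R) x on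
  [0, R]. The lower bound is used from |q| to \<open>r\<close>, the upper one from \<open>s\<close>
  to \<open>p\<close>; comparing the two increments costs the factor \<open>R / tan R\<close> in
  front of \<open>r\<^sup>2\<close>.\<close>

lemma spherical_midpoint_bound:
  fixes p q r s R :: real
  assumes qr: "\<bar>q\<bar> \<le> r" and r: "0 < r" "r \<le> p" and R: "p \<le> R" "R < pi / 2"
    and s: "0 \<le> s" "s \<le> R" "cos p * cos q \<le> cos r * cos s"
  shows "s \<le> p" and "s\<^sup>2 \<le> p\<^sup>2 + q\<^sup>2 - R / tan R * r\<^sup>2"
proof -
  have cos_pos: "0 < cos x" if "0 \<le> x" "x \<le> R" for x
    using that R by (intro cos_gt_zero_pi) auto
  have cq: "cos \<bar>q\<bar> = cos q" by simp
  have "cos r \<le> cos q" using cos_monotone_0_pi_le[of "\<bar>q\<bar>" r] qr r R by simp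
  then have "cos p * cos r \<le> cos p * cos q" using cos_pos[of p] r R by (intro mult_left_mono) auto
  then have "cos r * cos p \<le> cos r * cos s" using s by (simp add: mult.commute)
  then have cps: "cos p \<le> cos s" using cos_pos[of r] r R by (simp add: mult_le_cancel_left)
  then show sp: "s \<le> p" using s r R cos_mono_le_eq[of p s] by auto
  define k where "k = tan R / R"
  have R0: "0 < R" using r R by simp
  have k1: "1 \<le> k" using le_tan[of R] R0 R by (simp add: k_def)
  define F where "F c x = - ln (cos x) - c / 2 * x\<^sup>2" for c x :: real
  have F: "(F c has_real_derivative tan x - c * x) (at x)" if "0 \<le> x" "x \<le> R" for x c
    unfolding F_def using cos_pos[OF that]
    by (auto intro!: derivative_eq_intros simp: tan_def)
  have 1: "F 1 \<bar>q\<bar> \<le> F 1 r"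
  proof (rule DERIV_nonneg_imp_nondecreasing[OF qr])
    fix x assume x: "\<bar>q\<bar> \<le> x" "x \<le> r"
    then have "0 \<le> x" "x \<le> R" using r R by linarith+
    then show "\<exists>D. (F 1 has_real_derivative D) (at x) \<and> 0 \<le> D"
      using F[of x 1] le_tan[of x] R by (intro exI[of _ "tan x - 1 * x"]) auto
  qed
  have 2: "F k p \<le> F k s"
  proof (rule DERIV_nonpos_imp_nonincreasing[OF sp])
    fix x assume x: "s \<le> x" "x \<le> p"
    then have xR: "0 \<le> x" "x \<le> R" using s R by linarith+
    have "tan x - k * x \<le> 0"
    proof (cases "x = 0")
      case False
      then show ?thesis using tan_ratio_mono[of x R] xR R by (simp add: k_def divide_le_eq)
    qed simp
    then show "\<exists>D. (F k has_real_derivative D) (at x) \<and> D \<le> 0"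
      using F[OF xR, of k] by blast
  qed
  have "ln (cos p * cos q) \<le> ln (cos r * cos s)"
    using s cos_pos[of p] cos_pos[of "\<bar>q\<bar>"] cos_pos[of r] cos_pos[of s] qr r R
    by (subst ln_le_cancel_iff) auto
  then have "ln (cos p) + ln (cos q) \<le> ln (cos r) + ln (cos s)"
    using s cos_pos[of p] cos_pos[of "\<bar>q\<bar>"] cos_pos[of r] cos_pos[of s] qr r R
    by (simp add: ln_mult)
  then have "r\<^sup>2 - q\<^sup>2 \<le> k * (p\<^sup>2 - s\<^sup>2)"
    using 1 2 unfolding F_def cq by (simp add: algebra_simps)
  then have "(r\<^sup>2 - q\<^sup>2) / k \<le> p\<^sup>2 - s\<^sup>2" using k1 by (simp add: divide_le_eq mult.commute)
  moreover have "q\<^sup>2 / k \<le> q\<^sup>2" using k1 by (simp add: divide_le_eq mult_le_cancel_left1)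
  ultimately have "s\<^sup>2 \<le> p\<^sup>2 + q\<^sup>2 - r\<^sup>2 / k" by (simp add: diff_divide_distrib)
  then show "s\<^sup>2 \<le> p\<^sup>2 + q\<^sup>2 - R / tan R * r\<^sup>2" by (simp add: k_def mult.commute)
qed

section \<open>Medians in CAT spaces\<close>

text \<open>In the theorem, \<open>R = pi / 2 - sqrt \<kappa> * \<rho>\<close>, so that \<open>tan (sqrt \<kappa> * \<rho>) = 1 / tan R\<close>.\<close>

definition curvature_constant ::
  "real \<Rightarrow> 'a set \<Rightarrow> ('a \<Rightarrow> 'a \<Rightarrow> real) \<Rightarrow> real \<Rightarrow> bool" where
  "curvature_constant \<kappa> X d c \<longleftrightarrow>
     \<kappa> \<le> 0 \<and> c = 2 \<or>
     0 < \<kappa> \<and> (\<exists>R. 0 < R \<and> R < pi / 2 \<and> (\<forall>x\<in>X. \<forall>y\<in>X. sqrt \<kappa> * d x y \<le> R) \<and> c = 2 * (R / tan R))"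

lemma curvature_constant_bounds:
  assumes "curvature_constant \<kappa> X d c"
  shows "0 < c" "c \<le> 2"
proof -
  have "0 < 2 * (R / tan R) \<and> 2 * (R / tan R) \<le> 2" if "0 < R" "R < pi / 2" for R :: real
  proof -
    have "0 < tan R" "R \<le> tan R" using that tan_gt_zero le_tan by auto
    then have "0 < R / tan R" "R / tan R \<le> 1" using that by simp_all
    then show ?thesis by linarith
  qed
  then have "0 < c \<and> c \<le> 2"
    using assms unfolding curvature_constant_def by (elim disjE conjE exE) simp_all
  then show "0 < c" "c \<le> 2" by simp_all
qed

text \<open>The one-variable bounds are homogeneous of degree 2, so the factor sqrt |kappa| cancels.
  The Euclidean coefficient 1/4 of the squared base appears as c / 8 with c = 2.\<close>

lemma CAT_midpoint:
  assumes CAT: "CAT_space \<kappa> X d" and c: "curvature_constant \<kappa> X d c"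
    and C: "z \<in> X" "m \<in> X" "x \<in> X" and S: "geodesic_segment X d z m S" "u \<in> S" "d z u = d z m / 2"
  shows "d x u \<le> (d x z + d x m) / 2"
    and "(d x u)\<^sup>2 \<le> ((d x z)\<^sup>2 + (d x m)\<^sup>2) / 2 - c / 8 * (d z m)\<^sup>2"
proof -
  interpret Metric_space X d using CAT by (simp add: CAT_space_def)
  define a b l where "a = d x z" and "b = d x m" and "l = d z m"
  have u: "u \<in> X" using S by (auto simp: geodesic_segment_def)
  have tri: "l \<le> a + b" "\<bar>a - b\<bar> \<le> l"
    using triangle[of z x m] triangle[of x z m] triangle[of x m z] C commute
    by (auto simp: abs_le_iff a_def b_def l_def)
  have nn: "0 \<le> a" "0 \<le> b" "0 \<le> l" by (simp_all add: a_def b_def l_def)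
  have "d x u \<le> (a + b) / 2 \<and> (d x u)\<^sup>2 \<le> (a\<^sup>2 + b\<^sup>2) / 2 - c / 8 * l\<^sup>2"
  proof (cases "l = 0")
    case True
    then have "z = m" "z = u" using S(3) C u by (auto simp: l_def)
    then show ?thesis using True by (simp add: a_def b_def)
  next
    case False
    then have l: "0 < d z m" using nn unfolding l_def by linarith
    have scaled: "(k * ((a + b) / 2))\<^sup>2 + (k * ((a - b) / 2))\<^sup>2 - \<beta> * (k * (l / 2))\<^sup>2
        = k\<^sup>2 * ((a\<^sup>2 + b\<^sup>2) / 2 - \<beta> / 4 * l\<^sup>2)" for k \<beta> :: real
      by (simp add: power2_eq_square field_simps)
    have ratio: "\<bar>k * ((a - b) / 2)\<bar> \<le> k * (l / 2)" "0 < k * (l / 2)" "k * (l / 2) \<le> k * ((a + b) / 2)"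
      if "0 < k" for k
      using that tri l by (auto simp: abs_mult l_def)
    show ?thesis
    proof (cases "\<kappa> \<le> 0")
      case \<kappa>: True
      then have c2: "c = 2" using c by (simp add: curvature_constant_def)
      have main: "(d x u)\<^sup>2 \<le> (a\<^sup>2 + b\<^sup>2) / 2 - l\<^sup>2 / 4"
      proof (cases "\<kappa> = 0")
        case True
        then show ?thesis using CAT_midpoint_zero[of X d z m x S u] CAT C S l
          by (simp add: a_def b_def l_def)
      next
        case False
        then have neg: "\<kappa> < 0" using \<kappa> by simp
        define k where "k = sqrt (- \<kappa>)"
        have k: "0 < k" using neg by (simp add: k_def)
        have "(k * d x u)\<^sup>2 \<le> (k * ((a + b) / 2))\<^sup>2 + (k * ((a - b) / 2))\<^sup>2 - (k * (l / 2))\<^sup>2"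
          using CAT_midpoint_neg[OF neg CAT C S l, folded k_def a_def b_def l_def] k
          by (intro hyperbolic_midpoint_bound ratio) auto
        also have "\<dots> = k\<^sup>2 * ((a\<^sup>2 + b\<^sup>2) / 2 - l\<^sup>2 / 4)" using scaled[of k 1] by simp
        finally show ?thesis using k by (simp add: power_mult_distrib)
      qed
      \<comment> \<open>With the full coefficient 1/4 the linear bound follows from the quadratic
        one, since (a - b)^2 \<le> l^2. In positive curvature the coefficient is smaller, so there
        the linear bound comes from \<open>spherical_midpoint_bound\<close> directly.\<close>
      have "\<bar>a - b\<bar> \<le> \<bar>l\<bar>" using tri by simp
      then have "(a - b)\<^sup>2 \<le> l\<^sup>2" by (simp only: abs_le_square_iff)
      then have "(a\<^sup>2 + b\<^sup>2) / 2 - l\<^sup>2 / 4 \<le> (a\<^sup>2 + b\<^sup>2) / 2 - (a - b)\<^sup>2 / 4"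
        by (intro diff_left_mono divide_right_mono) auto
      also have "\<dots> = ((a + b) / 2)\<^sup>2"
        by (simp add: power2_eq_square field_simps)
      finally have "(d x u)\<^sup>2 \<le> ((a + b) / 2)\<^sup>2" by (rule order_trans[OF main])
      then have "d x u \<le> (a + b) / 2" by (rule power2_le_imp_le) (use nn in simp)
      then show ?thesis using main c2 by simp
    next
      case False
      then have \<kappa>: "0 < \<kappa>" by simp
      then obtain R where R: "0 < R" "R < pi / 2" "\<And>x y. x \<in> X \<Longrightarrow> y \<in> X \<Longrightarrow> sqrt \<kappa> * d x y \<le> R"
        and c2: "c = 2 * (R / tan R)"
        using c by (auto simp: curvature_constant_def)
      define k where "k = sqrt \<kappa>"
      have k: "0 < k" using \<kappa> by (simp add: k_def)
      have small: "k * d x u \<le> R" "k * a \<le> R" "k * b \<le> R" "k * l \<le> R"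
        using R(3) C u by (simp_all add: k_def a_def b_def l_def)
      have pR: "k * ((a + b) / 2) \<le> R" using small by (simp add: distrib_left add_divide_distrib)
      have "cos (k * ((a + b) / 2)) * cos (k * ((a - b) / 2)) \<le> cos (k * (l / 2)) * cos (k * d x u)"
        using CAT_midpoint_pos[OF \<kappa> CAT C S l, folded k_def a_def b_def l_def] small R(2) by simp
      note bound = spherical_midpoint_bound[OF ratio[OF k] pR R(2) _ small(1) this]
      have "k * d x u \<le> k * ((a + b) / 2)" using bound(1) k by simp
      then have 1: "d x u \<le> (a + b) / 2" using k by simp
      have "(k * d x u)\<^sup>2 \<le> (k * ((a + b) / 2))\<^sup>2 + (k * ((a - b) / 2))\<^sup>2 - R / tan R * (k * (l / 2))\<^sup>2"
        using bound(2) k by simp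
      also have "\<dots> = k\<^sup>2 * ((a\<^sup>2 + b\<^sup>2) / 2 - R / tan R / 4 * l\<^sup>2)" by (rule scaled)
      finally have "(d x u)\<^sup>2 \<le> (a\<^sup>2 + b\<^sup>2) / 2 - R / tan R / 4 * l\<^sup>2"
        using k by (simp add: power_mult_distrib)
      then show ?thesis using 1 c2 by simp
    qed
  qed
  then show "d x u \<le> (d x z + d x m) / 2"
    and "(d x u)\<^sup>2 \<le> ((d x z)\<^sup>2 + (d x m)\<^sup>2) / 2 - c / 8 * (d z m)\<^sup>2"
    by (simp_all add: a_def b_def l_def)
qed

section \<open>Convexity of the distance along geodesics\<close>

text \<open>Subtract the chord and suppose the maximum of the difference is positive. Its leftmost
  maximiser \<open>y\<close> is interior, and midpoint convexity for \<open>y - h\<close> and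
  \<open>y + h\<close> fails because the value at \<open>y - h\<close> is strictly smaller.\<close>

lemma midpoint_convex_below_chord:
  fixes f :: "real \<Rightarrow> real"
  assumes cont: "continuous_on {0..l} f"
    and mid: "\<And>s t. 0 \<le> s \<Longrightarrow> s \<le> t \<Longrightarrow> t \<le> l \<Longrightarrow> f ((s + t) / 2) \<le> (f s + f t) / 2"
    and l: "0 \<le> l" and t: "0 \<le> t" "t \<le> 1"
  shows "f (t * l) \<le> (1 - t) * f 0 + t * f l"
proof (cases "l = 0")
  case False
  then have l: "0 < l" using l by simp
  define g where "g s = f s - ((1 - s / l) * f 0 + s / l * f l)" for s
  have cont_g: "continuous_on {0..l} g"
    unfolding g_def using l by (intro continuous_intros cont) auto
  have g0: "g 0 = 0" "g l = 0" using l by (simp_all add: g_def)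
  have midg: "g ((s + t) / 2) \<le> (g s + g t) / 2" if "0 \<le> s" "s \<le> t" "t \<le> l" for s t
  proof -
    have "(s + t) / 2 / l = (s / l + t / l) / 2" by (simp add: add_divide_distrib)
    then have "g ((s + t) / 2) = f ((s + t) / 2) - (f s + f t) / 2 + (g s + g t) / 2"
      unfolding g_def by (simp add: algebra_simps add_divide_distrib diff_divide_distrib)
    then show ?thesis using mid[OF that] by linarith
  qed
  obtain x where x: "x \<in> {0..l}" "\<And>y. y \<in> {0..l} \<Longrightarrow> g y \<le> g x"
    using continuous_attains_sup[of "{0..l}" g] cont_g l by auto
  let ?A = "{y \<in> {0..l}. g y = g x}"
  have "closed ?A" using continuous_closed_preimage_constant[OF cont_g, of "g x"] by simp
  moreover have "{0..l} \<inter> ?A = ?A" by blast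
  ultimately have "compact ?A" using compact_Int_closed[of "{0..l}" ?A] by simp
  moreover have "?A \<noteq> {}" using x by blast
  ultimately obtain y where y: "y \<in> ?A" "\<And>v. v \<in> ?A \<Longrightarrow> y \<le> v"
    using compact_attains_inf[of ?A] by blast
  have "g x \<le> 0"
  proof (rule ccontr)
    assume "\<not> g x \<le> 0"
    then have "0 < y" "y < l" using y(1) g0 by (auto simp: order_less_le)
    define h where "h = min y (l - y)"
    have h: "0 < h" "h \<le> y" "h \<le> l - y" using \<open>0 < y\<close> \<open>y < l\<close> by (auto simp: h_def)
    have "g ((y - h + (y + h)) / 2) \<le> (g (y - h) + g (y + h)) / 2"
      using h by (intro midg) auto
    moreover have "g (y + h) \<le> g x" using x(2)[of "y + h"] h y(1) by auto
    moreover have "g (y - h) < g x"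
      using x(2)[of "y - h"] y(2)[of "y - h"] h y(1) by (auto simp: order_less_le)
    ultimately show False using y(1) by simp
  qed
  moreover have "t * l \<in> {0..l}" using t l by (simp add: mult_left_le_one_le)
  ultimately have "g (t * l) \<le> 0" using x(2)[of "t * l"] by linarith
  then show ?thesis using l by (simp add: g_def)
qed (use t in \<open>simp add: algebra_simps\<close>)

text \<open>Along the geodesic the distance to \<open>w\<close> is 1-Lipschitz, and it is midpoint
  convex because \<open>CAT_midpoint\<close> applies to every subsegment.\<close>

lemma CAT_conv_point:
  assumes CAT: "CAT_space \<kappa> X d" and cc: "curvature_constant \<kappa> X d k"
    and C: "x \<in> X" "z \<in> X" and S: "geodesic_segment X d x z S" and t: "0 \<le> t" "t \<le> 1"
  shows "\<exists>m. conv_point X d x z t m"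
proof -
  interpret Metric_space X d using CAT by (simp add: CAT_space_def)
  define l where "l = d x z"
  have l: "0 \<le> l" by (simp add: l_def)
  obtain c where "c ` {0..l} = S" "S \<subseteq> X" and c: "c 0 = x" "c l = z"
    "\<And>s t. s \<in> {0..l} \<Longrightarrow> t \<in> {0..l} \<Longrightarrow> d (c s) (c t) = \<bar>s - t\<bar>"
    using S unfolding geodesic_segment_def l_def by blast
  then have cX: "c s \<in> X" if "0 \<le> s" "s \<le> l" for s using that by auto
  have "d w (c (t * l)) \<le> (1 - t) * d w x + t * d w z" if w: "w \<in> X" for w
  proof -
    have "d w (c (t * l)) \<le> (1 - t) * d w (c 0) + t * d w (c l)"
    proof (rule midpoint_convex_below_chord[where f = "\<lambda>s. d w (c s)", OF _ _ l t])
      have "1-lipschitz_on {0..l} (\<lambda>s. d w (c s))"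
      proof (rule lipschitz_onI)
        fix s t assume st: "s \<in> {0..l}" "t \<in> {0..l}"
        have "d w (c s) \<le> d w (c t) + d (c t) (c s)" "d w (c t) \<le> d w (c s) + d (c s) (c t)"
          using triangle[OF w cX cX, of t s] triangle[OF w cX cX, of s t] st by simp_all
        then show "dist (d w (c s)) (d w (c t)) \<le> 1 * dist s t"
          using c(3)[OF st] commute[of "c s" "c t"] by (auto simp: dist_real_def)
      qed simp
      then show "continuous_on {0..l} (\<lambda>s. d w (c s))" by (rule lipschitz_on_continuous_on)
      fix s t assume st: "0 \<le> s" "s \<le> t" "t \<le> l"
      have dst: "d (c s) (c t) = t - s" using c(3)[of s t] st by auto
      have "geodesic_segment X d (c s) (c t) ((\<lambda>r. c (s + r)) ` {0..d (c s) (c t)})"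
        using st by (intro geodesic_segmentI cX) (auto simp: dst c(3))
      moreover have "c ((s + t) / 2) \<in> (\<lambda>r. c (s + r)) ` {0..d (c s) (c t)}"
        using st by (intro image_eqI[of _ _ "(t - s) / 2"]) (auto simp: dst field_simps)
      moreover have "d (c s) (c ((s + t) / 2)) = d (c s) (c t) / 2"
        using c(3)[of s "(s + t) / 2"] st by (auto simp: dst field_simps)
      ultimately show "d w (c ((s + t) / 2)) \<le> (d w (c s) + d w (c t)) / 2"
        using st w by (intro CAT_midpoint(1)[OF CAT cc]) (auto intro: cX)
    qed
    then show ?thesis using c by simp
  qed
  moreover have "c (t * l) \<in> X" using t l by (intro cX) (auto simp: mult_left_le_one_le)
  ultimately show ?thesis unfolding conv_point_def by blast
qed

section \<open>The explicit modulus in CAT spaces, and the theorem\<close>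

lemma CAT_uniqueness_modulus:
  assumes CAT: "CAT_space \<kappa> X d" and cc: "curvature_constant \<kappa> X d c"
  shows "uniqueness_modulus X d (Phi_CAT c)"
proof -
  interpret Metric_space X d using CAT by (simp add: CAT_space_def)
  note c = curvature_constant_bounds[OF cc]
  have geo: "\<exists>S. geodesic_segment X d x y S" if "x \<in> X" "y \<in> X" for x y
  proof (rule CAT_geodesic[OF CAT that])
    show "d x y < pi / sqrt \<kappa>" if "0 < \<kappa>"
    proof -
      obtain R where "R < pi / 2" "sqrt \<kappa> * d x y \<le> R"
        using cc \<open>x \<in> X\<close> \<open>y \<in> X\<close> \<open>0 < \<kappa>\<close> by (auto simp: curvature_constant_def)
      then have "sqrt \<kappa> * d x y < pi" using pi_gt_zero by linarith
      then show ?thesis using \<open>0 < \<kappa>\<close> by (simp add: pos_less_divide_eq mult.commute)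
    qed
  qed
  have midpoint: "\<exists>u\<in>X. \<forall>x\<in>X. \<forall>s>0. d x y \<le> s \<and> d x m \<le> s \<longrightarrow>
               d x u \<le> s - c / 16 * (d y m powr 2 / s powr (2 - 1))"
    if ym: "y \<in> X" "m \<in> X" for y m
  proof -
    obtain S where S: "geodesic_segment X d y m S" using geo ym by blast
    then obtain \<gamma> where \<gamma>: "\<gamma> ` {0..d y m} = S" "S \<subseteq> X" "\<gamma> 0 = y"
      "\<And>s t. s \<in> {0..d y m} \<Longrightarrow> t \<in> {0..d y m} \<Longrightarrow> d (\<gamma> s) (\<gamma> t) = \<bar>s - t\<bar>"
      unfolding geodesic_segment_def by blast
    define u where "u = \<gamma> (d y m / 2)"
    have uS: "u \<in> S" using \<gamma>(1) by (auto simp: u_def)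
    have yu: "d y u = d y m / 2" using \<gamma>(4)[of 0 "d y m / 2"] \<gamma>(3) by (simp add: u_def)
    have "d x u \<le> s - c / 16 * (d y m powr 2 / s powr (2 - 1))"
      if x: "x \<in> X" and s: "0 < s" and le: "d x y \<le> s" "d x m \<le> s" for x s
    proof -
      define D where "D = d y m"
      have "(d x y)\<^sup>2 \<le> s\<^sup>2" "(d x m)\<^sup>2 \<le> s\<^sup>2" using le by (auto intro: power_mono)
      then have "((d x y)\<^sup>2 + (d x m)\<^sup>2) / 2 \<le> s\<^sup>2" by simp
      then have sq: "(d x u)\<^sup>2 \<le> s\<^sup>2 - c / 8 * D\<^sup>2"
        unfolding D_def
        by (rule order_trans[OF CAT_midpoint(2)[OF CAT cc ym x S uS yu] diff_right_mono])
      \<comment> \<open>The linear gain sought; from here on the name hides the carrier. Completing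
        the square in s^2 - 2 s X turns the coefficient c / 8 of the squares into c / 16, and taking
        roots requires \<open>X \<le> s\<close>.\<close>
      define X where "X = c / 16 * (D\<^sup>2 / s)"
      have cD: "c / 8 * D\<^sup>2 = 2 * (s * X)" using s by (simp add: X_def)
      have "0 \<le> s\<^sup>2 - 2 * (s * X)" by (rule order_trans[OF zero_le_power2 sq[unfolded cD]])
      then have "2 * (s * X) \<le> s * s" by (simp add: power2_eq_square)
      then have "2 * X \<le> s" using s by (metis mult.left_commute mult_le_cancel_left_pos)
      moreover have "0 \<le> X" using c s by (simp add: X_def)
      ultimately have Xs: "0 \<le> s - X" by linarith
      have "(d x u)\<^sup>2 \<le> s\<^sup>2 - 2 * (s * X) + X\<^sup>2"
        using sq unfolding cD by (rule order_trans) simp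
      also have "\<dots> = (s - X)\<^sup>2" by (simp add: power2_diff)
      finally have "d x u \<le> s - X" using Xs by (rule power2_le_imp_le)
      then show ?thesis using s by (simp add: X_def D_def)
    qed
    moreover have "u \<in> X" using uS \<gamma>(2) by blast
    ultimately show ?thesis by blast
  qed
  show ?thesis
  proof (rule power_type_uniqueness_modulus[OF Metric_space_axioms _ midpoint, where k' = "c / 16"])
    show "\<exists>m. conv_point X d x z t m" if "x \<in> X" "z \<in> X" "0 \<le> t" "t \<le> 1" for x z t
      using geo[OF that(1,2)] CAT_conv_point[OF CAT cc that(1,2) _ that(3,4)] by blast
    show "Phi_CAT c e b = c / 16 * (e powr 2 / (b + e) powr (2 - 1))" if "0 < e" "0 < b" for e b
      using that by (simp add: Phi_CAT_def)
  qed (use c in auto)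
qed

lemma curvature_constant_set_diam:
  assumes X: "Metric_space X d" "Metric_space.mbounded X d X" and diam: "0 < set_diam X d"
    and c: "\<kappa> \<le> 0 \<and> c = 2 \<or>
         0 < \<kappa> \<and> set_diam X d < pi / (2 * sqrt \<kappa>) \<and>
         (\<exists>\<rho>. 0 < \<rho> \<and> \<rho> \<le> pi / (2 * sqrt \<kappa>) - set_diam X d \<and>
              c = (pi - 2 * sqrt \<kappa> * \<rho>) * tan (sqrt \<kappa> * \<rho>))"
  shows "curvature_constant \<kappa> X d c"
proof (cases "\<kappa> \<le> 0")
  case False
  then have \<kappa>: "0 < \<kappa>" by simp
  then have "\<not> (\<kappa> \<le> 0 \<and> c = 2)" by simp
  then obtain \<rho> where \<rho>: "0 < \<rho>" "\<rho> \<le> pi / (2 * sqrt \<kappa>) - set_diam X d"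
    "c = (pi - 2 * sqrt \<kappa> * \<rho>) * tan (sqrt \<kappa> * \<rho>)" using c by blast
  define R where "R = pi / 2 - sqrt \<kappa> * \<rho>"
  have "sqrt \<kappa> * \<rho> \<le> sqrt \<kappa> * (pi / (2 * sqrt \<kappa>) - set_diam X d)"
    using \<rho>(2) \<kappa> by (intro mult_left_mono) auto
  also have "\<dots> = pi / 2 - sqrt \<kappa> * set_diam X d"
    using \<kappa> by (simp add: right_diff_distrib)
  finally have le: "sqrt \<kappa> * set_diam X d \<le> R" by (simp add: R_def)
  \<comment> \<open>The positive diameter keeps \<open>R\<close>, and with it \<open>tan R\<close>,
    away from 0.\<close>
  have "0 < sqrt \<kappa> * set_diam X d" using \<kappa> diam by simp
  then have R0: "0 < R" using le by linarith
  have R1: "R < pi / 2" using \<kappa> \<rho>(1) by (simp add: R_def)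
  have "sqrt \<kappa> * d x y \<le> R" if "x \<in> X" "y \<in> X" for x y
  proof -
    have "sqrt \<kappa> * d x y \<le> sqrt \<kappa> * set_diam X d"
      using \<kappa> by (intro mult_left_mono dist_le_set_diam[OF X that]) auto
    then show ?thesis using le by linarith
  qed
  moreover have "c = 2 * (R / tan R)"
  proof -
    have "tan (sqrt \<kappa> * \<rho>) = tan (pi / 2 - R)" by (simp add: R_def)
    also have "\<dots> = inverse (tan R)" by (rule tan_cot)
    finally have "tan (sqrt \<kappa> * \<rho>) = inverse (tan R)" .
    moreover have "pi - 2 * sqrt \<kappa> * \<rho> = 2 * R" by (simp add: R_def)
    ultimately show ?thesis unfolding \<rho>(3) by (simp only: divide_inverse mult.assoc)
  qed
  ultimately show ?thesis using \<kappa> R0 R1 unfolding curvature_constant_def by blast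
next
  case True
  then have "c = 2" using c by linarith
  then show ?thesis using True by (simp add: curvature_constant_def)
qed

theorem mainTheorem3:
  shows
    "(\<forall>(\<mu> :: 'x measure) (p :: real) (C :: ('x \<Rightarrow> real) set set).
        1 < p \<and> C \<subseteq> Lp_space \<mu> p \<and> C \<noteq> {} \<and> Lp_convex \<mu> C \<and>
        Metric_space.mbounded (Lp_space \<mu> p) (Lp_dist \<mu> p) C \<and>
        0 < set_diam C (Lp_dist \<mu> p)
        \<longrightarrow>
        uniform_betweenness_modulus C (Lp_dist \<mu> p) (Theta_of (Phi_Lp p)) \<and>
        explicit_rate C (Lp_dist \<mu> p) (Theta_of (Phi_Lp p)) \<and>
        lion_always_wins C (Lp_dist \<mu> p))
     \<and>
     (\<forall>(\<kappa> :: real) (c :: real) (C :: 'a set) (d :: 'a \<Rightarrow> 'a \<Rightarrow> real).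
        CAT_space \<kappa> C d \<and> Metric_space.mbounded C d C \<and> 0 < set_diam C d \<and>
        (\<kappa> \<le> 0 \<and> c = 2 \<or>
         0 < \<kappa> \<and> set_diam C d < pi / (2 * sqrt \<kappa>) \<and>
         (\<exists>\<rho>. 0 < \<rho> \<and> \<rho> \<le> pi / (2 * sqrt \<kappa>) - set_diam C d \<and>
              c = (pi - 2 * sqrt \<kappa> * \<rho>) * tan (sqrt \<kappa> * \<rho>)))
        \<longrightarrow>
        uniform_betweenness_modulus C d (Theta_of (Phi_CAT c)) \<and>
        explicit_rate C d (Theta_of (Phi_CAT c)) \<and>
        lion_always_wins C d)
     \<and>
     (uniformly_convex TYPE('v :: real_normed_vector) \<longrightarrow>
        (\<forall>C :: 'v set. convex C \<and> bounded C \<longrightarrow> lion_always_wins C dist))"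
proof (rule conjI[OF _ conjI], goal_cases)
  case 1
  show ?case
  proof (intro allI impI, elim conjE, goal_cases)
    case (1 \<mu> p C)
    from \<open>1 < p\<close> have "Metric_space (Lp_space \<mu> p) (Lp_dist \<mu> p)"
      by (rule Metric_space_Lp)
    moreover from 1 have "uniqueness_modulus C (Lp_dist \<mu> p) (Phi_Lp p)"
      by (intro Lp_uniqueness_modulus)
    ultimately show ?case
      using 1 by (intro modulus_rate_and_win)
  qed
next
  case 2
  show ?case
  proof (intro allI impI, goal_cases)
    case (1 \<kappa> c C d)
    then have CAT: "CAT_space \<kappa> C d" and bounded: "Metric_space.mbounded C d C"
      and diam: "0 < set_diam C d" by blast+
    have metric: "Metric_space C d" using CAT by (simp add: CAT_space_def)
    have "curvature_constant \<kappa> C d c"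
      using curvature_constant_set_diam[OF metric bounded diam] 1 by blast
    then show ?case
      by (intro modulus_rate_and_win[OF metric bounded diam] CAT_uniqueness_modulus[OF CAT])
  qed
next
  case 3
  show ?case using lion_always_wins_uniformly_convex by blast
qed

end
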